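(* Let $m>0$, let $\Omega\subset\mathbb{R}^3$ be an open bounded set with Lipschitz boundary, and let $A:\mathbb{R}^3\to\mathbb{R}^3$ be a continuous vector field with locally bounded gradient such that $A\in C^2(\overline{\Omega},\mathbb{R}^3)$. Then, for every $u\in H^1_A(\Omega,\mathbb{C})$, $$\lim_{s\nearrow 1}\frac{C_s}{2}m^{\frac{3+2s}{2}}\int_{\Omega\times\Omega}\frac{\left|u(x)-e^{i(x-y)\cdot A\left(\frac{x+y}{2}\right)}u(y)\right|^2}{|x-y|^{\frac{3+2s}{2}}}\,\mathcal{K}_{\frac{3+2s}{2}}(m|x-y|)\,dx\,dy=\int_\Omega|\nabla_A u|^2\,dx .$$
   Context: For $s\in(0,1)$, $C_s:=\dfrac{s\,2^{\frac{2s-1}{2}}}{\pi^{3/2}\,\Gamma(1-s)}$, where $\Gamma$ is the Gamma function. $\mathcal{K}_\nu$ is the modified Bessel function (also called MacDonald function, or modified Bessel function of the second/third kind) of order $\nu$: $\mathcal{K}_\nu(\zeta)=\frac12\left(\frac{\zeta}{2}\right)^\nu\int_0^{+\infty}e^{-\frac{\zeta^2}{4t}-t}t^{-1-\nu}\,dt$ for $\zeta>0$. $\nabla_A u:=(\nabla-iA)u$ (weak gradient), and $H^1_A(\Omega,\mathbb{C})$ is the space of all $u\in L^2(\Omega,\mathbb{C})$ with $\int_\Omega|\nabla_A u|^2\,dx<+\infty$. "Locally bounded gradient" means that $\nabla A$ exists and is bounded on every compact set. *)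

theory Defs
  imports "HOL-Analysis.Analysis"
begin

definition has_partial_derivative ::
    "(real^'n \<Rightarrow> 'b::real_normed_vector) \<Rightarrow> 'n \<Rightarrow> real^'n \<Rightarrow> 'b \<Rightarrow> bool" where
  "has_partial_derivative f j x d \<longleftrightarrow>
     ((\<lambda>t. f (x + t *\<^sub>R axis j 1)) has_vector_derivative d) (at 0)"

text \<open>The space \<open>C\<^sup>k(closure S)\<close> for open \<open>S\<close>: all partial derivatives of order at most \<open>k\<close>
  exist in \<open>S\<close> and extend continuously to \<open>closure S\<close>; outside \<open>S\<close>, the witnesses \<open>D j\<close> carry the
  extension.  For \<open>S = UNIV\<close> this is the usual \<open>C\<^sup>k\<close> on the whole space.\<close>

primrec C_closure ::
    "nat \<Rightarrow> (real^'n) set \<Rightarrow> (real^'n \<Rightarrow> 'b::real_normed_vector) \<Rightarrow> bool" where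
  "C_closure 0 S f \<longleftrightarrow> continuous_on (closure S) f"
| "C_closure (Suc k) S f \<longleftrightarrow> continuous_on (closure S) f \<and>
     (\<exists>D. \<forall>j. (\<forall>x\<in>S. has_partial_derivative f j x (D j x)) \<and> C_closure k S (D j))"

definition locally_bounded_gradient :: "(real^'n \<Rightarrow> 'b::real_normed_vector) \<Rightarrow> bool" where
  "locally_bounded_gradient f \<longleftrightarrow>
     (\<exists>D. \<forall>j. (\<forall>x. has_partial_derivative f j x (D j x)) \<and>
        (\<forall>K. compact K \<longrightarrow> bounded (D j ` K)))"

text \<open>Near each boundary point, \<open>S\<close> is the strict epigraph of a Lipschitz function over the
  hyperplane orthogonal to some unit vector \<open>e\<close>, which plays the role of the last coordinate
  direction after a rotation.\<close>

definition lipschitz_boundary :: "(real^'n) set \<Rightarrow> bool" where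
  "lipschitz_boundary S \<longleftrightarrow>
     (\<forall>p\<in>frontier S. \<exists>r>0. \<exists>e \<gamma> L. norm e = 1 \<and> L-lipschitz_on {v. v \<bullet> e = 0} \<gamma> \<and>
        S \<inter> ball p r = {x \<in> ball p r. \<gamma> (x - (x \<bullet> e) *\<^sub>R e) < x \<bullet> e})"

definition test_function :: "(real^'n) set \<Rightarrow> (real^'n \<Rightarrow> real) \<Rightarrow> bool" where
  "test_function S \<phi> \<longleftrightarrow> (\<forall>k. C_closure k UNIV \<phi>) \<and>
     compact (closure {x. \<phi> x \<noteq> 0}) \<and> closure {x. \<phi> x \<noteq> 0} \<subseteq> S"

definition has_weak_gradient ::
    "(real^'n) set \<Rightarrow> (real^'n \<Rightarrow> complex) \<Rightarrow> (real^'n \<Rightarrow> complex^'n) \<Rightarrow> bool" where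
  "has_weak_gradient S u g \<longleftrightarrow>
     (\<forall>j. (\<forall>K. compact K \<and> K \<subseteq> S \<longrightarrow> set_integrable lebesgue K (\<lambda>x. g x $ j)) \<and>
        (\<forall>\<phi> \<psi>. test_function S \<phi> \<and> (\<forall>x. has_partial_derivative \<phi> j x (\<psi> x)) \<longrightarrow>
           (LINT x:S|lebesgue. \<psi> x *\<^sub>R u x) = - (LINT x:S|lebesgue. \<phi> x *\<^sub>R (g x $ j))))"

text \<open>The weak gradient is unique up to null sets; this picks one representative.\<close>

definition weak_gradient ::
    "(real^'n) set \<Rightarrow> (real^'n \<Rightarrow> complex) \<Rightarrow> real^'n \<Rightarrow> complex^'n" where
  "weak_gradient S u = (SOME g. has_weak_gradient S u g)"

definition magnetic_gradient ::
    "(real^'n) set \<Rightarrow> (real^'n \<Rightarrow> real^'n) \<Rightarrow> (real^'n \<Rightarrow> complex) \<Rightarrow> real^'n \<Rightarrow> complex^'n" where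
  "magnetic_gradient S A u x =
     (\<chi> j. weak_gradient S u x $ j - \<i> * complex_of_real (A x $ j) * u x)"

definition L2_on :: "(real^'n) set \<Rightarrow> (real^'n \<Rightarrow> complex) set" where
  "L2_on S = {u. u \<in> borel_measurable (lebesgue_on S) \<and>
     (\<integral>\<^sup>+x\<in>S. ennreal ((cmod (u x))\<^sup>2) \<partial>lebesgue) < \<infinity>}"

definition H1_magnetic ::
    "(real^'n) set \<Rightarrow> (real^'n \<Rightarrow> real^'n) \<Rightarrow> (real^'n \<Rightarrow> complex) set" where
  "H1_magnetic S A = {u \<in> L2_on S. (\<exists>g. has_weak_gradient S u g) \<and>
     (\<integral>\<^sup>+x\<in>S. ennreal ((norm (magnetic_gradient S A u x))\<^sup>2) \<partial>lebesgue) < \<infinity>}"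

definition C_const :: "real \<Rightarrow> real" where
  "C_const s = s * 2 powr ((2 * s - 1) / 2) / (pi powr (3 / 2) * Gamma (1 - s))"

text \<open>Modified Bessel function of order \<open>\<nu>\<close>, meaningful for \<open>\<zeta> > 0\<close>.\<close>

definition bessel_K :: "real \<Rightarrow> real \<Rightarrow> real" where
  "bessel_K \<nu> \<zeta> = 1 / 2 * (\<zeta> / 2) powr \<nu> *
     (LINT t:{0<..}|lebesgue. exp (- (\<zeta>\<^sup>2 / (4 * t)) - t) * t powr (- 1 - \<nu>))"

end

theory Submission
  imports Defs "HOL-Probability.Characteristic_Functions"
begin

text \<open>The weight in the double integral is a mixture of heat kernels.  With \<open>\<nu> = 3/2 + s\<close>, inserting the
integral formula for the Bessel function into
\<open>k\<^sub>s(v) = (C\<^sub>s / 2) m\<^sup>\<nu> |v|\<^sup>-\<^sup>\<nu> K\<^sub>\<nu>(m |v|)\<close> exhibits \<open>k\<^sub>s\<close> as an integral over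
\<open>t > 0\<close> of centred Gaussians of variance \<open>2t / m\<^sup>2\<close>.  All moments of \<open>k\<^sub>s\<close> are therefore Gamma
integrals: \<open>\<integral> k\<^sub>s(v) |v \<bullet> w|\<^sup>2 dv = s m\<^sup>2\<^sup>s\<^sup>-\<^sup>2 |w|\<^sup>2\<close>
(\<open>bessel_kernel_dot_moment\<close>), which tends to \<open>|w|\<^sup>2\<close> as \<open>s\<close> tends to 1, whereas the fourth moment is
of order \<open>1 - s\<close> (\<open>bessel_kernel_fourth_moment\<close>).  So the measures \<open>k\<^sub>s(v) |v|\<^sup>2 dv\<close> concentrate at
the origin, and the constant \<open>C\<^sub>s\<close> is exactly the one for which the limit has no extra factor.

After the substitution \<open>y = x + v\<close> the functional reads \<open>\<integral> k\<^sub>s(v) P(v) dv\<close>, where \<open>P(v)\<close> is the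
squared mean-square norm in \<open>x\<close> of the twisted difference of \<open>u\<close>.  It remains to see that this
difference equals \<open>v \<bullet> \<nabla>\<^sub>A u + o(|v|)\<close> in the mean square, with an error that is also bounded by a
constant times \<open>|v|\<close> for all \<open>v\<close> (\<open>remainder_small\<close>, \<open>remainder_bounded\<close>).  By the concentration of
the kernel the error then contributes nothing in the limit, by isotropy the main term contributes
the integral of \<open>|\<nabla>\<^sub>A u|\<^sup>2\<close>, and Young's inequality in both directions joins the two
(\<open>nonlocal_energy_tendsto\<close>).

The expansion rests on three facts.  First, for almost every \<open>x\<close> such that the segment from \<open>x\<close> to
\<open>x + v\<close> lies in the domain, \<open>u(x + v) - u(x)\<close> is the integral of \<open>v \<bullet> \<nabla>u\<close> over the segment
(\<open>segment_identity\<close>); this is the definition of the weak gradient, tested against translates of one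
bump function and integrated over the translation.  Second, translations are continuous in the mean
square (\<open>l2_imp_shift_continuous\<close>), so that \<open>\<nabla>u\<close> along the segment may be replaced by \<open>\<nabla>u(x)\<close>.
Third, in a bounded Lipschitz domain any two close points \<open>x\<close> and \<open>x + v\<close> are joined by a path of
three segments inside the domain whose outer legs are translates of each other, traversed in opposite
directions, and whose middle leg is a translate of \<open>v\<close> (\<open>lipschitz_boundary_detours\<close>).  To first order the outer
legs cancel, so the expansion holds up to the boundary although the straight segment may leave the
domain (\<open>detour_difference_bound\<close>).  This takes the place of an extension of \<open>u\<close> to the whole space.
Finally, if \<open>x + v\<close> is outside the domain, the gradient extended by zero vanishes there, so its value
at \<open>x\<close> is itself a translation difference.\<close>

section \<open>Continuity of translations in the mean square\<close>

text \<open>The squared mean-square norm as an extended real.  It is defined for every measurable function,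
so Tonelli's theorem and monotonicity apply to it without integrability side conditions.\<close>

definition l2sq :: "('a::euclidean_space \<Rightarrow> 'b::real_normed_vector) \<Rightarrow> ennreal" where
  "l2sq f = (\<integral>\<^sup>+x. ennreal ((norm (f x))\<^sup>2) \<partial>lborel)"

lemma nn_integral_translate:
  fixes f :: "'a::euclidean_space \<Rightarrow> ennreal"
  assumes [measurable]: "f \<in> borel_measurable borel"
  shows "(\<integral>\<^sup>+x. f (x + w) \<partial>lborel) = (\<integral>\<^sup>+x. f x \<partial>lborel)"
proof -
  have "(\<integral>\<^sup>+x. f x \<partial>lborel) = (\<integral>\<^sup>+x. f x \<partial>distr lborel borel ((+) w))"
    by (simp add: lborel_distr_plus)
  also have "\<dots> = (\<integral>\<^sup>+x. f (w + x) \<partial>lborel)"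
    by (subst nn_integral_distr) auto
  finally show ?thesis by (simp add: add.commute)
qed

lemma AE_translate:
  fixes P :: "'a::euclidean_space \<Rightarrow> bool"
  assumes "AE x in lborel. P x"
  shows "AE x in lborel. P (x + w)"
proof -
  have "AE x in distr lborel borel ((+) w). P x"
    unfolding lborel_distr_plus by (rule assms)
  then have "AE x in lborel. P (w + x)"
    by (intro AE_distrD[of "(+) w" lborel borel]) auto
  then show ?thesis by (simp add: add.commute)
qed

lemma l2sq_translate:
  fixes f :: "'a::euclidean_space \<Rightarrow> 'b::real_normed_vector"
  assumes [measurable]: "f \<in> borel_measurable borel"
  shows "l2sq (\<lambda>x. f (x + w)) = l2sq f"
  unfolding l2sq_def by (rule nn_integral_translate[of "\<lambda>x. ennreal ((norm (f x))\<^sup>2)"]) measurable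

lemma norm_add_square_le:
  fixes a b :: "'b::real_normed_vector"
  shows "(norm (a + b))\<^sup>2 \<le> 2 * (norm a)\<^sup>2 + 2 * (norm b)\<^sup>2"
proof -
  have "(norm (a + b))\<^sup>2 \<le> (norm a + norm b)\<^sup>2"
    by (intro power_mono norm_triangle_ineq) auto
  also have "\<dots> \<le> 2 * (norm a)\<^sup>2 + 2 * (norm b)\<^sup>2"
    using sum_squares_bound[of "norm a" "norm b"] by (simp add: power2_sum)
  finally show ?thesis .
qed

lemma l2sq_add_le:
  fixes f g :: "'a::euclidean_space \<Rightarrow> 'b::{real_normed_vector, second_countable_topology}"
  assumes [measurable]: "f \<in> borel_measurable borel" "g \<in> borel_measurable borel"
  shows "l2sq (\<lambda>x. f x + g x) \<le> 2 * l2sq f + 2 * l2sq g"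
proof -
  have "l2sq (\<lambda>x. f x + g x) \<le> (\<integral>\<^sup>+x. 2 * ennreal ((norm (f x))\<^sup>2) + 2 * ennreal ((norm (g x))\<^sup>2) \<partial>lborel)"
    unfolding l2sq_def
  proof (rule nn_integral_mono)
    fix x
    have "ennreal ((norm (f x + g x))\<^sup>2) \<le> ennreal (2 * (norm (f x))\<^sup>2 + 2 * (norm (g x))\<^sup>2)"
      by (intro ennreal_leI norm_add_square_le)
    then show "ennreal ((norm (f x + g x))\<^sup>2) \<le> 2 * ennreal ((norm (f x))\<^sup>2) + 2 * ennreal ((norm (g x))\<^sup>2)"
      by (simp add: ennreal_mult')
  qed
  also have "\<dots> = 2 * l2sq f + 2 * l2sq g"
    unfolding l2sq_def by (subst nn_integral_add) (auto simp: nn_integral_cmult)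
  finally show ?thesis .
qed

lemma l2sq_uminus: "l2sq (\<lambda>x. - f x) = l2sq f"
  by (simp add: l2sq_def)

lemma l2sq_minus_commute: "l2sq (\<lambda>x. f x - g x) = l2sq (\<lambda>x. g x - f x)"
  by (simp add: l2sq_def norm_minus_commute)

definition l2_shift_continuous :: "('a::euclidean_space \<Rightarrow> 'b::real_normed_vector) \<Rightarrow> bool" where
  "l2_shift_continuous f \<longleftrightarrow> ((\<lambda>w. l2sq (\<lambda>x. f (x + w) - f x)) \<longlongrightarrow> 0) (at 0)"

lemma l2_shift_continuous_add:
  fixes f g :: "'a::euclidean_space \<Rightarrow> 'b::{real_normed_vector, second_countable_topology}"
  assumes [measurable]: "f \<in> borel_measurable borel" "g \<in> borel_measurable borel"
    and "l2_shift_continuous f" "l2_shift_continuous g"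
  shows "l2_shift_continuous (\<lambda>x. f x + g x)"
  unfolding l2_shift_continuous_def
proof (rule tendsto_sandwich[OF _ _ tendsto_const])
  show "\<forall>\<^sub>F w in at 0. l2sq (\<lambda>x. f (x + w) + g (x + w) - (f x + g x))
      \<le> 2 * l2sq (\<lambda>x. f (x + w) - f x) + 2 * l2sq (\<lambda>x. g (x + w) - g x)"
  proof (intro always_eventually allI)
    fix w
    show "l2sq (\<lambda>x. f (x + w) + g (x + w) - (f x + g x))
      \<le> 2 * l2sq (\<lambda>x. f (x + w) - f x) + 2 * l2sq (\<lambda>x. g (x + w) - g x)"
      using l2sq_add_le[of "\<lambda>x. f (x + w) - f x" "\<lambda>x. g (x + w) - g x"]
      by (simp add: algebra_simps)
  qed
  have "((\<lambda>w. 2 * l2sq (\<lambda>x. f (x + w) - f x) + 2 * l2sq (\<lambda>x. g (x + w) - g x)) \<longlongrightarrow> 2 * 0 + 2 * 0) (at 0)"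
    using assms unfolding l2_shift_continuous_def
    by (intro tendsto_add ennreal_tendsto_cmult) auto
  then show "((\<lambda>w. 2 * l2sq (\<lambda>x. f (x + w) - f x) + 2 * l2sq (\<lambda>x. g (x + w) - g x)) \<longlongrightarrow> 0) (at 0)"
    by simp
qed auto

lemma l2_shift_continuous_sum:
  fixes f :: "'i \<Rightarrow> 'a::euclidean_space \<Rightarrow> 'b::{real_normed_vector, second_countable_topology}"
  assumes "finite I" "\<And>i. i \<in> I \<Longrightarrow> f i \<in> borel_measurable borel" "\<And>i. i \<in> I \<Longrightarrow> l2_shift_continuous (f i)"
  shows "l2_shift_continuous (\<lambda>x. \<Sum>i\<in>I. f i x)"
  using assms
proof (induction I rule: finite_induct)
  case empty
  then show ?case by (simp add: l2_shift_continuous_def l2sq_def)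
next
  case (insert i I)
  then show ?case
    by (simp add: l2_shift_continuous_add)
qed

text \<open>Translation invariance bounds the shift error of \<open>f\<close>, up to constants, by that of an
approximant \<open>g\<close> plus the distance from \<open>f\<close> to \<open>g\<close>, uniformly in the shift.\<close>

lemma l2_shift_continuous_approx:
  fixes f :: "'a::euclidean_space \<Rightarrow> 'b::{real_normed_vector, second_countable_topology}"
  assumes [measurable]: "f \<in> borel_measurable borel"
    and approx: "\<And>e. e > 0 \<Longrightarrow> \<exists>g\<in>borel_measurable borel. l2_shift_continuous g \<and> l2sq (\<lambda>x. f x - g x) < ennreal e"
  shows "l2_shift_continuous f"
  unfolding l2_shift_continuous_def
proof (rule order_tendstoI)
  fix a :: ennreal assume a: "0 < a"
  obtain e where e: "e > 0" "ennreal e < a"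
  proof (cases a)
    case (real r)
    then show ?thesis using a by (intro that[of "r / 2"]) (auto simp: ennreal_less_iff)
  next
    case top
    then show ?thesis by (intro that[of 1]) auto
  qed
  \<comment> \<open>squaring turns the three-term triangle inequality into \<open>2 + 4 + 4 = 10\<close> copies of the error, and \<open>10 < 12\<close>\<close>
  obtain g where [measurable]: "g \<in> borel_measurable borel" and g: "l2_shift_continuous g"
    and fg: "l2sq (\<lambda>x. f x - g x) < ennreal (e/12)"
    using approx[of "e/12"] e by auto
  have "\<forall>\<^sub>F w in at 0. l2sq (\<lambda>x. g (x + w) - g x) < ennreal (e/12)"
    using g e unfolding l2_shift_continuous_def by (intro order_tendstoD) auto
  then show "\<forall>\<^sub>F w in at 0. l2sq (\<lambda>x. f (x + w) - f x) < a"
  proof eventually_elim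
    case (elim w)
    have "l2sq (\<lambda>x. f (x + w) - f x)
        = l2sq (\<lambda>x. (f (x + w) - g (x + w)) + ((g (x + w) - g x) + (g x - f x)))"
      by (simp add: algebra_simps)
    also have "\<dots> \<le> 2 * l2sq (\<lambda>x. f (x + w) - g (x + w)) + 2 * l2sq (\<lambda>x. (g (x + w) - g x) + (g x - f x))"
      by (intro l2sq_add_le) measurable
    also have "l2sq (\<lambda>x. f (x + w) - g (x + w)) = l2sq (\<lambda>x. f x - g x)"
      by (rule l2sq_translate[of "\<lambda>x. f x - g x"]) measurable
    also have "l2sq (\<lambda>x. (g (x + w) - g x) + (g x - f x)) \<le> 2 * l2sq (\<lambda>x. g (x + w) - g x) + 2 * l2sq (\<lambda>x. g x - f x)"
      by (intro l2sq_add_le) measurable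
    also have "l2sq (\<lambda>x. g x - f x) = l2sq (\<lambda>x. f x - g x)"
      by (rule l2sq_minus_commute)
    also have "2 * l2sq (\<lambda>x. f x - g x) + 2 * (2 * l2sq (\<lambda>x. g (x + w) - g x) + 2 * l2sq (\<lambda>x. f x - g x))
        \<le> 2 * ennreal (e/12) + 2 * (2 * ennreal (e/12) + 2 * ennreal (e/12))"
      using fg elim by (intro add_mono mult_left_mono) auto
    also have "\<dots> = ennreal (2 * (e/12) + 2 * (2 * (e/12) + 2 * (e/12)))"
      using e by (simp only: ennreal_plus ennreal_mult' ennreal_numeral divide_nonneg_nonneg zero_le_numeral less_imp_le mult_nonneg_nonneg add_nonneg_nonneg)
    also have "\<dots> = ennreal (10/12 * e)" by simp
    also have "\<dots> < a" using e by (auto intro!: le_less_trans[OF ennreal_leI, of _ e])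
    finally show ?case by (simp add: mult_left_mono)
  qed
qed simp

text \<open>A point of an open set \<open>U\<close> stays in \<open>U\<close> under all small shifts, so by dominated convergence the
measure of the points that leave \<open>U\<close> tends to 0.  The points that enter \<open>U\<close> correspond, by
translation, to those that leave it under the opposite shift.\<close>

lemma l2_shift_continuous_open:
  fixes U :: "'a::euclidean_space set" and c :: "'b::{real_normed_vector, second_countable_topology}"
  assumes "open U" and fin: "emeasure lborel U < \<infinity>"
  shows "l2_shift_continuous (\<lambda>x. indicat_real U x *\<^sub>R c)"
proof -
  have [measurable]: "U \<in> sets borel" using \<open>open U\<close> by simp
  define D where "D w = (\<integral>\<^sup>+x. indicator U x * indicator (-U) (x + w) \<partial>lborel)" for w :: 'a
  have D: "(D \<longlongrightarrow> 0) (at 0)"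
    unfolding tendsto_at_iff_sequentially comp_def
  proof (intro allI impI)
    fix X :: "nat \<Rightarrow> 'a" assume X: "X \<longlonglongrightarrow> 0"
    have "(\<lambda>i. D (X i)) \<longlonglongrightarrow> (\<integral>\<^sup>+(x::'a). 0 \<partial>lborel)"
      unfolding D_def
    proof (rule nn_integral_dominated_convergence[where w = "indicator U"])
      show "AE x in lborel. (\<lambda>i. indicator U x * indicator (-U) (x + X i) :: ennreal) \<longlonglongrightarrow> 0"
      proof (rule AE_I2)
        fix x :: 'a
        show "(\<lambda>i. indicator U x * indicator (-U) (x + X i) :: ennreal) \<longlonglongrightarrow> 0"
        proof (cases "x \<in> U")
          case True
          have "(\<lambda>i. x + X i) \<longlonglongrightarrow> x + 0" by (intro tendsto_intros X)
          then have "\<forall>\<^sub>F i in sequentially. x + X i \<in> U"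
            using topological_tendstoD[OF _ \<open>open U\<close>, of "\<lambda>i. x + X i" x] True by simp
          then have "\<forall>\<^sub>F i in sequentially. indicator U x * indicator (-U) (x + X i) = (0::ennreal)"
            by eventually_elim simp
          then show ?thesis by (rule tendsto_eventually)
        qed simp
      qed
      show "integral\<^sup>N lborel (indicator U) < \<infinity>" using fin by simp
      show "AE x in lborel. indicator U x * indicator (- U) (x + X j) \<le> (indicator U x::ennreal)" for j
        by (auto simp: indicator_def)
    qed auto
    then show "(\<lambda>i. D (X i)) \<longlonglongrightarrow> 0" by simp
  qed
  have D': "((\<lambda>w. D (- w)) \<longlongrightarrow> 0) (at 0)"
  proof (rule filterlim_compose[OF D])
    show "filterlim uminus (at 0) (at (0::'a))"
      by (auto simp: filterlim_at eventually_at_filter intro!: tendsto_eq_intros)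
  qed
  have eq: "l2sq (\<lambda>x. indicat_real U (x + w) *\<^sub>R c - indicat_real U x *\<^sub>R c)
      = ennreal ((norm c)\<^sup>2) * (D w + D (-w))" for w
  proof -
    have "D (-w) = (\<integral>\<^sup>+x. indicator U (x + w) * indicator (-U) (x + w + - w) \<partial>lborel)"
      unfolding D_def by (rule nn_integral_translate[symmetric]) measurable
    then have "ennreal ((norm c)\<^sup>2) * (D w + D (-w))
        = (\<integral>\<^sup>+x. ennreal ((norm c)\<^sup>2) * (indicator U x * indicator (-U) (x + w) + indicator U (x + w) * indicator (-U) x) \<partial>lborel)"
      unfolding D_def by (simp add: nn_integral_add nn_integral_cmult)
    also have "\<dots> = l2sq (\<lambda>x. indicat_real U (x + w) *\<^sub>R c - indicat_real U x *\<^sub>R c)"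
      unfolding l2sq_def by (intro nn_integral_cong) (auto simp: indicator_def)
    finally show ?thesis by simp
  qed
  have "((\<lambda>w. ennreal ((norm c)\<^sup>2) * (D w + D (-w))) \<longlongrightarrow> ennreal ((norm c)\<^sup>2) * (0 + 0)) (at 0)"
    by (intro ennreal_tendsto_cmult tendsto_add D D') auto
  then show ?thesis unfolding l2_shift_continuous_def eq by simp
qed

lemma l2_shift_continuous_indicator:
  fixes E :: "'a::euclidean_space set" and c :: "'b::{real_normed_vector, second_countable_topology}"
  assumes [measurable]: "E \<in> sets borel" and fin: "emeasure lborel E < \<infinity>"
  shows "l2_shift_continuous (\<lambda>x. indicat_real E x *\<^sub>R c)"
proof (rule l2_shift_continuous_approx)
  fix e :: real assume e: "e > 0"
  define e' where "e' = e / ((norm c)\<^sup>2 + 1)"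
  have e': "e' > 0" using e by (auto simp: e'_def intro!: divide_pos_pos add_nonneg_pos)
  obtain U where U: "open U" "E \<subseteq> U" "emeasure lborel (U - E) < ennreal e'"
    using outer_regular_lborel[of E e'] e' by auto
  have [measurable]: "U \<in> sets borel" using U by simp
  have "emeasure lborel U \<le> emeasure lborel E + emeasure lborel (U - E)"
    using emeasure_subadditive[of E lborel "U - E"] U by (simp add: Un_absorb1)
  also have "\<dots> < \<infinity>" using fin U e' by (auto simp: less_top[symmetric] top_unique)
  finally have finU: "emeasure lborel U < \<infinity>" .
  have "l2sq (\<lambda>x. indicat_real E x *\<^sub>R c - indicat_real U x *\<^sub>R c) = (\<integral>\<^sup>+x. ennreal ((norm c)\<^sup>2) * indicator (U - E) x \<partial>lborel)"
    unfolding l2sq_def using U(2) by (intro nn_integral_cong) (auto simp: indicator_def)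
  also have "\<dots> = ennreal ((norm c)\<^sup>2) * emeasure lborel (U - E)"
    by (simp add: nn_integral_cmult_indicator)
  also have "\<dots> \<le> ennreal ((norm c)\<^sup>2) * ennreal e'"
    using U by (intro mult_left_mono) auto
  also have "\<dots> = ennreal ((norm c)\<^sup>2 * e')" by (simp add: ennreal_mult')
  also have "\<dots> < ennreal e"
  proof (rule ennreal_lessI[OF e])
    have pos: "(norm c)\<^sup>2 + 1 > 0" by (simp add: add_nonneg_pos)
    show "(norm c)\<^sup>2 * e' < e"
      unfolding e'_def times_divide_eq_right pos_divide_less_eq[OF pos] using e by (simp add: algebra_simps)
  qed
  finally show "\<exists>g\<in>borel_measurable borel. l2_shift_continuous g \<and> l2sq (\<lambda>x. indicat_real E x *\<^sub>R c - g x) < ennreal e"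
    using l2_shift_continuous_open[OF U(1) finU, of c]
    by (intro bexI[of _ "\<lambda>x. indicat_real U x *\<^sub>R c"]) auto
qed measurable

lemma l2_shift_continuous_simple:
  fixes s :: "'a::euclidean_space \<Rightarrow> 'b::{real_normed_vector, second_countable_topology}"
  assumes s: "simple_function borel s" and fin: "l2sq s < \<infinity>"
  shows "l2_shift_continuous s"
proof -
  have [measurable]: "s \<in> borel_measurable borel" using s by (rule borel_measurable_simple_function)
  have rng: "finite (range s)" using simple_functionD(1)[OF s] by simp
  have sets[measurable]: "s -` {y} \<in> sets borel" for y
    using simple_functionD(2)[OF s, of "{y}"] by simp
  have eq: "s x = (\<Sum>y\<in>range s - {0}. indicat_real (s -` {y}) x *\<^sub>R y)" for x
  proof (cases "s x = 0")
    case True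
    then show ?thesis by (auto intro!: sum.neutral[symmetric] simp: indicator_def)
  next
    case False
    have "(\<Sum>y\<in>range s - {0}. indicat_real (s -` {y}) x *\<^sub>R y) = (\<Sum>y\<in>{s x}. indicat_real (s -` {y}) x *\<^sub>R y)"
      using rng False by (intro sum.mono_neutral_right) (auto simp: indicator_def)
    then show ?thesis by simp
  qed
  have "l2_shift_continuous (\<lambda>x. \<Sum>y\<in>range s - {0}. indicat_real (s -` {y}) x *\<^sub>R y)"
  proof (intro l2_shift_continuous_sum l2_shift_continuous_indicator)
    fix y assume y: "y \<in> range s - {0}"
    have "ennreal ((norm y)\<^sup>2) * emeasure lborel (s -` {y}) = (\<integral>\<^sup>+x. ennreal ((norm y)\<^sup>2) * indicator (s -` {y}) x \<partial>lborel)"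
      by (simp add: nn_integral_cmult_indicator)
    also have "\<dots> \<le> l2sq s"
      unfolding l2sq_def by (intro nn_integral_mono) (auto simp: indicator_def)
    also have "\<dots> < \<infinity>" by fact
    finally show "emeasure lborel (s -` {y}) < \<infinity>"
      using y by (auto simp: ennreal_mult_less_top)
  qed (use rng in auto)
  then show ?thesis by (simp flip: eq)
qed

text \<open>Simple functions are dense in the mean square.  They are finite sums of multiples of indicators
of sets of finite measure, and outer regularity reduces those to open sets.\<close>

theorem l2_imp_shift_continuous:
  fixes f :: "'a::euclidean_space \<Rightarrow> 'b::euclidean_space"
  assumes [measurable]: "f \<in> borel_measurable borel" and fin: "l2sq f < \<infinity>"
  shows "l2_shift_continuous f"
proof (rule l2_shift_continuous_approx)
  fix e :: real assume e: "e > 0"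
  obtain s where s: "\<And>i. simple_function borel (s i)" "\<And>x. (\<lambda>i. s i x) \<longlonglongrightarrow> f x"
    "\<And>i x. dist (s i x) 0 \<le> 2 * dist (f x) 0"
    using borel_measurable_implies_sequence_metric[of f borel 0] by auto
  have [measurable]: "s i \<in> borel_measurable borel" for i using s(1) by (rule borel_measurable_simple_function)
  have "(\<lambda>i. l2sq (\<lambda>x. f x - s i x)) \<longlonglongrightarrow> (\<integral>\<^sup>+(x::'a). 0 \<partial>lborel)"
    unfolding l2sq_def
  proof (rule nn_integral_dominated_convergence[where w = "\<lambda>x. 9 * ennreal ((norm (f x))\<^sup>2)"])
    show "AE x in lborel. ennreal ((norm (f x - s j x))\<^sup>2) \<le> 9 * ennreal ((norm (f x))\<^sup>2)" for j
    proof (rule AE_I2)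
      fix x
      have "norm (f x - s j x) \<le> 3 * norm (f x)"
        using s(3)[of j x] norm_triangle_ineq4[of "f x" "s j x"] by simp
      then have "(norm (f x - s j x))\<^sup>2 \<le> (3 * norm (f x))\<^sup>2" by (intro power_mono) auto
      then have "ennreal ((norm (f x - s j x))\<^sup>2) \<le> ennreal (9 * (norm (f x))\<^sup>2)"
        by (intro ennreal_leI) (simp add: power_mult_distrib)
      then show "ennreal ((norm (f x - s j x))\<^sup>2) \<le> 9 * ennreal ((norm (f x))\<^sup>2)"
        by (simp add: ennreal_mult')
    qed
    show "AE x in lborel. (\<lambda>i. ennreal ((norm (f x - s i x))\<^sup>2)) \<longlonglongrightarrow> 0"
    proof (rule AE_I2)
      fix x
      have "(\<lambda>i. ennreal ((norm (f x - s i x))\<^sup>2)) \<longlonglongrightarrow> ennreal ((norm (f x - f x))\<^sup>2)"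
        by (intro tendsto_intros tendsto_ennrealI s(2))
      then show "(\<lambda>i. ennreal ((norm (f x - s i x))\<^sup>2)) \<longlonglongrightarrow> 0" by simp
    qed
    show "(\<integral>\<^sup>+ x. 9 * ennreal ((norm (f x))\<^sup>2) \<partial>lborel) < \<infinity>"
      using fin by (simp add: nn_integral_cmult l2sq_def ennreal_mult_less_top)
  qed auto
  then have "\<forall>\<^sub>F i in sequentially. l2sq (\<lambda>x. f x - s i x) < ennreal e"
    using e by (intro order_tendstoD(2)) auto
  then obtain i where i: "l2sq (\<lambda>x. f x - s i x) < ennreal e"
    by (auto simp: eventually_sequentially)
  have "l2sq (s i) = l2sq (\<lambda>x. (s i x - f x) + f x)" by simp
  also have "\<dots> \<le> 2 * l2sq (\<lambda>x. s i x - f x) + 2 * l2sq f"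
    by (intro l2sq_add_le) measurable
  also have "\<dots> < \<infinity>"
    using fin i unfolding l2sq_minus_commute[of "s i" f]
    by (auto simp: ennreal_mult_less_top intro: order.strict_trans)
  finally have "l2_shift_continuous (s i)"
    using s(1) by (intro l2_shift_continuous_simple) auto
  then show "\<exists>g\<in>borel_measurable borel. l2_shift_continuous g \<and> l2sq (\<lambda>x. f x - g x) < ennreal e"
    using i by (intro bexI[of _ "s i"]) auto
qed measurable

section \<open>Smooth bump functions on boxes\<close>

text \<open>Continuous differentiability of order \<open>n\<close>.  The recursion runs parallel to that of
\<open>C_closure\<close>, and it yields closure under products by induction, without a formula for iterated
derivatives.\<close>

primrec times_differentiable :: "nat \<Rightarrow> (real \<Rightarrow> real) \<Rightarrow> bool" where
  "times_differentiable 0 f \<longleftrightarrow> continuous_on UNIV f"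
| "times_differentiable (Suc n) f \<longleftrightarrow> (\<exists>f'. (\<forall>x. (f has_real_derivative f' x) (at x)) \<and> times_differentiable n f')"

lemma times_differentiable_SucI:
  "(\<And>x. (f has_real_derivative f' x) (at x)) \<Longrightarrow> times_differentiable n f' \<Longrightarrow> times_differentiable (Suc n) f"
  unfolding times_differentiable.simps by (intro exI[of _ f']) simp

lemma times_differentiable_continuous:
  "times_differentiable n f \<Longrightarrow> continuous_on UNIV f"
proof (cases n)
  case (Suc k)
  assume "times_differentiable n f"
  then obtain f' where "\<And>x. (f has_real_derivative f' x) (at x)" unfolding Suc times_differentiable.simps by blast
  then show ?thesis by (intro DERIV_continuous_on[of UNIV f f']) auto
qed simp

lemma times_differentiable_Suc_imp: "times_differentiable (Suc n) f \<Longrightarrow> times_differentiable n f"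
proof (induction n arbitrary: f)
  case 0
  then show ?case using times_differentiable_continuous[OF 0] by simp
next
  case (Suc n)
  from Suc.prems obtain f' where d: "\<And>x. (f has_real_derivative f' x) (at x)" and "times_differentiable (Suc n) f'"
    unfolding times_differentiable.simps(2)[of "Suc n"] by blast
  then have "times_differentiable n f'" by (intro Suc.IH)
  with d show ?case by (intro times_differentiable_SucI)
qed

lemma times_differentiable_add:
  "times_differentiable n f \<Longrightarrow> times_differentiable n g \<Longrightarrow> times_differentiable n (\<lambda>x. f x + g x)"
proof (induction n arbitrary: f g)
  case 0
  then show ?case by (simp add: continuous_on_add)
next
  case (Suc n)
  then obtain f' g' where "\<And>x. (f has_real_derivative f' x) (at x)" "times_differentiable n f'"
    "\<And>x. (g has_real_derivative g' x) (at x)" "times_differentiable n g'"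
    unfolding times_differentiable.simps by blast
  then show ?case
    by (intro times_differentiable_SucI[where f' = "\<lambda>x. f' x + g' x"] DERIV_add Suc.IH)
qed

lemma times_differentiable_cmult:
  "times_differentiable n f \<Longrightarrow> times_differentiable n (\<lambda>x. c * f x)"
proof (induction n arbitrary: f)
  case 0
  then show ?case by (simp add: continuous_on_mult_left)
next
  case (Suc n)
  then obtain f' where "\<And>x. (f has_real_derivative f' x) (at x)" "times_differentiable n f'"
    unfolding times_differentiable.simps by blast
  then show ?case
    by (intro times_differentiable_SucI[where f' = "\<lambda>x. c * f' x"] DERIV_cmult Suc.IH)
qed

lemma times_differentiable_mult:
  "times_differentiable n f \<Longrightarrow> times_differentiable n g \<Longrightarrow> times_differentiable n (\<lambda>x. f x * g x)"
proof (induction n arbitrary: f g)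
  case 0
  then show ?case by (simp add: continuous_on_mult)
next
  case (Suc n)
  then obtain f' g' where fg: "\<And>x. (f has_real_derivative f' x) (at x)" "times_differentiable n f'"
    "\<And>x. (g has_real_derivative g' x) (at x)" "times_differentiable n g'"
    unfolding times_differentiable.simps by blast
  have "times_differentiable n (\<lambda>x. f' x * g x + g' x * f x)"
    by (intro times_differentiable_add Suc.IH fg Suc.prems[THEN times_differentiable_Suc_imp])
  then show ?case
    by (intro times_differentiable_SucI[where f' = "\<lambda>x. f' x * g x + g' x * f x"] DERIV_mult fg)
qed

lemma times_differentiable_affine:
  "times_differentiable n f \<Longrightarrow> times_differentiable n (\<lambda>x. f (a * x + b))"
proof (induction n arbitrary: f)
  case 0
  have "continuous_on UNIV (\<lambda>x. a * x + b)" by (intro continuous_intros)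
  with 0 have "continuous_on UNIV (\<lambda>x. f (a * x + b))"
    using continuous_on_compose2[of UNIV f UNIV "\<lambda>x. a * x + b"] by simp
  then show ?case by simp
next
  case (Suc n)
  then obtain f' where f': "\<And>x. (f has_real_derivative f' x) (at x)" "times_differentiable n f'"
    unfolding times_differentiable.simps by blast
  have deriv: "((\<lambda>x. f (a * x + b)) has_real_derivative a * f' (a * x + b)) (at x)" for x
  proof -
    have "((\<lambda>x. a * x + b) has_real_derivative a) (at x)" by (auto intro!: derivative_eq_intros)
    from DERIV_chain2[OF f'(1) this] show ?thesis by (simp add: mult.commute)
  qed
  show ?case
    by (rule times_differentiable_SucI[OF deriv], rule times_differentiable_cmult, rule Suc.IH, rule f'(2))
qed

text \<open>The functions \<open>exp (- c / t) / t\<^sup>k\<close>, continued by zero to the left half line, have derivatives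
that are linear combinations of functions of the same kind.  One induction over all \<open>k\<close> at once
therefore gives the smoothness of the classical flat function \<open>flat_exp c 0\<close>.\<close>

definition flat_exp :: "real \<Rightarrow> nat \<Rightarrow> real \<Rightarrow> real" where
  "flat_exp c k t = (if t > 0 then exp (- c / t) / t ^ k else 0)"

lemma flat_exp_tendsto_0:
  assumes "c > 0"
  shows "(flat_exp c k \<longlongrightarrow> 0) (at 0)"
proof -
  have "((\<lambda>y::real. y ^ k / exp y) \<longlongrightarrow> 0) at_top" by (rule tendsto_power_div_exp_0)
  then have "((\<lambda>t. (c / t) ^ k / exp (c / t)) \<longlongrightarrow> 0) (at_right 0)"
  proof (rule filterlim_compose)
    show "filterlim (\<lambda>t. c / t) at_top (at_right 0)"
      unfolding divide_inverse
      by (rule filterlim_tendsto_pos_mult_at_top[OF tendsto_const assms filterlim_inverse_at_top_right])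
  qed
  then have "((\<lambda>t. (1 / c ^ k) * ((c / t) ^ k / exp (c / t))) \<longlongrightarrow> (1 / c ^ k) * 0) (at_right 0)"
    by (intro tendsto_mult tendsto_const)
  then have right: "(flat_exp c k \<longlongrightarrow> 0) (at_right 0)"
  proof (rule Lim_transform_eventually[OF tendsto_eq_rhs])
    show "\<forall>\<^sub>F t in at_right 0. (1 / c ^ k) * ((c / t) ^ k / exp (c / t)) = flat_exp c k t"
      by (rule eventually_at_rightI[of 0 1])
        (use assms in \<open>auto simp: flat_exp_def power_divide exp_minus field_simps\<close>)
  qed simp
  have left: "(flat_exp c k \<longlongrightarrow> 0) (at_left 0)"
    by (intro tendsto_eventually eventually_at_leftI[of "-1"]) (auto simp: flat_exp_def)
  show ?thesis using left right by (simp add: filterlim_split_at)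
qed

lemma flat_exp_DERIV:
  assumes c: "c > 0"
  shows "(flat_exp c k has_real_derivative c * flat_exp c (k + 2) t + (- real k) * flat_exp c (k + 1) t) (at t)"
proof (cases t "0::real" rule: linorder_cases)
  case less
  have "(flat_exp c k has_real_derivative 0) (at t)"
    by (rule has_field_derivative_transform_within_open[of "\<lambda>_. 0" 0 t "{..<0}"])
      (use less in \<open>auto simp: flat_exp_def\<close>)
  then show ?thesis using less by (simp add: flat_exp_def)
next
  case equal
  have "((\<lambda>h. (flat_exp c k (0 + h) - flat_exp c k 0) / h) \<longlongrightarrow> 0) (at 0)"
    by (rule Lim_transform_eventually[OF flat_exp_tendsto_0[OF c, of "Suc k"]])
       (auto simp: flat_exp_def eventually_at_filter)
  then show ?thesis using equal by (simp add: DERIV_def) (simp add: flat_exp_def)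
next
  case greater
  have "((\<lambda>t. exp (- c / t) / t ^ k) has_real_derivative c * flat_exp c (k + 2) t + (- real k) * flat_exp c (k + 1) t) (at t)"
  proof (cases k)
    case 0
    then show ?thesis using greater
      by (auto intro!: derivative_eq_intros simp: flat_exp_def power2_eq_square)
  next
    case (Suc j)
    define p where "p = t ^ j"
    define E where "E = exp (- c / t)"
    have p: "p \<noteq> 0" using greater by (simp add: p_def)
    have "((\<lambda>t. exp (- c / t)) has_real_derivative E * (c / (t * t))) (at t)"
      using greater by (auto intro!: derivative_eq_intros simp: E_def)
    moreover have "((\<lambda>t. t ^ k) has_real_derivative real k * p) (at t)"
      using DERIV_pow[of k t UNIV] by (simp add: Suc p_def)
    ultimately have "((\<lambda>t. exp (- c / t) / t ^ k) has_real_derivative (E * (c / (t * t)) * t ^ k - exp (- c / t) * (real k * p)) / (t ^ k * t ^ k)) (at t)"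
      by (intro DERIV_divide) (use greater in auto)
    also have "(E * (c / (t * t)) * t ^ k - exp (- c / t) * (real k * p)) / (t ^ k * t ^ k)
        = c * (E / (t * t * (t * p))) + (- real k) * (E / (t * (t * p)))"
      unfolding E_def[symmetric] using p greater by (simp add: Suc field_simps flip: p_def)
    also have "\<dots> = c * flat_exp c (k + 2) t + (- real k) * flat_exp c (k + 1) t"
      using greater by (simp add: flat_exp_def Suc p_def E_def mult_ac)
    finally show ?thesis .
  qed
  then show ?thesis
    by (rule has_field_derivative_transform_within_open[of _ _ _ "{0<..}"])
       (use greater in \<open>auto simp: flat_exp_def\<close>)
qed

lemma times_differentiable_flat_exp: "c > 0 \<Longrightarrow> times_differentiable n (flat_exp c k)"
proof (induction n arbitrary: k)
  case 0
  then show ?case by (auto intro!: DERIV_continuous_on flat_exp_DERIV)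
next
  case (Suc n)
  then have "times_differentiable n (\<lambda>t. c * flat_exp c (k + 2) t + (- real k) * flat_exp c (k + 1) t)"
    by (intro times_differentiable_add times_differentiable_cmult) auto
  then show ?case by (rule times_differentiable_SucI[OF flat_exp_DERIV[OF Suc.prems]])
qed

text \<open>As \<open>c\<close> decreases to 0, these bumps increase to the indicator of the open interval.  Statements
tested on bumps thus turn into statements about intervals, and no plateau function is needed.\<close>

definition bump :: "real \<Rightarrow> real \<Rightarrow> real \<Rightarrow> real \<Rightarrow> real" where
  "bump c a b t = flat_exp c 0 (t - a) * flat_exp c 0 (b - t)"

lemma times_differentiable_bump:
  assumes "c > 0"
  shows "times_differentiable n (bump c a b)"
proof -
  have "times_differentiable n (\<lambda>t. flat_exp c 0 (1 * t + (- a)) * flat_exp c 0 ((- 1) * t + b))"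
    by (intro times_differentiable_mult times_differentiable_affine times_differentiable_flat_exp assms)
  moreover have "bump c a b = (\<lambda>t. flat_exp c 0 (1 * t + (- a)) * flat_exp c 0 ((- 1) * t + b))"
    by (rule ext) (simp add: bump_def)
  ultimately show ?thesis by (simp only:)
qed

lemma flat_exp_bounds:
  assumes "c > 0"
  shows "0 \<le> flat_exp c 0 t" "flat_exp c 0 t \<le> 1"
  using assms by (simp_all add: flat_exp_def)

lemma bump_bounds:
  assumes "c > 0"
  shows "0 \<le> bump c a b t" "bump c a b t \<le> 1"
  unfolding bump_def
  by (rule mult_nonneg_nonneg; rule flat_exp_bounds[OF assms])
    (rule mult_le_one; rule flat_exp_bounds[OF assms])

lemma bump_nonzero_iff: "bump c a b t \<noteq> 0 \<longleftrightarrow> a < t \<and> t < b"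
  by (auto simp: bump_def flat_exp_def)

lemma bump_shift: "bump c a b (t - w) = bump c (a + w) (b + w) t"
  by (simp add: bump_def algebra_simps)

lemma bump_tendsto_indicator:
  "(\<lambda>n. bump (1 / real (Suc n)) a b t) \<longlonglongrightarrow> indicat_real {a<..<b} t"
proof (cases "a < t \<and> t < b")
  case True
  have "(\<lambda>n. exp (- (1 / real (Suc n)) / (t - a)) * exp (- (1 / real (Suc n)) / (b - t))) \<longlonglongrightarrow> exp (- 0 / (t - a)) * exp (- 0 / (b - t))"
    by (intro tendsto_intros LIMSEQ_inverse_real_of_nat[unfolded inverse_eq_divide]) (use True in auto)
  then show ?thesis using True by (simp add: bump_def flat_exp_def)
next
  case False
  then have "bump c a b t = 0" for c using bump_nonzero_iff by blast
  then show ?thesis using False by auto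
qed

definition tensor :: "('n::finite \<Rightarrow> real \<Rightarrow> real) \<Rightarrow> real^'n \<Rightarrow> real" where
  "tensor F x = (\<Prod>i\<in>UNIV. F i (x $ i))"

lemma tensor_continuous:
  "(\<And>i. continuous_on UNIV (F i)) \<Longrightarrow> continuous_on UNIV (tensor F)"
  unfolding tensor_def
  by (intro continuous_on_prod, rule continuous_on_compose2[of UNIV "F _"]) (auto intro!: continuous_intros)

lemma tensor_has_partial_derivative:
  fixes F :: "'n::finite \<Rightarrow> real \<Rightarrow> real"
  assumes "(F j has_real_derivative d (x $ j)) (at (x $ j))"
  shows "has_partial_derivative (tensor F) j x (tensor (F(j := d)) x)"
proof -
  define P where "P = (\<Prod>i\<in>UNIV - {j}. F i (x $ i))"
  have split: "tensor G y = G j (y $ j) * (\<Prod>i\<in>UNIV - {j}. G i (y $ i))" for G y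
    unfolding tensor_def by (subst prod.remove[of _ j]) auto
  have eq: "tensor F (x + t *\<^sub>R axis j 1) = F j (x $ j + t) * P" for t
    unfolding split P_def by (auto simp: axis_def intro!: prod.cong)
  have "((\<lambda>t. F j (x $ j + t)) has_real_derivative d (x $ j)) (at 0)"
  proof -
    have "((\<lambda>t. x $ j + t) has_real_derivative 1) (at 0)" by (auto intro!: derivative_eq_intros)
    from DERIV_chain2[OF _ this, of "F j" "d (x $ j)"] assms show ?thesis by simp
  qed
  then have "((\<lambda>t. F j (x $ j + t) * P) has_real_derivative d (x $ j) * P) (at 0)"
    by (rule DERIV_cmult_right)
  moreover have "tensor (F(j := d)) x = d (x $ j) * P"
    unfolding split P_def by (auto intro!: prod.cong)
  ultimately show ?thesis
    unfolding has_partial_derivative_def eq by (simp add: has_real_derivative_iff_has_vector_derivative)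
qed

text \<open>A partial derivative replaces one factor by its derivative, so it is again a tensor product of
smooth functions.\<close>

lemma tensor_C_closure:
  fixes F :: "'n::finite \<Rightarrow> real \<Rightarrow> real"
  assumes "\<And>i. times_differentiable k (F i)"
  shows "C_closure k UNIV (tensor F)"
  using assms
proof (induction k arbitrary: F)
  case 0
  then show ?case by (auto intro: tensor_continuous)
next
  case (Suc k)
  then obtain D where D: "\<And>i x. (F i has_real_derivative D i x) (at x)" "\<And>i. times_differentiable k (D i)"
    unfolding times_differentiable.simps by metis
  have "C_closure k UNIV (tensor (F(j := D j)))" for j
    using D(2) times_differentiable_Suc_imp[OF Suc.prems] by (intro Suc.IH) auto
  moreover have "continuous_on UNIV (tensor F)"
    using Suc.prems times_differentiable_continuous by (blast intro: tensor_continuous)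
  ultimately show ?case
    using tensor_has_partial_derivative[of F _ "D _", OF D(1)]
    by (auto intro!: exI[of _ "\<lambda>j. tensor (F(j := D j))"])
qed

definition box_bump :: "real \<Rightarrow> real^'n \<Rightarrow> real^'n \<Rightarrow> real^'n \<Rightarrow> real" where
  "box_bump c a b = tensor (\<lambda>i. bump c (a $ i) (b $ i))"

definition box_bump_partial :: "real \<Rightarrow> real^'n \<Rightarrow> real^'n \<Rightarrow> 'n \<Rightarrow> real^'n \<Rightarrow> real" where
  "box_bump_partial c a b j = tensor ((\<lambda>i. bump c (a $ i) (b $ i))(j := deriv (bump c (a $ j) (b $ j))))"

lemma bump_DERIV:
  assumes "c > 0"
  shows "(bump c a b has_real_derivative deriv (bump c a b) x) (at x)" "continuous_on UNIV (deriv (bump c a b))"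
proof -
  obtain d where d: "\<And>x. (bump c a b has_real_derivative d x) (at x)" "continuous_on UNIV d"
    using times_differentiable_bump[OF assms, of 1 a b] by auto
  then have "deriv (bump c a b) = d" by (auto simp: DERIV_imp_deriv)
  then show "(bump c a b has_real_derivative deriv (bump c a b) x) (at x)" "continuous_on UNIV (deriv (bump c a b))"
    using d by simp_all
qed

lemma box_bump_continuous: "c > 0 \<Longrightarrow> continuous_on UNIV (box_bump c a b)"
  "c > 0 \<Longrightarrow> continuous_on UNIV (box_bump_partial c a b j)"
proof -
  assume c: "c > 0"
  have cont: "continuous_on UNIV (bump c a b)" for a b
    by (rule times_differentiable_continuous[OF times_differentiable_bump[OF c, where n = 0]])
  show "continuous_on UNIV (box_bump c a b)"
    unfolding box_bump_def by (rule tensor_continuous) (rule cont)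
  show "continuous_on UNIV (box_bump_partial c a b j)"
    unfolding box_bump_partial_def
  proof (rule tensor_continuous)
    fix i
    show "continuous_on UNIV (((\<lambda>i. bump c (a $ i) (b $ i))(j := deriv (bump c (a $ j) (b $ j)))) i)"
      by (cases "i = j") (simp_all add: cont bump_DERIV(2)[OF c])
  qed
qed

lemma box_bump_partial:
  "c > 0 \<Longrightarrow> has_partial_derivative (box_bump c a b) j x (box_bump_partial c a b j x)"
  unfolding box_bump_def box_bump_partial_def
  by (rule tensor_has_partial_derivative[where F = "\<lambda>i. bump c (a $ i) (b $ i)"]) (rule bump_DERIV(1))

lemma box_bump_bounds:
  assumes "c > 0"
  shows "0 \<le> box_bump c a b x" "box_bump c a b x \<le> 1"
  unfolding box_bump_def tensor_def
  by (simp_all add: prod_nonneg prod_le_1 bump_bounds[OF assms])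

lemma box_bump_nonzero_iff: "box_bump c a b x \<noteq> 0 \<longleftrightarrow> x \<in> box a b"
  unfolding box_bump_def tensor_def by (auto simp: bump_nonzero_iff mem_box_cart)

lemma box_bump_partial_zero:
  assumes "c > 0" "x \<notin> cbox a b"
  shows "box_bump_partial c a b j x = 0"
proof -
  obtain i where i: "x $ i < a $ i \<or> b $ i < x $ i"
    using assms by (auto simp: mem_box_cart not_le)
  have "deriv (bump c (a $ j) (b $ j)) (x $ j) = 0" if "j = i"
  proof (rule DERIV_imp_deriv)
    have "((\<lambda>_. 0) has_real_derivative 0) (at (x $ j))" by simp
    then show "(bump c (a $ j) (b $ j) has_real_derivative 0) (at (x $ j))"
    proof (rule has_field_derivative_transform_within_open)
      show "open (- {a $ j .. b $ j})" by (intro open_Compl closed_atLeastAtMost)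
      show "x $ j \<in> - {a $ j .. b $ j}" using i that by auto
      show "0 = bump c (a $ j) (b $ j) y" if "y \<in> - {a $ j .. b $ j}" for y
        using bump_nonzero_iff[of c "a $ j" "b $ j" y] that by fastforce
    qed
  qed
  moreover have "bump c (a $ i) (b $ i) (x $ i) = 0"
    using i bump_nonzero_iff[of c "a $ i" "b $ i" "x $ i"] by auto
  ultimately show ?thesis
    unfolding box_bump_partial_def tensor_def
    by (intro prod_zero bexI[of _ i]) auto
qed

lemma box_bump_shift: "box_bump c a b (x - w) = box_bump c (a + w) (b + w) x"
  by (simp add: box_bump_def tensor_def bump_shift)

lemma deriv_bump_shift:
  assumes "c > 0"
  shows "deriv (bump c a b) (t - w) = deriv (bump c (a + w) (b + w)) t"
proof -
  have "((\<lambda>t. bump c a b (t - w)) has_real_derivative deriv (bump c a b) (t - w)) (at t)"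
  proof -
    have "((\<lambda>t. t - w) has_real_derivative 1) (at t)" by (auto intro!: derivative_eq_intros)
    from DERIV_chain2[OF bump_DERIV(1)[OF assms] this] show ?thesis by simp
  qed
  then show ?thesis by (auto simp: bump_shift DERIV_imp_deriv)
qed

lemma box_bump_partial_shift:
  "c > 0 \<Longrightarrow> box_bump_partial c a b j (x - w) = box_bump_partial c (a + w) (b + w) j x"
  unfolding box_bump_partial_def tensor_def
  by (intro prod.cong) (auto simp: bump_shift deriv_bump_shift)

lemma box_bump_test_function:
  fixes a b :: "real^'n"
  assumes "c > 0" "cbox a b \<subseteq> S"
  shows "test_function S (box_bump c a b)"
proof -
  have "{x. box_bump c a b x \<noteq> 0} \<subseteq> cbox a b"
    using box_subset_cbox by (auto simp: box_bump_nonzero_iff)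
  then have "closure {x. box_bump c a b x \<noteq> 0} \<subseteq> cbox a b"
    by (rule closure_minimal) auto
  moreover have "compact (closure {x. box_bump c a b x \<noteq> 0})"
    using calculation compact_cbox by (metis closed_closure compact_Int_closed inf.absorb_iff2)
  moreover have "C_closure k UNIV (box_bump c a b)" for k
    unfolding box_bump_def by (intro tensor_C_closure times_differentiable_bump assms)
  ultimately show ?thesis using assms unfolding test_function_def by auto
qed

lemma box_bump_tendsto_indicator:
  fixes a b :: "real^'n"
  shows "(\<lambda>n. box_bump (1 / real (Suc n)) a b x) \<longlonglongrightarrow> indicat_real (box a b) x"
proof -
  have "(\<lambda>n. \<Prod>i\<in>UNIV. bump (1 / real (Suc n)) (a $ i) (b $ i) (x $ i)) \<longlonglongrightarrow> (\<Prod>i\<in>UNIV. indicat_real {a $ i<..<b $ i} (x $ i))"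
    by (intro tendsto_prod bump_tendsto_indicator)
  moreover have "(\<Prod>i\<in>UNIV. indicat_real {a $ i<..<b $ i} (x $ i)) = indicat_real (box a b) x"
  proof (cases "x \<in> box a b")
    case False
    then show ?thesis by (auto simp: mem_box_cart indicator_def intro!: prod_zero)
  qed (auto simp: mem_box_cart)
  ultimately show ?thesis by (simp add: box_bump_def tensor_def)
qed

text \<open>The product rule along a line gives the directional derivative without passing through total
differentiability.\<close>

lemma box_bump_line_derivative:
  fixes a b x v :: "real^'n"
  assumes c: "c > 0"
  shows "((\<lambda>t. box_bump c a b (x - t *\<^sub>R v)) has_real_derivative
          - (\<Sum>j\<in>UNIV. v $ j * box_bump_partial c a b j (x - t *\<^sub>R v))) (at t)"
proof -
  define G where "G i t = bump c (a $ i) (b $ i) (x $ i - t * v $ i)" for i t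
  define G' where "G' i t = deriv (bump c (a $ i) (b $ i)) (x $ i - t * v $ i) * (- (v $ i))" for i t
  have "(G i has_real_derivative G' i t) (at t)" for i
    unfolding G_def G'_def
    by (rule DERIV_chain2[OF bump_DERIV(1)[OF c]]) (auto intro!: derivative_eq_intros)
  then have "((\<lambda>t. \<Prod>i\<in>UNIV. G i t) has_real_derivative (\<Sum>j\<in>UNIV. G' j t * (\<Prod>i\<in>UNIV - {j}. G i t))) (at t)"
    by (intro has_field_derivative_prod) auto
  moreover have "G' j t * (\<Prod>i\<in>UNIV - {j}. G i t) = - (v $ j * box_bump_partial c a b j (x - t *\<^sub>R v))" for j
    unfolding box_bump_partial_def tensor_def G_def G'_def
    by (subst prod.remove[of UNIV j]) (auto intro!: prod.cong)
  ultimately show ?thesis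
    by (simp add: box_bump_def tensor_def G_def sum_negf)
qed

section \<open>The fundamental lemma of the calculus of variations on boxes\<close>

text \<open>Boxes are stable under intersection and generate the Borel sets, so by Dynkin's argument the
integral vanishes over every Borel set.  For complements this uses that the whole space is an
increasing union of boxes.\<close>

lemma AE_eq_0_if_box_integrals_0:
  fixes f :: "'a::euclidean_space \<Rightarrow> 'b::{banach, second_countable_topology}"
  assumes int: "integrable lborel f"
    and box: "\<And>a b. (LINT x:box a b|lborel. f x) = 0"
  shows "AE x in lborel. f x = 0"
proof (rule sigma_finite_measure.density_zero[OF sigma_finite_lborel int])
  let ?G = "range (\<lambda>(a, b). box a b :: 'a set)"
  have setint: "set_integrable lborel A f" if "A \<in> sets borel" for A
    using that int by (simp add: set_integrable_def integrable_mult_indicator)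
  have sets: "sigma_sets UNIV ?G = sets borel"
    by (simp add: borel_eq_box)
  fix A :: "'a set" assume "A \<in> sets lborel"
  then have A: "A \<in> sigma_sets UNIV ?G" by (simp add: sets)
  have "Int_stable ?G" by (auto simp: Int_stable_def box_Int_box)
  moreover have "?G \<subseteq> Pow UNIV" by simp
  ultimately show "(LINT x:A|lborel. f x) = 0"
    using A
  proof (induction rule: sigma_sets_induct_disjoint)
    case (basic A)
    then show ?case using box by auto
  next
    case empty
    show ?case by (simp add: set_lebesgue_integral_def)
  next
    case (compl A)
    have "(\<lambda>n. LINT x:box (- (real n *\<^sub>R One)) (real n *\<^sub>R One)|lborel. f x)
        \<longlonglongrightarrow> (LINT x:(\<Union>n. box (- (real n *\<^sub>R One)) (real n *\<^sub>R One))|lborel. f x)"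
    proof (rule set_integral_cont_up)
      show "incseq (\<lambda>n. box (- (real n *\<^sub>R One)) (real n *\<^sub>R One :: 'a))"
        by (intro incseq_SucI subset_box_imp) (auto simp: inner_simps)
    qed (auto intro!: setint)
    then have U: "(LINT x:UNIV|lborel. f x) = 0"
      by (simp add: box UN_box_eq_UNIV LIMSEQ_const_iff)
    have [measurable]: "A \<in> sets borel" using compl(1) by (simp add: sets)
    have "(LINT x:UNIV|lborel. f x) = (LINT x:(UNIV - A) \<union> A|lborel. f x)" by simp
    also have "\<dots> = (LINT x:UNIV - A|lborel. f x) + (LINT x:A|lborel. f x)"
      by (rule set_integral_Un) (auto intro!: setint)
    finally show ?case using U compl(2) by simp
  next
    case (union A)
    then have [measurable]: "A i \<in> sets borel" for i by (auto simp: sets)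
    have "(LINT x:(\<Union>i. A i)|lborel. f x) = (\<Sum>i. LINT x:A i|lborel. f x)"
      using union(1) by (intro lebesgue_integral_countable_add setint) (auto simp: disjoint_family_on_def)
    then show ?case using union(3) by simp
  qed
qed

lemma AE_cbox_imp_box: "AE x in lborel. x \<in> cbox a (b::'a::euclidean_space) \<longrightarrow> x \<in> box a b"
proof -
  have "emeasure lborel (cbox a b - box a b) = emeasure lborel (cbox a b) - emeasure lborel (box a b)"
    using emeasure_lborel_box_finite[of a b] by (intro emeasure_Diff) (auto simp: box_subset_cbox)
  also have "\<dots> = 0"
    by (simp add: emeasure_lborel_cbox_eq emeasure_lborel_box_eq)
  finally have "cbox a b - box a b \<in> null_sets lborel" by (simp add: null_sets_def)
  from AE_not_in[OF this] show ?thesis by eventually_elim auto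
qed

text \<open>An open set is a countable union of closed boxes.  On each of them the global version applies
to \<open>f\<close> cut off to the interior of the box, since intersections of boxes are boxes.\<close>

lemma AE_eq_0_on_open_if_box_integrals_0:
  fixes f :: "'a::euclidean_space \<Rightarrow> 'b::{banach, second_countable_topology}"
  assumes int: "integrable lborel f" and "open U"
    and box: "\<And>a b. cbox a b \<subseteq> U \<Longrightarrow> (LINT x:box a b|lborel. f x) = 0"
  shows "AE x in lborel. x \<in> U \<longrightarrow> f x = 0"
proof -
  obtain D where D: "countable D" "D \<subseteq> Pow U" "\<And>X. X \<in> D \<Longrightarrow> \<exists>a b. X = cbox a b" "\<Union>D = U"
    using open_countable_Union_open_cbox[OF \<open>open U\<close>] by metis
  have "AE x in lborel. x \<in> X \<longrightarrow> f x = 0" if XD: "X \<in> D" for X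
  proof -
    obtain a b where X: "X = cbox a b" using D(3)[OF XD] by blast
    define h where "h x = indicat_real (box a b) x *\<^sub>R f x" for x
    have "AE x in lborel. h x = 0"
    proof (rule AE_eq_0_if_box_integrals_0)
      show "integrable lborel h" unfolding h_def by (intro integrable_mult_indicator int) simp
      fix c d
      obtain e e' where e: "box c d \<inter> box a b = box e (e'::'a)"
        using box_Int_box by blast
      have "(LINT x:box c d|lborel. h x) = (LINT x:box e e'|lborel. f x)"
        unfolding set_lebesgue_integral_def h_def e[symmetric]
        by (intro Bochner_Integration.integral_cong) (auto simp: indicator_def)
      also have "\<dots> = 0"
      proof (cases "box e e' = {}")
        case False
        have "closure (box e e') \<subseteq> cbox a b"
          unfolding e[symmetric] using box_subset_cbox[of a b] by (intro closure_minimal) auto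
        then have "cbox e e' \<subseteq> U"
          using D(2) XD X closure_box[OF False] by auto
        then show ?thesis by (rule box)
      qed (simp add: set_lebesgue_integral_def)
      finally show "(LINT x:box c d|lborel. h x) = 0" .
    qed
    with AE_cbox_imp_box[of a b] show ?thesis
      by eventually_elim (auto simp: h_def X)
  qed
  then have "AE x in lborel. \<forall>X\<in>D. x \<in> X \<longrightarrow> f x = 0"
    by (subst AE_ball_countable[OF D(1)]) blast
  then show ?thesis using D(4) by (auto elim!: eventually_mono)
qed

section \<open>Weakly differentiable functions along segments\<close>

text \<open>The bilinear pairing, without conjugation, of a real direction with a complex gradient.\<close>

definition dot :: "real^'n \<Rightarrow> complex^'n \<Rightarrow> complex" where
  "dot v w = (\<Sum>j\<in>UNIV. (v $ j) *\<^sub>R (w $ j))"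

lemma dot_diff: "dot v (w - y) = dot v w - dot v y"
  by (simp add: dot_def scaleR_diff_right sum_subtractf)

lemma norm_dot_le: "norm (dot v w) \<le> norm v * norm w"
proof -
  have "norm (dot v w) \<le> (\<Sum>j\<in>UNIV. \<bar>v $ j\<bar> * \<bar>norm (w $ j)\<bar>)"
    unfolding dot_def by (rule sum_norm_le) simp
  also have "\<dots> \<le> L2_set (($) v) UNIV * L2_set (\<lambda>j. norm (w $ j)) UNIV"
    by (rule L2_set_mult_ineq)
  finally show ?thesis by (simp add: norm_vec_def L2_set_def)
qed

lemma borel_measurable_vec_nth_compose[measurable]:
  fixes f :: "'a \<Rightarrow> 'b::euclidean_space^'n"
  assumes [measurable]: "f \<in> borel_measurable M"
  shows "(\<lambda>x. f x $ i) \<in> borel_measurable M"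
proof -
  have "(\<lambda>y::'b^'n. y $ i) \<in> borel_measurable borel"
    by (intro borel_measurable_continuous_onI continuous_intros)
  from measurable_compose[OF assms this] show ?thesis .
qed

lemma dot_measurable[measurable]:
  assumes [measurable]: "h \<in> borel_measurable M" "f \<in> borel_measurable M"
  shows "(\<lambda>x. dot (h x) (f x)) \<in> borel_measurable M"
  unfolding dot_def by measurable

lemma integral_translate:
  fixes f :: "'a::euclidean_space \<Rightarrow> 'b::{banach, second_countable_topology}"
  assumes [measurable]: "f \<in> borel_measurable borel"
  shows "(LINT x|lborel. f (x + w)) = (LINT x|lborel. f x)"
proof -
  have "(LINT x|lborel. f x) = (LINT x|distr lborel borel ((+) w). f x)"
    by (simp add: lborel_distr_plus)
  also have "\<dots> = (LINT x|lborel. f (w + x))"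
    by (subst integral_distr) auto
  finally show ?thesis by (simp add: add.commute)
qed

lemma integrable_translate:
  fixes f :: "'a::euclidean_space \<Rightarrow> 'b::{banach, second_countable_topology}"
  assumes "integrable lborel f"
  shows "integrable lborel (\<lambda>x. f (x + w))"
proof -
  have [measurable]: "f \<in> borel_measurable borel" using assms by simp
  have "integrable (distr lborel borel ((+) w)) f"
    using assms by (simp add: lborel_distr_plus)
  then have "integrable lborel (\<lambda>x. f (w + x))"
    by (subst (asm) integrable_distr_eq) auto
  then show ?thesis by (simp add: add.commute)
qed

lemma l2sq_imp_integrable:
  fixes f :: "'a::euclidean_space \<Rightarrow> 'b::{banach, second_countable_topology}"
  assumes [measurable]: "f \<in> borel_measurable borel" and "l2sq f < \<infinity>"
    and "bounded S" "\<And>x. x \<notin> S \<Longrightarrow> f x = 0"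
  shows "integrable lborel f"
proof -
  obtain a b where ab: "S \<subseteq> cbox a b" using bounded_subset_cbox_symmetric[OF \<open>bounded S\<close>] by metis
  show ?thesis
  proof (rule integrableI_bounded)
    have "(\<integral>\<^sup>+x. ennreal (norm (f x)) \<partial>lborel) \<le> (\<integral>\<^sup>+x. indicator (cbox a b) x + ennreal ((norm (f x))\<^sup>2) \<partial>lborel)"
    proof (rule nn_integral_mono)
      fix x
      show "ennreal (norm (f x)) \<le> indicator (cbox a b) x + ennreal ((norm (f x))\<^sup>2)"
      proof (cases "x \<in> S")
        case True
        have "norm (f x) \<le> 1 + (norm (f x))\<^sup>2"
          using sum_squares_bound[of "norm (f x)" 1] norm_ge_zero[of "f x"] by (simp del: norm_ge_zero)
        then have "ennreal (norm (f x)) \<le> ennreal (1 + (norm (f x))\<^sup>2)" by (rule ennreal_leI)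
        then show ?thesis using True ab by (auto simp: indicator_def)
      qed (use assms(4) in simp)
    qed
    also have "\<dots> = emeasure lborel (cbox a b) + l2sq f"
      unfolding l2sq_def by (subst nn_integral_add) auto
    also have "\<dots> < \<infinity>" using assms(2) emeasure_lborel_cbox_finite[of a b] by simp
    finally show "(\<integral>\<^sup>+x. ennreal (norm (f x)) \<partial>lborel) < \<infinity>" .
  qed simp
qed

text \<open>A Borel representative of a weakly differentiable function and of its gradient, both continued by
zero outside the domain.  The continuation makes translates and integrals over the whole space
available.  It is in general not weakly differentiable across the boundary, so differences of \<open>u\<close>
are expressed by \<open>g\<close> only along segments inside the domain.\<close>

locale sobolev_function =
  fixes \<Omega> :: "(real^'n) set" and u :: "real^'n \<Rightarrow> complex" and g :: "real^'n \<Rightarrow> complex^'n"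
  assumes open_dom: "open \<Omega>" and bounded_dom: "bounded \<Omega>"
    and u_meas[measurable]: "u \<in> borel_measurable borel" and g_meas[measurable]: "g \<in> borel_measurable borel"
    and u_outside: "\<And>x. x \<notin> \<Omega> \<Longrightarrow> u x = 0" and g_outside: "\<And>x. x \<notin> \<Omega> \<Longrightarrow> g x = 0"
    and u_l2: "l2sq u < \<infinity>" and g_l2: "l2sq g < \<infinity>"
    and weak: "\<And>j \<phi> \<psi>. test_function \<Omega> \<phi> \<Longrightarrow> (\<And>x. has_partial_derivative \<phi> j x (\<psi> x)) \<Longrightarrow>
       continuous_on UNIV \<phi> \<Longrightarrow> continuous_on UNIV \<psi> \<Longrightarrow>
       (LINT x|lborel. \<psi> x *\<^sub>R u x) = - (LINT x|lborel. \<phi> x *\<^sub>R (g x $ j))"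
begin

lemma u_integrable: "integrable lborel u"
  by (rule l2sq_imp_integrable[OF u_meas u_l2 bounded_dom u_outside])

lemma g_integrable: "integrable lborel g"
  by (rule l2sq_imp_integrable[OF g_meas g_l2 bounded_dom g_outside])

lemma dot_g_integrable: "integrable lborel (\<lambda>x. dot v (g x))"
proof (rule Bochner_Integration.integrable_bound)
  show "integrable lborel (\<lambda>x. norm v *\<^sub>R g x)" using g_integrable by simp
  show "AE x in lborel. norm (dot v (g x)) \<le> norm (norm v *\<^sub>R g x)"
    by (simp add: norm_dot_le)
qed simp

definition segment_inside :: "real^'n \<Rightarrow> (real^'n) set" where
  "segment_inside v = {x. closed_segment x (x + v) \<subseteq> \<Omega>}"

lemma segment_inside_iff: "x \<in> segment_inside v \<longleftrightarrow> (\<forall>t\<in>{0..1}. x + t *\<^sub>R v \<in> \<Omega>)"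
proof -
  have "closed_segment x (x + v) = (\<lambda>t. x + t *\<^sub>R v) ` {0..1}"
    by (auto simp: closed_segment_def algebra_simps image_iff Bex_def)
  then show ?thesis by (auto simp: segment_inside_def)
qed

lemma open_segment_inside: "open (segment_inside v)"
proof (rule openI)
  fix x assume "x \<in> segment_inside v"
  then have sub: "closed_segment x (x + v) \<subseteq> \<Omega>" by (simp add: segment_inside_def)
  obtain e where e: "e > 0" "(\<Union>y\<in>closed_segment x (x + v). ball y e) \<subseteq> \<Omega>"
    using compact_subset_open_imp_ball_epsilon_subset[OF compact_segment open_dom sub] by metis
  have "ball x e \<subseteq> segment_inside v"
  proof
    fix y assume y: "y \<in> ball x e"
    show "y \<in> segment_inside v"
      unfolding segment_inside_iff
    proof
      fix t :: real assume t: "t \<in> {0..1}"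
      have "x + t *\<^sub>R v \<in> closed_segment x (x + v)"
        unfolding closed_segment_def using t by (auto intro!: exI[of _ t] simp: algebra_simps)
      moreover have "y + t *\<^sub>R v \<in> ball (x + t *\<^sub>R v) e"
        using y by (simp add: dist_norm)
      ultimately show "y + t *\<^sub>R v \<in> \<Omega>" using e(2) by blast
    qed
  qed
  then show "\<exists>e>0. ball x e \<subseteq> segment_inside v" using e(1) by blast
qed

lemma segment_integrable:
  "integrable (lborel \<Otimes>\<^sub>M lborel) (\<lambda>(\<tau>::real, x). indicat_real {0..1} \<tau> *\<^sub>R dot v (g (x + \<tau> *\<^sub>R v)))"
proof (rule integrableI_bounded)
  have "(\<integral>\<^sup>+p. ennreal (norm (case p of (\<tau>::real, x) \<Rightarrow> indicat_real {0..1} \<tau> *\<^sub>R dot v (g (x + \<tau> *\<^sub>R v)))) \<partial>(lborel \<Otimes>\<^sub>M lborel))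
      = (\<integral>\<^sup>+\<tau>. \<integral>\<^sup>+x. ennreal (norm (indicat_real {0..1} \<tau> *\<^sub>R dot v (g (x + \<tau> *\<^sub>R v)))) \<partial>lborel \<partial>lborel)"
    by (subst lborel.nn_integral_fst[symmetric]) auto
  also have "\<dots> = (\<integral>\<^sup>+\<tau>. indicator {0..1} (\<tau>::real) * (\<integral>\<^sup>+x. ennreal (norm (dot v (g x))) \<partial>lborel) \<partial>lborel)"
  proof (rule nn_integral_cong)
    fix \<tau> :: real
    have "(\<integral>\<^sup>+x. ennreal (norm (indicat_real {0..1} \<tau> *\<^sub>R dot v (g (x + \<tau> *\<^sub>R v)))) \<partial>lborel)
        = (\<integral>\<^sup>+x. indicator {0..1} \<tau> * ennreal (norm (dot v (g (x + \<tau> *\<^sub>R v)))) \<partial>lborel)"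
      by (intro nn_integral_cong) (auto simp: indicator_def)
    also have "\<dots> = indicator {0..1} \<tau> * (\<integral>\<^sup>+x. ennreal (norm (dot v (g (x + \<tau> *\<^sub>R v)))) \<partial>lborel)"
      by (rule nn_integral_cmult) simp
    also have "(\<integral>\<^sup>+x. ennreal (norm (dot v (g (x + \<tau> *\<^sub>R v)))) \<partial>lborel) = (\<integral>\<^sup>+x. ennreal (norm (dot v (g x))) \<partial>lborel)"
      by (rule nn_integral_translate[of "\<lambda>x. ennreal (norm (dot v (g x)))"]) simp
    finally show "(\<integral>\<^sup>+x. ennreal (norm (indicat_real {0..1} \<tau> *\<^sub>R dot v (g (x + \<tau> *\<^sub>R v)))) \<partial>lborel)
        = indicator {0..1} \<tau> * (\<integral>\<^sup>+x. ennreal (norm (dot v (g x))) \<partial>lborel)" .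
  qed
  also have "\<dots> = (\<integral>\<^sup>+x. ennreal (norm (dot v (g x))) \<partial>lborel)"
    by (subst nn_integral_multc) auto
  also have "\<dots> < \<infinity>" using dot_g_integrable[of v] by (simp add: integrable_iff_bounded)
  finally show "(\<integral>\<^sup>+p. ennreal (norm (case p of (\<tau>::real, x) \<Rightarrow> indicat_real {0..1} \<tau> *\<^sub>R dot v (g (x + \<tau> *\<^sub>R v)))) \<partial>(lborel \<Otimes>\<^sub>M lborel)) < \<infinity>" .
qed measurable

definition path_integral :: "real^'n \<Rightarrow> real^'n \<Rightarrow> complex" where
  "path_integral v x = (LINT \<tau>|lborel. indicat_real {0..1} \<tau> *\<^sub>R dot v (g (x + \<tau> *\<^sub>R v)))"

lemma path_integral_integrable: "integrable lborel (path_integral v)"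
  unfolding path_integral_def
  using lborel_pair.integrable_snd[OF segment_integrable[of v]] by simp

text \<open>This is the segment formula tested against a bump \<open>\<phi>\<close>.  By the fundamental theorem of calculus
\<open>\<phi>(x) - \<phi>(x - v)\<close> is the integral over \<open>\<tau> \<in> [0, 1]\<close> of \<open>v \<bullet> \<nabla>\<phi>(x - \<tau> v)\<close>.  For each fixed \<open>\<tau>\<close> the weak
derivative moves the gradient from the translated bump to \<open>u\<close>, and translating back and exchanging
the integrals gives the claim.\<close>

lemma box_bump_segment_identity:
  assumes c: "c > 0" and sub: "cbox a b \<subseteq> segment_inside v"
  shows "(LINT x|lborel. box_bump c a b x *\<^sub>R (u (x + v) - u x - path_integral v x)) = 0"
proof -
  define \<phi> where "\<phi> = box_bump c a b"
  define D where "D y = (\<Sum>j\<in>UNIV. v $ j * box_bump_partial c a b j y)" for y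
  have \<phi>_cont: "continuous_on UNIV \<phi>" unfolding \<phi>_def by (rule box_bump_continuous[OF c])
  have D_cont: "continuous_on UNIV D"
    unfolding D_def by (intro continuous_intros box_bump_continuous[OF c])
  have [measurable]: "\<phi> \<in> borel_measurable borel" "D \<in> borel_measurable borel"
    using \<phi>_cont D_cont by (auto intro: borel_measurable_continuous_onI)
  have \<phi>1: "norm (\<phi> x) \<le> 1" for x unfolding \<phi>_def using box_bump_bounds[OF c, of a b x] by simp
  have "bounded (D ` cbox a b)"
    by (intro compact_imp_bounded compact_continuous_image compact_cbox continuous_on_subset[OF D_cont]) simp
  then obtain B where B: "\<And>x. x \<in> cbox a b \<Longrightarrow> norm (D x) \<le> B" "B > 0"
    by (auto simp: bounded_pos)
  have D0: "D x = 0" if "x \<notin> cbox a b" for x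
    unfolding D_def using box_bump_partial_zero[OF c that] by simp
  have DB: "norm (D x) \<le> B" for x using B D0[of x] by (cases "x \<in> cbox a b") auto
  have bound_int: "integrable lborel (\<lambda>x. f x *\<^sub>R h x)"
    if "integrable lborel h" "f \<in> borel_measurable borel" "\<And>x. norm (f x) \<le> K"
    for f :: "real^'n \<Rightarrow> real" and h :: "real^'n \<Rightarrow> complex" and K
  proof (rule Bochner_Integration.integrable_bound)
    show "integrable lborel (\<lambda>x. K *\<^sub>R h x)" using that by simp
    have "0 \<le> K" using that(3)[of 0] norm_ge_zero order_trans by blast
    then show "AE x in lborel. norm (f x *\<^sub>R h x) \<le> norm (K *\<^sub>R h x)"
      using that(3) by (auto intro!: mult_right_mono)
    show "(\<lambda>x. f x *\<^sub>R h x) \<in> borel_measurable lborel"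
      using that(2) borel_measurable_integrable[OF that(1)] by simp
  qed
  \<comment> \<open>The box consists of starting points of segments inside the domain, so the bump shifted by
    \<open>\<tau> v\<close> is still supported in the domain.\<close>
  have A: "(LINT x|lborel. D (x - \<tau> *\<^sub>R v) *\<^sub>R u x) = - (LINT x|lborel. \<phi> x *\<^sub>R dot v (g (x + \<tau> *\<^sub>R v)))"
    if \<tau>: "\<tau> \<in> {0..1}" for \<tau>
  proof -
    define a' b' where "a' = a + \<tau> *\<^sub>R v" and "b' = b + \<tau> *\<^sub>R v"
    have "cbox a' b' \<subseteq> \<Omega>"
    proof
      fix x assume "x \<in> cbox a' b'"
      then have "x - \<tau> *\<^sub>R v \<in> cbox a b"
        by (auto simp: mem_box_cart a'_def b'_def algebra_simps)
      then have "x - \<tau> *\<^sub>R v \<in> segment_inside v" using sub by blast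
      then have "x - \<tau> *\<^sub>R v + \<tau> *\<^sub>R v \<in> \<Omega>" using \<tau> unfolding segment_inside_iff by blast
      then show "x \<in> \<Omega>" by simp
    qed
    then have test: "test_function \<Omega> (box_bump c a' b')" by (rule box_bump_test_function[OF c])
    have shift: "box_bump c a' b' x = \<phi> (x - \<tau> *\<^sub>R v)"
      "box_bump_partial c a' b' j x = box_bump_partial c a b j (x - \<tau> *\<^sub>R v)" for x j
      unfolding \<phi>_def a'_def b'_def using box_bump_shift box_bump_partial_shift[OF c] by metis+
    have part[measurable]: "box_bump_partial c a' b' j \<in> borel_measurable borel" for j
      by (intro borel_measurable_continuous_onI box_bump_continuous[OF c])
    have int1: "integrable lborel (\<lambda>x. (v $ j * box_bump_partial c a' b' j x) *\<^sub>R u x)" for j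
    proof -
      have "bounded (box_bump_partial c a' b' j ` cbox a' b')"
        by (intro compact_imp_bounded compact_continuous_image compact_cbox
            continuous_on_subset[OF box_bump_continuous(2)[OF c]]) simp
      then obtain K where K: "\<And>x. x \<in> cbox a' b' \<Longrightarrow> norm (box_bump_partial c a' b' j x) \<le> K" "K > 0"
        by (auto simp: bounded_pos)
      have "norm (v $ j * box_bump_partial c a' b' j x) \<le> \<bar>v $ j\<bar> * K" for x
        using K box_bump_partial_zero[OF c, of x a' b' j]
        by (cases "x \<in> cbox a' b'") (auto simp: abs_mult intro!: mult_left_mono)
      then show ?thesis by (intro bound_int u_integrable) auto
    qed
    have int2: "integrable lborel (\<lambda>x. (v $ j * box_bump c a' b' x) *\<^sub>R (g x $ j))" for j
    proof (rule bound_int)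
      show "integrable lborel (\<lambda>x. g x $ j)"
        by (rule Bochner_Integration.integrable_bound[OF g_integrable])
          (simp, intro AE_I2 Finite_Cartesian_Product.norm_nth_le)
      have "box_bump c a' b' \<in> borel_measurable borel"
        by (intro borel_measurable_continuous_onI box_bump_continuous[OF c])
      then show "(\<lambda>x. v $ j * box_bump c a' b' x) \<in> borel_measurable borel" by simp
      show "norm (v $ j * box_bump c a' b' x) \<le> \<bar>v $ j\<bar>" for x
        using box_bump_bounds[OF c, of a' b' x] mult_left_mono[of "box_bump c a' b' x" 1 "\<bar>v $ j\<bar>"] by (simp add: abs_mult)
    qed
    have "(LINT x|lborel. D (x - \<tau> *\<^sub>R v) *\<^sub>R u x) = (LINT x|lborel. (\<Sum>j\<in>UNIV. (v $ j * box_bump_partial c a' b' j x) *\<^sub>R u x))"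
      unfolding D_def shift by (simp add: scaleR_sum_left)
    also have "\<dots> = (\<Sum>j\<in>UNIV. LINT x|lborel. (v $ j * box_bump_partial c a' b' j x) *\<^sub>R u x)"
      by (rule Bochner_Integration.integral_sum) (rule int1)
    also have "\<dots> = (\<Sum>j\<in>UNIV. v $ j *\<^sub>R (LINT x|lborel. box_bump_partial c a' b' j x *\<^sub>R u x))"
      by (simp flip: scaleR_scaleR)
    also have "\<dots> = (\<Sum>j\<in>UNIV. v $ j *\<^sub>R (- (LINT x|lborel. box_bump c a' b' x *\<^sub>R (g x $ j))))"
      using weak[OF test box_bump_partial[OF c] box_bump_continuous(1)[OF c] box_bump_continuous(2)[OF c]] by simp
    also have "\<dots> = - (\<Sum>j\<in>UNIV. LINT x|lborel. (v $ j * box_bump c a' b' x) *\<^sub>R (g x $ j))"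
      by (simp add: sum_negf flip: scaleR_scaleR)
    also have "(\<Sum>j\<in>UNIV. LINT x|lborel. (v $ j * box_bump c a' b' x) *\<^sub>R (g x $ j))
        = (LINT x|lborel. (\<Sum>j\<in>UNIV. (v $ j * box_bump c a' b' x) *\<^sub>R (g x $ j)))"
      by (rule Bochner_Integration.integral_sum[symmetric]) (rule int2)
    also have "\<dots> = (LINT x|lborel. \<phi> (x - \<tau> *\<^sub>R v) *\<^sub>R dot v (g x))"
      unfolding dot_def shift by (simp add: scaleR_sum_right mult.commute)
    also have "\<dots> = (LINT x|lborel. \<phi> (x + \<tau> *\<^sub>R v - \<tau> *\<^sub>R v) *\<^sub>R dot v (g (x + \<tau> *\<^sub>R v)))"
      by (rule integral_translate[symmetric, of "\<lambda>x. \<phi> (x - \<tau> *\<^sub>R v) *\<^sub>R dot v (g x)"]) measurable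
    finally show ?thesis by simp
  qed
  have B': "(LINT \<tau>|lborel. indicat_real {0..1} \<tau> * D (x - \<tau> *\<^sub>R v)) = \<phi> x - \<phi> (x - v)" for x
  proof -
    have "(LINT \<tau>|lborel. indicat_real {0..1} \<tau> *\<^sub>R (- D (x - \<tau> *\<^sub>R v))) = \<phi> (x - 1 *\<^sub>R v) - \<phi> (x - 0 *\<^sub>R v)"
    proof (rule integral_FTC_Icc[where F = "\<lambda>\<tau>. \<phi> (x - \<tau> *\<^sub>R v)"])
      show "continuous_on {0..1} (\<lambda>\<tau>. - D (x - \<tau> *\<^sub>R v))"
        by (intro continuous_intros continuous_on_compose2[OF D_cont]) auto
      show "((\<lambda>\<tau>. \<phi> (x - \<tau> *\<^sub>R v)) has_vector_derivative - D (x - \<tau> *\<^sub>R v)) (at \<tau> within {0..1})" for \<tau>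
        using box_bump_line_derivative[OF c, of a b x v \<tau>] unfolding \<phi>_def D_def
        by (simp add: has_real_derivative_iff_has_vector_derivative has_vector_derivative_at_within)
    qed simp
    then show ?thesis by simp
  qed
  have intD: "integrable (lborel \<Otimes>\<^sub>M lborel) (\<lambda>(\<tau>::real, x). (indicat_real {0..1} \<tau> * D (x - \<tau> *\<^sub>R v)) *\<^sub>R u x)"
  proof (rule Bochner_Integration.integrable_bound)
    have "integrable (lborel \<Otimes>\<^sub>M lborel) (\<lambda>(\<tau>::real, x). (B * indicat_real {0..1} \<tau>) *\<^sub>R u x)"
    proof (rule lborel_pair.Fubini_integrable)
      show "integrable lborel (\<lambda>\<tau>::real. LINT x|lborel. norm (case (\<tau>, x) of (\<tau>, x) \<Rightarrow> (B * indicat_real {0..1} \<tau>) *\<^sub>R u x))"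
        using B(2) by (simp add: abs_mult)
      show "AE \<tau>::real in lborel. integrable lborel (\<lambda>x. case (\<tau>, x) of (\<tau>, x) \<Rightarrow> (B * indicat_real {0..1} \<tau>) *\<^sub>R u x)"
        using u_integrable by simp
    qed measurable
    then show "integrable (lborel \<Otimes>\<^sub>M lborel) (\<lambda>(\<tau>::real, x). (B * indicat_real {0..1} \<tau>) *\<^sub>R u x)" .
    show "AE p in lborel \<Otimes>\<^sub>M lborel. norm (case p of (\<tau>::real, x) \<Rightarrow> (indicat_real {0..1} \<tau> * D (x - \<tau> *\<^sub>R v)) *\<^sub>R u x)
        \<le> norm (case p of (\<tau>, x) \<Rightarrow> (B * indicat_real {0..1} \<tau>) *\<^sub>R u x)"
      using DB B(2) by (intro AE_I2) (auto simp: abs_mult indicator_def intro!: mult_right_mono)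
  qed measurable
  have int\<phi>: "integrable (lborel \<Otimes>\<^sub>M lborel) (\<lambda>(\<tau>::real, x). \<phi> x *\<^sub>R (indicat_real {0..1} \<tau> *\<^sub>R dot v (g (x + \<tau> *\<^sub>R v))))"
  proof (rule Bochner_Integration.integrable_bound[OF segment_integrable[of v]])
    show "AE p in lborel \<Otimes>\<^sub>M lborel. norm (case p of (\<tau>::real, x) \<Rightarrow> \<phi> x *\<^sub>R (indicat_real {0..1} \<tau> *\<^sub>R dot v (g (x + \<tau> *\<^sub>R v))))
        \<le> norm (case p of (\<tau>, x) \<Rightarrow> indicat_real {0..1} \<tau> *\<^sub>R dot v (g (x + \<tau> *\<^sub>R v)))"
      using \<phi>1 by (intro AE_I2) (auto simp: indicator_def intro!: mult_left_le_one_le)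
  qed measurable
  have "(LINT x|lborel. (\<phi> x - \<phi> (x - v)) *\<^sub>R u x)
      = (LINT x|lborel. LINT \<tau>|lborel. (indicat_real {0..1} \<tau> * D (x - \<tau> *\<^sub>R v)) *\<^sub>R u x)"
  proof (rule Bochner_Integration.integral_cong[OF refl])
    fix x
    have "set_integrable lborel {0..1} (\<lambda>\<tau>. D (x - \<tau> *\<^sub>R v))"
      by (intro borel_integrable_atLeastAtMost' continuous_intros continuous_on_compose2[OF D_cont]) auto
    then have "integrable lborel (\<lambda>\<tau>. indicat_real {0..1} \<tau> * D (x - \<tau> *\<^sub>R v))"
      by (simp add: set_integrable_def)
    then show "(\<phi> x - \<phi> (x - v)) *\<^sub>R u x = (LINT \<tau>|lborel. (indicat_real {0..1} \<tau> * D (x - \<tau> *\<^sub>R v)) *\<^sub>R u x)"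
      unfolding B'[symmetric] by (intro integral_scaleR_left[symmetric])
  qed
  also have "\<dots> = (LINT \<tau>|lborel. LINT x|lborel. (indicat_real {0..1} \<tau> * D (x - \<tau> *\<^sub>R v)) *\<^sub>R u x)"
    using lborel_pair.Fubini_integral[OF intD] by simp
  also have "\<dots> = (LINT \<tau>|lborel. - (LINT x|lborel. \<phi> x *\<^sub>R (indicat_real {0..1} \<tau> *\<^sub>R dot v (g (x + \<tau> *\<^sub>R v)))))"
  proof (rule Bochner_Integration.integral_cong[OF refl])
    fix \<tau> :: real
    show "(LINT x|lborel. (indicat_real {0..1} \<tau> * D (x - \<tau> *\<^sub>R v)) *\<^sub>R u x)
        = - (LINT x|lborel. \<phi> x *\<^sub>R (indicat_real {0..1} \<tau> *\<^sub>R dot v (g (x + \<tau> *\<^sub>R v))))"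
      using A[of \<tau>] by (cases "\<tau> \<in> {0..1}") auto
  qed
  also have "\<dots> = - (LINT x|lborel. LINT \<tau>|lborel. \<phi> x *\<^sub>R (indicat_real {0..1} \<tau> *\<^sub>R dot v (g (x + \<tau> *\<^sub>R v))))"
    using lborel_pair.Fubini_integral[OF int\<phi>] by simp
  also have "\<dots> = - (LINT x|lborel. \<phi> x *\<^sub>R path_integral v x)"
    unfolding path_integral_def by (simp del: scaleR_scaleR)
  finally have main: "(LINT x|lborel. (\<phi> x - \<phi> (x - v)) *\<^sub>R u x) = - (LINT x|lborel. \<phi> x *\<^sub>R path_integral v x)" .
  have i1: "integrable lborel (\<lambda>x. \<phi> x *\<^sub>R u x)" and i3: "integrable lborel (\<lambda>x. \<phi> x *\<^sub>R u (x + v))"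
    and i4: "integrable lborel (\<lambda>x. \<phi> x *\<^sub>R path_integral v x)"
    by (intro bound_int[OF _ _ \<phi>1] u_integrable integrable_translate path_integral_integrable; simp)+
  have i2: "integrable lborel (\<lambda>x. \<phi> (x - v) *\<^sub>R u x)"
    by (intro bound_int[OF u_integrable _ \<phi>1]) simp
  have t: "(LINT x|lborel. \<phi> x *\<^sub>R u (x + v)) = (LINT x|lborel. \<phi> (x - v) *\<^sub>R u x)"
    using integral_translate[of "\<lambda>x. \<phi> (x - v) *\<^sub>R u x" v] by simp
  have "(LINT x|lborel. \<phi> x *\<^sub>R (u (x + v) - u x - path_integral v x))
      = (LINT x|lborel. \<phi> x *\<^sub>R u (x + v)) - (LINT x|lborel. \<phi> x *\<^sub>R u x) - (LINT x|lborel. \<phi> x *\<^sub>R path_integral v x)"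
    using i1 i3 i4 by (simp add: scaleR_diff_right)
  also have "\<dots> = 0"
  proof -
    have "(LINT x|lborel. \<phi> x *\<^sub>R u x) - (LINT x|lborel. \<phi> (x - v) *\<^sub>R u x) = - (LINT x|lborel. \<phi> x *\<^sub>R path_integral v x)"
      using main i1 i2 by (simp add: scaleR_diff_left)
    from arg_cong[OF this, of uminus] show ?thesis unfolding t by simp
  qed
  finally show ?thesis by (simp add: \<phi>_def)
qed

text \<open>The bumps of a box converge boundedly to its indicator, so the difference of both sides has
integral zero over every box whose closure lies in the open set \<open>segment_inside v\<close>.\<close>

theorem segment_identity:
  "AE x in lborel. x \<in> segment_inside v \<longrightarrow> u (x + v) - u x = path_integral v x"
proof -
  define W where "W x = u (x + v) - u x - path_integral v x" for x
  have W: "integrable lborel W"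
    unfolding W_def by (intro Bochner_Integration.integrable_diff integrable_translate u_integrable path_integral_integrable)
  have "AE x in lborel. x \<in> segment_inside v \<longrightarrow> W x = 0"
  proof (rule AE_eq_0_on_open_if_box_integrals_0[OF W open_segment_inside])
    fix a b assume sub: "cbox a b \<subseteq> segment_inside v"
    have [measurable]: "W \<in> borel_measurable borel" using W by simp
    have "(\<lambda>n. LINT x|lborel. box_bump (1 / real (Suc n)) a b x *\<^sub>R W x)
        \<longlonglongrightarrow> (LINT x|lborel. indicat_real (box a b) x *\<^sub>R W x)"
    proof (rule integral_dominated_convergence[where w = "\<lambda>x. norm (W x)"])
      show "(\<lambda>x. box_bump (1 / real (Suc n)) a b x *\<^sub>R W x) \<in> borel_measurable lborel" for n
        using borel_measurable_continuous_onI[OF box_bump_continuous(1), of "1 / real (Suc n)" a b] by simp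
      show "AE x in lborel. norm (box_bump (1 / real (Suc n)) a b x *\<^sub>R W x) \<le> norm (W x)" for n
        using box_bump_bounds[of "1 / real (Suc n)" a b]
        by (intro AE_I2) (auto intro!: mult_left_le_one_le)
      show "AE x in lborel. (\<lambda>n. box_bump (1 / real (Suc n)) a b x *\<^sub>R W x) \<longlonglongrightarrow> indicat_real (box a b) x *\<^sub>R W x"
        by (intro AE_I2 tendsto_scaleR box_bump_tendsto_indicator tendsto_const)
    qed (use W in auto)
    moreover have "(LINT x|lborel. box_bump (1 / real (Suc n)) a b x *\<^sub>R W x) = 0" for n
      unfolding W_def by (rule box_bump_segment_identity[OF _ sub]) simp
    ultimately show "(LINT x:box a b|lborel. W x) = 0"
      by (simp add: set_lebesgue_integral_def LIMSEQ_const_iff)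
  qed
  then show ?thesis by eventually_elim (simp add: W_def)
qed

text \<open>This is the Cauchy-Schwarz inequality along the segment.  The vector \<open>y\<close> is free because it will
be the gradient at a point that need not lie on the segment.\<close>

lemma segment_difference_bound:
  "AE x in lborel. x \<in> segment_inside v \<longrightarrow> (\<forall>y. ennreal ((norm (u (x + v) - u x - dot v y))\<^sup>2)
     \<le> ennreal ((norm v)\<^sup>2) * (\<integral>\<^sup>+\<tau>\<in>{0..1}. ennreal ((norm (g (x + \<tau> *\<^sub>R v) - y))\<^sup>2) \<partial>lborel))"
proof -
  have "AE x in lborel. integrable lborel (\<lambda>\<tau>::real. indicat_real {0..1} \<tau> *\<^sub>R dot v (g (x + \<tau> *\<^sub>R v)))"
    using lborel_pair.AE_integrable_snd[OF segment_integrable[of v]] by simp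
  with segment_identity[of v] show ?thesis
  proof eventually_elim
    case (elim x)
    show ?case
    proof (intro impI allI)
      fix y assume "x \<in> segment_inside v"
      then have id: "u (x + v) - u x = path_integral v x" using elim by simp
      have "dot v y = (LINT \<tau>|lborel. indicat_real {0..1::real} \<tau> *\<^sub>R dot v y)" by simp
      then have "u (x + v) - u x - dot v y
          = (LINT \<tau>|lborel. indicat_real {0..1} \<tau> *\<^sub>R dot v (g (x + \<tau> *\<^sub>R v)) - indicat_real {0..1::real} \<tau> *\<^sub>R dot v y)"
        using elim(2) unfolding id path_integral_def by (subst Bochner_Integration.integral_diff) auto
      also have "\<dots> = (LINT \<tau>|lborel. indicat_real {0..1} \<tau> *\<^sub>R dot v (g (x + \<tau> *\<^sub>R v) - y))"
        by (simp add: dot_diff scaleR_diff_right)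
      finally have eq: "u (x + v) - u x - dot v y = (LINT \<tau>|lborel. indicat_real {0..1} \<tau> *\<^sub>R dot v (g (x + \<tau> *\<^sub>R v) - y))" .
      have "integrable lborel (\<lambda>\<tau>. indicat_real {0..1} \<tau> *\<^sub>R dot v (g (x + \<tau> *\<^sub>R v)) - indicat_real {0..1::real} \<tau> *\<^sub>R dot v y)"
        using elim(2) by (intro Bochner_Integration.integrable_diff) auto
      then have int: "integrable lborel (\<lambda>\<tau>. indicat_real {0..1} \<tau> *\<^sub>R dot v (g (x + \<tau> *\<^sub>R v) - y))"
        by (simp add: dot_diff scaleR_diff_right)
      have "ennreal (norm (u (x + v) - u x - dot v y))
          \<le> (\<integral>\<^sup>+\<tau>. ennreal (norm (indicat_real {0..1} \<tau> *\<^sub>R dot v (g (x + \<tau> *\<^sub>R v) - y))) \<partial>lborel)"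
        unfolding eq by (rule integral_norm_bound_ennreal[OF int])
      also have "\<dots> \<le> (\<integral>\<^sup>+\<tau>. indicator {0..1} \<tau> * (indicator {0..1} \<tau> * ennreal (norm v * norm (g (x + \<tau> *\<^sub>R v) - y))) \<partial>lborel)"
        by (intro nn_integral_mono) (auto simp: indicator_def norm_dot_le intro!: ennreal_leI)
      finally have "(ennreal (norm (u (x + v) - u x - dot v y)))\<^sup>2
          \<le> (\<integral>\<^sup>+\<tau>. indicator {0..1} \<tau> * (indicator {0..1} \<tau> * ennreal (norm v * norm (g (x + \<tau> *\<^sub>R v) - y))) \<partial>lborel)\<^sup>2"
        by (rule power_mono) simp
      also have "\<dots> \<le> (\<integral>\<^sup>+\<tau>. (indicator {0..1::real} \<tau>)\<^sup>2 \<partial>lborel)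
          * (\<integral>\<^sup>+\<tau>. (indicator {0..1} \<tau> * ennreal (norm v * norm (g (x + \<tau> *\<^sub>R v) - y)))\<^sup>2 \<partial>lborel)"
        by (rule Cauchy_Schwarz_nn_integral) measurable
      also have "(\<integral>\<^sup>+\<tau>. (indicator {0..1::real} \<tau>)\<^sup>2 \<partial>lborel) = (\<integral>\<^sup>+\<tau>. indicator {0..1::real} \<tau> \<partial>lborel)"
        by (intro nn_integral_cong) (auto simp: indicator_def)
      also have "\<dots> = 1" by simp
      also have "(\<integral>\<^sup>+\<tau>. (indicator {0..1} \<tau> * ennreal (norm v * norm (g (x + \<tau> *\<^sub>R v) - y)))\<^sup>2 \<partial>lborel)
          = (\<integral>\<^sup>+\<tau>. ennreal ((norm v)\<^sup>2) * (ennreal ((norm (g (x + \<tau> *\<^sub>R v) - y))\<^sup>2) * indicator {0..1} \<tau>) \<partial>lborel)"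
        by (intro nn_integral_cong) (auto simp: indicator_def ennreal_power power_mult_distrib ennreal_mult')
      also have "\<dots> = ennreal ((norm v)\<^sup>2) * (\<integral>\<^sup>+\<tau>\<in>{0..1}. ennreal ((norm (g (x + \<tau> *\<^sub>R v) - y))\<^sup>2) \<partial>lborel)"
        by (rule nn_integral_cmult) measurable
      finally show "ennreal ((norm (u (x + v) - u x - dot v y))\<^sup>2)
          \<le> ennreal ((norm v)\<^sup>2) * (\<integral>\<^sup>+\<tau>\<in>{0..1}. ennreal ((norm (g (x + \<tau> *\<^sub>R v) - y))\<^sup>2) \<partial>lborel)"
        by (simp add: ennreal_power)
    qed
  qed
qed

end

section \<open>Short detours inside Lipschitz domains\<close>

lemma norm_orthogonal_part_le:
  fixes e w :: "'a::real_inner"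
  assumes "norm e = 1"
  shows "norm (w - (w \<bullet> e) *\<^sub>R e) \<le> norm w"
proof (rule power2_le_imp_le)
  have "e \<bullet> e = 1" using assms by (simp add: norm_eq_1)
  then have "(norm (w - (w \<bullet> e) *\<^sub>R e))\<^sup>2 = w \<bullet> w - (w \<bullet> e)\<^sup>2"
    unfolding power2_norm_eq_inner
    by (simp add: inner_diff_left inner_diff_right inner_commute power2_eq_square)
  then show "(norm (w - (w \<bullet> e) *\<^sub>R e))\<^sup>2 \<le> (norm w)\<^sup>2"
    by (simp add: power2_norm_eq_inner)
qed simp

text \<open>The path from \<open>x\<close> via \<open>x + |v| a\<close> and \<open>x + v + |v| a\<close> to \<open>x + v\<close> stays in \<open>S\<close>.  Scaling the offset by
\<open>|v|\<close> keeps the length of the path proportional to the distance of its end points.\<close>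

definition detour_inside :: "'a::real_normed_vector set \<Rightarrow> 'a \<Rightarrow> 'a \<Rightarrow> 'a \<Rightarrow> bool" where
  "detour_inside S a x v \<longleftrightarrow> (\<forall>t\<in>{0..1}. x + t *\<^sub>R (norm v *\<^sub>R a) \<in> S \<and>
     x + norm v *\<^sub>R a + t *\<^sub>R v \<in> S \<and> x + v + t *\<^sub>R (norm v *\<^sub>R a) \<in> S)"

text \<open>Moving up by \<open>(L + 1) |v|\<close> is enough: along the middle leg the graph rises by at most \<open>L |v|\<close>
while the height of the point drops by at most \<open>|v|\<close>.\<close>

lemma epigraph_detour:
  fixes e :: "real^'n"
  assumes e: "norm e = 1" and \<gamma>: "L-lipschitz_on {v. v \<bullet> e = 0} \<gamma>" and "r > 0"
    and S: "S \<inter> ball p r = {x \<in> ball p r. \<gamma> (x - (x \<bullet> e) *\<^sub>R e) < x \<bullet> e}"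
  shows "\<exists>q>0. \<exists>a. \<forall>x v. x \<in> S \<inter> ball p q \<longrightarrow> x + v \<in> S \<inter> ball p q \<longrightarrow> detour_inside S a x v"
proof -
  define \<pi> where "\<pi> w = w - (w \<bullet> e) *\<^sub>R e" for w
  define c where "c = L + 1"
  \<comment> \<open>two points of \<open>ball p q\<close> are less than \<open>2q\<close> apart, so the detour stays within \<open>q + 2q c + 2q\<close> of \<open>p\<close>\<close>
  define q where "q = r / (3 + 2 * c)"
  have L: "L \<ge> 0" using \<gamma> by (rule lipschitz_on_nonneg)
  then have c: "c \<ge> 1" and q: "q > 0" and qr: "q * (3 + 2 * c) = r"
    using \<open>r > 0\<close> by (auto simp: c_def q_def)
  have ee: "e \<bullet> e = 1" using e by (simp add: norm_eq_1)
  have \<pi>_perp: "\<pi> w \<bullet> e = 0" for w by (simp add: \<pi>_def inner_diff_left ee)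
  have \<pi>_le: "norm (\<pi> w) \<le> norm w" for w unfolding \<pi>_def by (rule norm_orthogonal_part_le[OF e])
  have \<pi>_shift: "\<pi> (w + s *\<^sub>R e) = \<pi> w" for w s
    by (simp add: \<pi>_def inner_add_left ee algebra_simps)
  have \<pi>_diff: "\<pi> (w - z) = \<pi> w - \<pi> z" for w z by (simp add: \<pi>_def inner_diff_left algebra_simps)
  have mem: "y \<in> S \<longleftrightarrow> \<gamma> (\<pi> y) < y \<bullet> e" if "y \<in> ball p r" for y
    using S that unfolding \<pi>_def by blast
  have up: "y + s *\<^sub>R e \<in> S" if "y \<in> S" "y \<in> ball p r" "y + s *\<^sub>R e \<in> ball p r" "s \<ge> 0" for y s
    using that mem[of y] mem[of "y + s *\<^sub>R e"] by (simp add: \<pi>_shift inner_add_left ee)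
  have "detour_inside S (c *\<^sub>R e) x v" if x: "x \<in> S \<inter> ball p q" and y: "x + v \<in> S \<inter> ball p q" for x v
  proof -
    define d where "d = norm v"
    have d: "d \<ge> 0" "d < 2 * q"
    proof -
      have "norm v \<le> dist p x + dist p (x + v)"
        using dist_triangle[of x "x + v" p] by (simp add: dist_norm norm_minus_commute[of x p])
      then show "d < 2 * q" using x y by (simp add: d_def)
    qed (simp add: d_def)
    have qle: "q \<le> r" using qr q c by (smt (verit) mult_le_cancel_left1)
    have near: "z \<in> ball p r" if "norm (z - x) \<le> c * d + d" for z
    proof -
      have "dist p z \<le> dist p x + norm (z - x)"
        using dist_triangle[of p z x] by (simp add: dist_norm norm_minus_commute)
      also have "\<dots> < q + (c * d + d)" using x that by simp
      also have "\<dots> \<le> q + (c * (2 * q) + 2 * q)"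
        using d c by (intro add_mono mult_left_mono) auto
      also have "\<dots> = r" using qr by (simp add: algebra_simps)
      finally show ?thesis by simp
    qed
    have xr: "x \<in> ball p r" "x + v \<in> ball p r" using x y qle by auto
    show ?thesis
      unfolding detour_inside_def d_def[symmetric]
    proof (intro ballI conjI)
      fix t :: real assume t: "t \<in> {0..1}"
      have td: "t * d \<le> d" "0 \<le> t * d" using t d by (auto intro: mult_left_le_one_le)
      have tcd: "\<bar>t * d * c\<bar> \<le> c * d" "\<bar>d * c\<bar> = c * d"
        using td c mult_right_mono[OF td(1), of c] d by (auto simp: abs_mult mult.commute)
      have "x + (t * d * c) *\<^sub>R e \<in> S"
        using x xr td c tcd e d by (intro up near) auto
      then show "x + t *\<^sub>R (d *\<^sub>R (c *\<^sub>R e)) \<in> S" by (simp add: mult.assoc)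
      have "norm (x + v + (t * d * c) *\<^sub>R e - x) \<le> norm v + norm ((t * d * c) *\<^sub>R e)"
        using norm_triangle_ineq[of v "(t * d * c) *\<^sub>R e"] by (simp add: algebra_simps)
      also have "\<dots> \<le> c * d + d" using tcd e by (simp add: d_def)
      finally have "x + v + (t * d * c) *\<^sub>R e \<in> ball p r" by (rule near)
      then have "x + v + (t * d * c) *\<^sub>R e \<in> S"
        using y xr td c by (intro up) auto
      then show "x + v + t *\<^sub>R (d *\<^sub>R (c *\<^sub>R e)) \<in> S" by (simp add: mult.assoc)
      define z where "z = x + d *\<^sub>R (c *\<^sub>R e) + t *\<^sub>R v"
      have tv: "norm (t *\<^sub>R v) \<le> d" using td t by (simp add: d_def)
      have "norm (z - x) \<le> norm ((d * c) *\<^sub>R e) + norm (t *\<^sub>R v)"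
        using norm_triangle_ineq[of "(d * c) *\<^sub>R e" "t *\<^sub>R v"] by (simp add: z_def algebra_simps)
      also have "\<dots> \<le> c * d + d" using tv tcd(2) e by simp
      finally have zr: "z \<in> ball p r" by (rule near)
      have "\<pi> z = \<pi> (x + t *\<^sub>R v)"
        using \<pi>_shift[of "x + t *\<^sub>R v" "d * c"] by (simp add: z_def algebra_simps)
      then have "norm (\<pi> z - \<pi> x) = norm (\<pi> (t *\<^sub>R v))"
        by (simp flip: \<pi>_diff)
      also have "\<dots> \<le> d" using \<pi>_le[of "t *\<^sub>R v"] tv by linarith
      finally have "L * norm (\<pi> z - \<pi> x) \<le> L * d" using L by (intro mult_left_mono)
      then have "\<gamma> (\<pi> z) \<le> \<gamma> (\<pi> x) + L * d"
        using lipschitz_onD[OF \<gamma>, of "\<pi> z" "\<pi> x"] \<pi>_perp by (simp add: dist_norm)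
      also have "\<gamma> (\<pi> x) < x \<bullet> e" using mem xr x by simp
      also have "x \<bullet> e + L * d \<le> z \<bullet> e"
      proof -
        have "\<bar>(t *\<^sub>R v) \<bullet> e\<bar> \<le> d"
          using Cauchy_Schwarz_ineq2[of "t *\<^sub>R v" e] tv e by simp
        then show ?thesis by (simp add: z_def inner_add_left ee c_def algebra_simps)
      qed
      finally have "\<gamma> (\<pi> z) < z \<bullet> e" by simp
      then show "x + d *\<^sub>R (c *\<^sub>R e) + t *\<^sub>R v \<in> S"
        using mem[OF zr] by (simp add: z_def)
    qed
  qed
  then show ?thesis using q by blast
qed

text \<open>Near a point of \<open>S\<close> the straight segment serves, with offset \<open>a = 0\<close>; near a frontier point the
detour over the graph does.  Compactness of the closure leaves finitely many offsets and a common
distance \<open>r\<close>.\<close>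

lemma lipschitz_boundary_detours:
  fixes S :: "(real^'n) set"
  assumes "open S" "bounded S" "lipschitz_boundary S"
  shows "\<exists>E r. finite E \<and> r > 0 \<and>
    (\<forall>x v. x \<in> S \<longrightarrow> x + v \<in> S \<longrightarrow> norm v < r \<longrightarrow> (\<exists>a\<in>E. detour_inside S a x v))"
proof -
  have "\<exists>q>0. \<exists>a. \<forall>x v. x \<in> S \<inter> ball p q \<longrightarrow> x + v \<in> S \<inter> ball p q \<longrightarrow> detour_inside S a x v"
    if p: "p \<in> closure S" for p
  proof (cases "p \<in> S")
    case True
    then obtain q where q: "q > 0" "ball p q \<subseteq> S" using \<open>open S\<close> open_contains_ball by blast
    have "detour_inside S 0 x v" if x: "x \<in> ball p q" and y: "x + v \<in> ball p q" for x v
    proof -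
      have "x + t *\<^sub>R v \<in> S" if t: "t \<in> {0..1}" for t
      proof -
        have "(1 - t) *\<^sub>R x + t *\<^sub>R (x + v) \<in> ball p q"
          using x y t by (intro convexD[OF convex_ball]) auto
        then show ?thesis using q(2) by (auto simp: algebra_simps)
      qed
      then show ?thesis using q x y unfolding detour_inside_def by auto
    qed
    then show ?thesis using q(1) by blast
  next
    case False
    then have "p \<in> frontier S" using p \<open>open S\<close> by (simp add: frontier_def interior_open)
    then obtain r e \<gamma> L where "r > 0" "norm e = 1" "L-lipschitz_on {v. v \<bullet> e = 0} \<gamma>"
      "S \<inter> ball p r = {x \<in> ball p r. \<gamma> (x - (x \<bullet> e) *\<^sub>R e) < x \<bullet> e}"
      using assms(3) unfolding lipschitz_boundary_def by blast
    then show ?thesis by (intro epigraph_detour)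
  qed
  then obtain q a where qa: "\<And>p. p \<in> closure S \<Longrightarrow> q p > 0"
    "\<And>p x v. p \<in> closure S \<Longrightarrow> x \<in> S \<inter> ball p (q p) \<Longrightarrow> x + v \<in> S \<inter> ball p (q p) \<Longrightarrow> detour_inside S (a p) x v"
    by metis
  have "compact (closure S)" using \<open>bounded S\<close> by simp
  then obtain C where C: "C \<subseteq> closure S" "finite C" "closure S \<subseteq> (\<Union>p\<in>C. ball p (q p / 2))"
    by (rule compactE_image[of "closure S" "closure S" "\<lambda>p. ball p (q p / 2)"]) (use qa(1) in force)+
  define r where "r = Min (insert 1 ((\<lambda>p. q p / 2) ` C))"
  have r: "r > 0" unfolding r_def using C(1,2) qa(1) by (subst Min_gr_iff) auto
  have rq: "r \<le> q p / 2" if "p \<in> C" for p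
    unfolding r_def using C(2) that by (intro Min_le) auto
  have "\<exists>b\<in>a ` C. detour_inside S b x v" if x: "x \<in> S" and y: "x + v \<in> S" and v: "norm v < r" for x v
  proof -
    obtain p where p: "p \<in> C" "x \<in> ball p (q p / 2)"
      using C(3) x closure_subset by blast
    have "dist p (x + v) \<le> dist p x + norm v"
      using dist_triangle[of p "x + v" x] by (simp add: dist_norm)
    then have "x + v \<in> ball p (q p)" "x \<in> ball p (q p)"
      using p rq[OF p(1)] v qa(1)[of p] C(1) by auto
    then have "detour_inside S (a p) x v" using p(1) C(1) x y by (intro qa(2)) auto
    then show ?thesis using p(1) by blast
  qed
  then show ?thesis using r C(2) by (intro exI[of _ "a ` C"] exI[of _ r]) auto
qed

section \<open>Moments of the Bessel kernel\<close>

text \<open>The product formula is needed for signed factors because the mixed second moments of a Gaussian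
vanish by cancellation.\<close>

lemma has_bochner_integral_lborel_prod:
  fixes f :: "'a::euclidean_space \<Rightarrow> real \<Rightarrow> real"
  assumes int: "\<And>b. b \<in> Basis \<Longrightarrow> integrable lborel (f b)"
  shows "has_bochner_integral lborel (\<lambda>x. \<Prod>b\<in>Basis. f b (x \<bullet> b)) (\<Prod>b\<in>Basis. LINT x|lborel. f b x)"
proof -
  interpret product_sigma_finite "\<lambda>_::'a. lborel :: real measure" ..
  have [measurable]: "f b \<in> borel_measurable borel" if "b \<in> Basis" for b using int[OF that] by simp
  let ?P = "\<Pi>\<^sub>M b\<in>(Basis::'a set). (lborel :: real measure)"
  let ?T = "\<lambda>x. \<Sum>b\<in>(Basis::'a set). x b *\<^sub>R b"
  have T[measurable]: "?T \<in> measurable ?P borel" by measurable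
  have eq: "(\<Prod>b\<in>Basis. f b (?T x \<bullet> b)) = (\<Prod>b\<in>Basis. f b (x b))" for x
    by (intro prod.cong) (auto simp: inner_sum_left inner_Basis if_distrib sum.delta cong: if_cong)
  have meas: "(\<lambda>x::'a. \<Prod>b\<in>Basis. f b (x \<bullet> b)) \<in> borel_measurable borel" by measurable
  have "integrable ?P (\<lambda>x. \<Prod>b\<in>Basis. f b (x b))"
    by (rule product_integrable_prod) (auto intro: int)
  then have "integrable lborel (\<lambda>x. \<Prod>b\<in>Basis. f b (x \<bullet> b))"
    by (subst lborel_eq, subst integrable_distr_eq[OF T meas]) (simp add: eq)
  moreover have "(LINT x|lborel. (\<Prod>b\<in>Basis. f b (x \<bullet> b))) = (\<Prod>b\<in>Basis. LINT x|lborel. f b x)"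
    by (subst lborel_eq, subst integral_distr[OF T meas], subst eq, rule product_integral_prod) (auto intro: int)
  ultimately show ?thesis by (simp add: has_bochner_integral_iff)
qed

lemma has_bochner_integral_lborel_prod_cart:
  fixes f :: "'n::finite \<Rightarrow> real \<Rightarrow> real"
  assumes int: "\<And>i. integrable lborel (f i)"
  shows "has_bochner_integral lborel (\<lambda>x::real^'n. \<Prod>i\<in>UNIV. f i (x $ i)) (\<Prod>i\<in>UNIV. LINT x|lborel. f i x)"
proof -
  define idx where "idx b = (THE i. b = axis i (1::real))" for b :: "real^'n"
  have idx: "idx (axis i 1) = i" for i
    unfolding idx_def by (rule the_equality) (auto simp: axis_eq_axis)
  have Basis: "(Basis :: (real^'n) set) = (\<lambda>i. axis i 1) ` UNIV" by (auto simp: Basis_vec_def)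
  have inj: "inj (\<lambda>i::'n. axis i (1::real))" by (auto intro!: injI simp: axis_eq_axis)
  have re: "(\<Prod>b\<in>Basis. F b) = (\<Prod>i\<in>UNIV. F (axis i 1))" for F :: "real^'n \<Rightarrow> real"
    unfolding Basis by (subst prod.reindex[OF inj]) simp
  have "has_bochner_integral lborel (\<lambda>x::real^'n. \<Prod>b\<in>Basis. f (idx b) (x \<bullet> b)) (\<Prod>b\<in>Basis. LINT x|lborel. f (idx b) x)"
    by (rule has_bochner_integral_lborel_prod) (rule int)
  then show ?thesis by (simp add: re idx inner_axis)
qed

definition gauss :: "real \<Rightarrow> real^'n \<Rightarrow> real" where
  "gauss \<sigma> v = (\<Prod>i\<in>UNIV. normal_density 0 \<sigma> (v $ i))"

lemma gauss_measurable[measurable]: "gauss \<sigma> \<in> borel_measurable borel"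
  unfolding gauss_def by measurable

lemma gauss_nonneg: "0 \<le> gauss \<sigma> v"
  by (auto simp: gauss_def intro!: prod_nonneg)

lemma gauss_moment:
  assumes \<sigma>: "\<sigma> > 0"
  shows "has_bochner_integral lborel (\<lambda>v::real^'n. gauss \<sigma> v * (\<Prod>i\<in>UNIV. (v $ i) ^ k i))
     (\<Prod>i\<in>UNIV. LINT x|lborel. normal_density 0 \<sigma> x * x ^ k i)"
proof -
  have "has_bochner_integral lborel (\<lambda>v::real^'n. \<Prod>i\<in>UNIV. normal_density 0 \<sigma> (v $ i) * (v $ i) ^ k i)
     (\<Prod>i\<in>UNIV. LINT x|lborel. normal_density 0 \<sigma> x * x ^ k i)"
    by (rule has_bochner_integral_lborel_prod_cart) (use integrable_normal_moment[OF \<sigma>, of 0] in simp)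
  then show ?thesis by (simp add: gauss_def prod.distrib)
qed

lemma normal_moments:
  assumes \<sigma>: "\<sigma> > 0"
  shows "(LINT x|lborel. normal_density 0 \<sigma> x) = 1" "(LINT x|lborel. normal_density 0 \<sigma> x * x) = 0"
    "(LINT x|lborel. normal_density 0 \<sigma> x * x ^ 2) = \<sigma>\<^sup>2" "(LINT x|lborel. normal_density 0 \<sigma> x * x ^ 4) = 3 * \<sigma> ^ 4"
proof -
  show "(LINT x|lborel. normal_density 0 \<sigma> x) = 1" using integral_normal_moment_even[OF \<sigma>, of 0 0] by simp
  show "(LINT x|lborel. normal_density 0 \<sigma> x * x) = 0" using integral_normal_moment_odd[OF \<sigma>, of 0 0] by simp
  show "(LINT x|lborel. normal_density 0 \<sigma> x * x ^ 2) = \<sigma>\<^sup>2"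
    using integral_normal_moment_even[OF \<sigma>, of 0 1] \<sigma> by (simp add: fact_numeral power2_eq_square)
  show "(LINT x|lborel. normal_density 0 \<sigma> x * x ^ 4) = 3 * \<sigma> ^ 4"
    using integral_normal_moment_even[OF \<sigma>, of 0 2] \<sigma> by (simp add: fact_numeral power_divide flip: power_mult)
qed

lemma gauss_covariance:
  fixes j k :: "'n::finite"
  assumes \<sigma>: "\<sigma> > 0"
  shows "has_bochner_integral lborel (\<lambda>v::real^'n. gauss \<sigma> v * (v $ j * v $ k)) (if j = k then \<sigma>\<^sup>2 else 0)"
proof -
  define p where "p i = (if i = j then 1 else 0) + (if i = k then 1 else (0::nat))" for i
  have "(\<Prod>i\<in>UNIV. (v $ i) ^ p i) = v $ j * v $ k" for v :: "real^'n"
    by (simp add: p_def power_add prod.distrib if_distrib[of "\<lambda>n. _ ^ n"] prod.delta cong: if_cong)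
  moreover have "(\<Prod>i\<in>UNIV. LINT x|lborel. normal_density 0 \<sigma> x * x ^ p i) = (if j = k then \<sigma>\<^sup>2 else 0)"
  proof (cases "j = k")
    case True
    have "(\<Prod>i\<in>UNIV. LINT x|lborel. normal_density 0 \<sigma> x * x ^ p i) = (\<Prod>i\<in>UNIV. if i = j then \<sigma>\<^sup>2 else 1)"
      using True normal_moments[OF \<sigma>] by (intro prod.cong) (auto simp: p_def numeral_2_eq_2)
    then show ?thesis using True by simp
  next
    case False
    then have "(LINT x|lborel. normal_density 0 \<sigma> x * x ^ p j) = 0"
      using normal_moments[OF \<sigma>] by (simp add: p_def)
    then show ?thesis using False by (auto intro!: prod_zero)
  qed
  ultimately show ?thesis using gauss_moment[OF \<sigma>, of p] by simp
qed

lemma gauss_fourth_moment: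
  fixes j :: "'n::finite"
  assumes \<sigma>: "\<sigma> > 0"
  shows "has_bochner_integral lborel (\<lambda>v::real^'n. gauss \<sigma> v * (v $ j) ^ 4) (3 * \<sigma> ^ 4)"
proof -
  define p where "p i = (if i = j then 4 else (0::nat))" for i
  have "(\<Prod>i\<in>UNIV. (v $ i) ^ p i) = (v $ j) ^ 4" for v :: "real^'n"
    by (simp add: p_def if_distrib[of "\<lambda>n. _ ^ n"] prod.delta cong: if_cong)
  moreover have "(\<Prod>i\<in>UNIV. LINT x|lborel. normal_density 0 \<sigma> x * x ^ p i) = (\<Prod>i\<in>UNIV. if i = j then 3 * \<sigma> ^ 4 else 1)"
    using normal_moments[OF \<sigma>] by (intro prod.cong) (auto simp: p_def)
  ultimately show ?thesis using gauss_moment[OF \<sigma>, of p] by simp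
qed

lemma gauss_linear_square:
  fixes a :: "'n::finite \<Rightarrow> real"
  assumes \<sigma>: "\<sigma> > 0"
  shows "has_bochner_integral lborel (\<lambda>v::real^'n. gauss \<sigma> v * (\<Sum>j\<in>UNIV. v $ j * a j)\<^sup>2) (\<sigma>\<^sup>2 * (\<Sum>j\<in>UNIV. (a j)\<^sup>2))"
proof -
  have "has_bochner_integral lborel (\<lambda>v::real^'n. \<Sum>j\<in>UNIV. \<Sum>k\<in>UNIV. (a j * a k) * (gauss \<sigma> v * (v $ j * v $ k)))
     (\<Sum>j\<in>UNIV. \<Sum>k\<in>UNIV. (a j * a k) * (if j = k then \<sigma>\<^sup>2 else 0))"
    by (intro has_bochner_integral_sum has_bochner_integral_mult_right gauss_covariance \<sigma>)
  moreover have "(\<Sum>j\<in>UNIV. \<Sum>k\<in>UNIV. (a j * a k) * (gauss \<sigma> v * (v $ j * v $ k))) = gauss \<sigma> v * (\<Sum>j\<in>UNIV. v $ j * a j)\<^sup>2" for v :: "real^'n"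
    by (simp add: power2_eq_square sum_product sum_distrib_left mult_ac)
  moreover have "(\<Sum>j\<in>UNIV. \<Sum>k\<in>UNIV. (a j * a k) * (if j = k then \<sigma>\<^sup>2 else 0)) = \<sigma>\<^sup>2 * (\<Sum>j\<in>UNIV. (a j)\<^sup>2)"
    by (simp add: power2_eq_square sum_distrib_left if_distrib sum.delta mult_ac cong: if_cong)
  ultimately show ?thesis by simp
qed

lemma has_bochner_integral_imp_nn_integral:
  assumes "has_bochner_integral M f x" "\<And>y. 0 \<le> f y"
  shows "(\<integral>\<^sup>+y. ennreal (f y) \<partial>M) = ennreal x"
  using assms by (subst nn_integral_eq_integral) (auto simp: has_bochner_integral_iff)

lemma gauss_dot_square:
  fixes w :: "complex^'n"
  assumes \<sigma>: "\<sigma> > 0"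
  shows "(\<integral>\<^sup>+v. ennreal (gauss \<sigma> v * (norm (dot v w))\<^sup>2) \<partial>lborel) = ennreal (\<sigma>\<^sup>2 * (norm w)\<^sup>2)"
proof (rule has_bochner_integral_imp_nn_integral)
  have "has_bochner_integral lborel (\<lambda>v. gauss \<sigma> v * (\<Sum>j\<in>UNIV. v $ j * Re (w $ j))\<^sup>2 + gauss \<sigma> v * (\<Sum>j\<in>UNIV. v $ j * Im (w $ j))\<^sup>2)
    (\<sigma>\<^sup>2 * (\<Sum>j\<in>UNIV. (Re (w $ j))\<^sup>2) + \<sigma>\<^sup>2 * (\<Sum>j\<in>UNIV. (Im (w $ j))\<^sup>2))"
    by (intro has_bochner_integral_add gauss_linear_square \<sigma>)
  moreover have "gauss \<sigma> v * (\<Sum>j\<in>UNIV. v $ j * Re (w $ j))\<^sup>2 + gauss \<sigma> v * (\<Sum>j\<in>UNIV. v $ j * Im (w $ j))\<^sup>2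
      = gauss \<sigma> v * (norm (dot v w))\<^sup>2" for v
    by (simp add: dot_def cmod_power2 Re_sum Im_sum algebra_simps)
  moreover have "\<sigma>\<^sup>2 * (\<Sum>j\<in>UNIV. (Re (w $ j))\<^sup>2) + \<sigma>\<^sup>2 * (\<Sum>j\<in>UNIV. (Im (w $ j))\<^sup>2) = \<sigma>\<^sup>2 * (norm w)\<^sup>2"
    by (simp add: norm_vec_def L2_set_def sum_nonneg cmod_power2 sum.distrib algebra_simps)
  ultimately show "has_bochner_integral lborel (\<lambda>v. gauss \<sigma> v * (norm (dot v w))\<^sup>2) (\<sigma>\<^sup>2 * (norm w)\<^sup>2)" by simp
qed (simp add: gauss_nonneg)

lemma gauss_coordinate_fourth:
  assumes \<sigma>: "\<sigma> > 0"
  shows "(\<integral>\<^sup>+v. ennreal (gauss \<sigma> v * ((v::real^'n) $ j) ^ 4) \<partial>lborel) = ennreal (3 * \<sigma> ^ 4)"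
  by (rule has_bochner_integral_imp_nn_integral[OF gauss_fourth_moment[OF \<sigma>]]) (simp add: gauss_nonneg)

text \<open>The exponent \<open>3/2\<close> is half the dimension.\<close>

lemma gauss_eq_exp:
  fixes v :: "real^3"
  assumes "\<sigma> > 0"
  shows "exp (- (norm v)\<^sup>2 / (2 * \<sigma>\<^sup>2)) = (2 * pi * \<sigma>\<^sup>2) powr (3/2) * gauss \<sigma> v"
proof -
  have "gauss \<sigma> v = (1 / sqrt (2 * pi * \<sigma>\<^sup>2)) ^ 3 * exp (\<Sum>i\<in>UNIV. - (v $ i)\<^sup>2 / (2 * \<sigma>\<^sup>2))"
    by (simp add: gauss_def normal_density_def prod_dividef exp_sum power_divide)
  also have "(\<Sum>i\<in>UNIV. - (v $ i)\<^sup>2 / (2 * \<sigma>\<^sup>2)) = - (norm v)\<^sup>2 / (2 * \<sigma>\<^sup>2)"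
    by (simp add: norm_vec_def L2_set_def sum_nonneg sum_negf flip: sum_divide_distrib)
  also have "(1 / sqrt (2 * pi * \<sigma>\<^sup>2)) ^ 3 = 1 / (2 * pi * \<sigma>\<^sup>2) powr (3/2)"
    using assms by (simp add: powr_half_sqrt[symmetric] power_divide powr_powr flip: powr_numeral)
  finally show ?thesis using assms by simp
qed

text \<open>The integrand in the formula for the Bessel function, continued by zero.\<close>

definition bessel_profile :: "real \<Rightarrow> real \<Rightarrow> real \<Rightarrow> real" where
  "bessel_profile \<nu> \<zeta> t = indicator {0<..} t * (exp (- (\<zeta>\<^sup>2 / (4 * t)) - t) * t powr (- 1 - \<nu>))"

lemma bessel_profile_nonneg: "0 \<le> bessel_profile \<nu> \<zeta> t"
  by (simp add: bessel_profile_def)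

lemma bessel_profile_measurable[measurable]:
  assumes [measurable]: "f \<in> borel_measurable M" "g \<in> borel_measurable M"
  shows "(\<lambda>x. bessel_profile \<nu> (f x) (g x)) \<in> borel_measurable M"
  unfolding bessel_profile_def by measurable

text \<open>Near \<open>t = 0\<close> the bound \<open>exp (- a / t) \<le> (4 t / a)\<^sup>4\<close> compensates the singular power and leaves the
integrand of \<open>\<Gamma>(4 - \<nu>)\<close>.  Integrability is what makes \<open>bessel_K\<close> the genuine value of the integral
rather than the default value 0.\<close>

lemma bessel_profile_finite:
  assumes "\<nu> < 4" "\<zeta> > 0"
  shows "integrable lborel (bessel_profile \<nu> \<zeta>)"
proof (rule integrableI_bounded)
  define a where "a = \<zeta>\<^sup>2 / 4"
  have a: "a > 0" using assms by (simp add: a_def)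
  have le: "bessel_profile \<nu> \<zeta> t \<le> (4 / a) ^ 4 * (indicator {0..} t * t powr (4 - \<nu> - 1) / exp t)" for t
  proof (cases "t > 0")
    case True
    have "a / t / 4 \<le> exp (a / t / 4)" using exp_ge_add_one_self[of "a / t / 4"] by linarith
    then have "(a / t / 4) ^ 4 \<le> exp (a / t / 4) ^ 4" using True a by (intro power_mono) auto
    also have "\<dots> = exp (a / t)" by (simp flip: exp_of_nat_mult)
    finally have "exp (- (a / t)) \<le> (4 / a) ^ 4 * t ^ 4"
      using True a by (simp add: exp_minus field_simps)
    then have "exp (- (a / t)) * (exp (- t) * t powr (- 1 - \<nu>)) \<le> (4 / a) ^ 4 * t ^ 4 * (exp (- t) * t powr (- 1 - \<nu>))"
      by (rule mult_right_mono) simp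
    also have "\<dots> = (4 / a) ^ 4 * ((t powr 4 * t powr (- 1 - \<nu>)) * exp (- t))"
      using True by simp
    also have "t powr 4 * t powr (- 1 - \<nu>) = t powr (4 - \<nu> - 1)"
      unfolding powr_add[symmetric] by (simp add: algebra_simps)
    also have "exp (- (a / t)) * (exp (- t) * t powr (- 1 - \<nu>)) = bessel_profile \<nu> \<zeta> t"
    proof -
      have "exp (- (a / t)) * exp (- t) = exp (- (\<zeta>\<^sup>2 / (4 * t)) - t)"
        unfolding exp_add[symmetric] by (simp add: a_def)
      then show ?thesis using True by (simp add: bessel_profile_def flip: mult.assoc)
    qed
    finally show ?thesis using True by (simp add: exp_minus field_simps)
  qed (use a in \<open>auto simp: bessel_profile_def indicator_def\<close>)
  have "(\<integral>\<^sup>+t. ennreal (norm (bessel_profile \<nu> \<zeta> t)) \<partial>lborel)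
      \<le> (\<integral>\<^sup>+t. ennreal ((4 / a) ^ 4) * ennreal (indicator {0..} t * t powr (4 - \<nu> - 1) / exp t) \<partial>lborel)"
  proof (rule nn_integral_mono)
    fix t
    have "ennreal (norm (bessel_profile \<nu> \<zeta> t)) \<le> ennreal ((4 / a) ^ 4 * (indicator {0..} t * t powr (4 - \<nu> - 1) / exp t))"
      using le[of t] by (intro ennreal_leI) (simp add: bessel_profile_nonneg)
    also have "\<dots> = ennreal ((4 / a) ^ 4) * ennreal (indicator {0..} t * t powr (4 - \<nu> - 1) / exp t)"
      by (rule ennreal_mult') (use a in simp)
    finally show "ennreal (norm (bessel_profile \<nu> \<zeta> t)) \<le> ennreal ((4 / a) ^ 4) * ennreal (indicator {0..} t * t powr (4 - \<nu> - 1) / exp t)" .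
  qed
  also have "\<dots> = ennreal ((4 / a) ^ 4) * ennreal (Gamma (4 - \<nu>))"
    using assms by (subst nn_integral_cmult) (auto simp: Gamma_conv_nn_integral_real)
  also have "\<dots> < \<infinity>" by (simp add: ennreal_mult_less_top)
  finally show "(\<integral>\<^sup>+t. ennreal (norm (bessel_profile \<nu> \<zeta> t)) \<partial>lborel) < \<infinity>" .
qed measurable

lemma bessel_K_nn_integral:
  assumes "\<nu> < 4" "\<zeta> > 0"
  shows "ennreal (bessel_K \<nu> \<zeta>) = ennreal (1 / 2 * (\<zeta> / 2) powr \<nu>) * (\<integral>\<^sup>+t. ennreal (bessel_profile \<nu> \<zeta> t) \<partial>lborel)"
proof -
  have "(LINT t:{0<..}|lebesgue. exp (- (\<zeta>\<^sup>2 / (4 * t)) - t) * t powr (- 1 - \<nu>)) = (LINT t|lebesgue. bessel_profile \<nu> \<zeta> t)"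
    by (simp add: set_lebesgue_integral_def bessel_profile_def[abs_def])
  also have "\<dots> = (LINT t|lborel. bessel_profile \<nu> \<zeta> t)"
    by (rule integral_completion) measurable
  finally have "bessel_K \<nu> \<zeta> = 1 / 2 * (\<zeta> / 2) powr \<nu> * (LINT t|lborel. bessel_profile \<nu> \<zeta> t)"
    by (simp add: bessel_K_def)
  then have "ennreal (bessel_K \<nu> \<zeta>) = ennreal (1 / 2 * (\<zeta> / 2) powr \<nu>) * ennreal (LINT t|lborel. bessel_profile \<nu> \<zeta> t)"
    by (simp only:) (rule ennreal_mult', simp)
  then show ?thesis
    using nn_integral_eq_integral[OF bessel_profile_finite[OF assms]] by (simp add: bessel_profile_nonneg)
qed

text \<open>The weight \<open>(C\<^sub>s / 2) m\<^sup>\<nu> r\<^sup>-\<^sup>\<nu> K\<^sub>\<nu>(m r)\<close> for \<open>\<nu> = 3/2 + s\<close>, after the powers of \<open>r\<close> have cancelled: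
the radius enters only through the Gaussian factor.\<close>

definition bessel_kernel :: "real \<Rightarrow> real \<Rightarrow> real \<Rightarrow> ennreal" where
  "bessel_kernel m s r = ennreal (C_const s / 4 * m powr (3 + 2 * s) * 2 powr (- (3 / 2 + s)))
     * (\<integral>\<^sup>+t. ennreal (bessel_profile (3 / 2 + s) (m * r) t) \<partial>lborel)"

lemma Gamma_one_minus_nonzero: "0 < s \<Longrightarrow> s < 1 \<Longrightarrow> Gamma (1 - s :: real) \<noteq> 0"
  using Gamma_real_pos[of "1 - s"] by linarith

lemma C_const_pos: "0 < s \<Longrightarrow> s < 1 \<Longrightarrow> C_const s > 0"
  by (simp add: C_const_def Gamma_real_pos)

lemma bessel_kernel_measurable[measurable]:
  assumes [measurable]: "f \<in> borel_measurable M"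
  shows "(\<lambda>x. bessel_kernel m s (f x)) \<in> borel_measurable M"
  unfolding bessel_kernel_def by measurable

lemma bessel_kernel_eq:
  assumes "0 < s" "s < 1" "m > 0" "r > 0" "q \<ge> 0"
  shows "ennreal (C_const s / 2 * m powr ((3 + 2 * s) / 2)) * ennreal (q / r powr ((3 + 2 * s) / 2) * bessel_K ((3 + 2 * s) / 2) (m * r))
    = ennreal q * bessel_kernel m s r"
proof -
  define \<nu> where "\<nu> = 3 / 2 + s"
  have \<nu>: "(3 + 2 * s) / 2 = \<nu>" "3 + 2 * s = \<nu> + \<nu>" "3 / 2 + s = \<nu>" by (auto simp: \<nu>_def)
  have C: "C_const s > 0" using assms by (intro C_const_pos)
  have "ennreal (C_const s / 2 * m powr \<nu>) * ennreal (q / r powr \<nu> * bessel_K \<nu> (m * r))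
     = ennreal (C_const s / 2 * m powr \<nu>) * (ennreal (q / r powr \<nu>) * (ennreal (1 / 2 * (m * r / 2) powr \<nu>) * (\<integral>\<^sup>+t. ennreal (bessel_profile \<nu> (m * r) t) \<partial>lborel)))"
  proof -
    have "ennreal (q / r powr \<nu> * bessel_K \<nu> (m * r)) = ennreal (q / r powr \<nu>) * ennreal (bessel_K \<nu> (m * r))"
      by (rule ennreal_mult') (use assms in simp)
    moreover have "\<nu> < 4" "m * r > 0" using assms by (auto simp: \<nu>_def)
    ultimately show ?thesis by (simp only: bessel_K_nn_integral)
  qed
  also have "\<dots> = ennreal (C_const s / 2 * m powr \<nu> * (q / r powr \<nu> * (1 / 2 * (m * r / 2) powr \<nu>))) * (\<integral>\<^sup>+t. ennreal (bessel_profile \<nu> (m * r) t) \<partial>lborel)"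
  proof -
    have "ennreal X * (ennreal Y * (ennreal Z * J)) = ennreal (X * (Y * Z)) * J" if "X \<ge> 0" "Y \<ge> 0" "Z \<ge> 0" for X Y Z J
      using that by (simp add: ennreal_mult mult.assoc)
    from this[of "C_const s / 2 * m powr \<nu>"] show ?thesis using assms C by simp
  qed
  also have "C_const s / 2 * m powr \<nu> * (q / r powr \<nu> * (1 / 2 * (m * r / 2) powr \<nu>)) = q * (C_const s / 4 * m powr (\<nu> + \<nu>) * 2 powr (- \<nu>))"
    unfolding powr_add[of m \<nu> \<nu>] using assms by (simp add: powr_divide powr_mult powr_minus field_simps)
  finally have "ennreal (C_const s / 2 * m powr \<nu>) * ennreal (q / r powr \<nu> * bessel_K \<nu> (m * r))
      = ennreal (q * (C_const s / 4 * m powr (\<nu> + \<nu>) * 2 powr (- \<nu>))) * (\<integral>\<^sup>+t. ennreal (bessel_profile \<nu> (m * r) t) \<partial>lborel)" .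
  also have "ennreal (q * (C_const s / 4 * m powr (\<nu> + \<nu>) * 2 powr (- \<nu>))) * (\<integral>\<^sup>+t. ennreal (bessel_profile \<nu> (m * r) t) \<partial>lborel)
      = ennreal q * (ennreal (C_const s / 4 * m powr (\<nu> + \<nu>) * 2 powr (- \<nu>)) * (\<integral>\<^sup>+t. ennreal (bessel_profile \<nu> (m * r) t) \<partial>lborel))"
    by (subst ennreal_mult'[OF assms(5)]) (rule mult.assoc)
  finally have "ennreal (C_const s / 2 * m powr \<nu>) * ennreal (q / r powr \<nu> * bessel_K \<nu> (m * r))
      = ennreal q * (ennreal (C_const s / 4 * m powr (\<nu> + \<nu>) * 2 powr (- \<nu>)) * (\<integral>\<^sup>+t. ennreal (bessel_profile \<nu> (m * r) t) \<partial>lborel))" .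
  moreover have "(\<nu> + \<nu>) / 2 = \<nu>" by simp
  ultimately show ?thesis by (simp only: bessel_kernel_def \<nu>)
qed

text \<open>This identity is the reason for the choice of \<open>C\<^sub>s\<close>: up to the factor on the right, which tends
to 1, the kernel has unit second moment in every direction.\<close>

lemma C_const_normalization:
  assumes "0 < s" "s < 1" "m > 0"
  shows "C_const s / 4 * m powr (3 + 2 * s) * 2 powr (- (3 / 2 + s)) * ((2 * pi) powr (3 / 2) * (2 / m\<^sup>2) powr (5 / 2)) * Gamma (1 - s)
    = s * m powr (2 * s - 2)"
proof -
  have G: "Gamma (1 - s) > 0" using assms by (simp add: Gamma_real_pos)
  have m2: "(2 / m\<^sup>2) powr (5 / 2) = 2 powr (5 / 2) * m powr (- 5)"
  proof -
    have "m\<^sup>2 = m powr 2" using assms by simp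
    then have "(m\<^sup>2) powr (5 / 2) = m powr 5" by (simp only: powr_powr) simp
    moreover have "(2 / m\<^sup>2) powr (5 / 2) = 2 powr (5 / 2) / (m\<^sup>2) powr (5 / 2)"
      by (rule powr_divide)
    ultimately show ?thesis by (simp add: powr_minus_divide)
  qed
  have "C_const s * Gamma (1 - s) = s * 2 powr ((2 * s - 1) / 2) * pi powr (- (3 / 2))"
    using G by (simp add: C_const_def powr_minus_divide)
  moreover have "C_const s / 4 = C_const s * 2 powr (- 2)" by (simp add: powr_minus)
  ultimately have "C_const s / 4 * m powr (3 + 2 * s) * 2 powr (- (3 / 2 + s)) * ((2 * pi) powr (3 / 2) * (2 / m\<^sup>2) powr (5 / 2)) * Gamma (1 - s)
     = (s * 2 powr ((2 * s - 1) / 2) * pi powr (- (3 / 2))) * (2 powr (- 2) * m powr (3 + 2 * s) * 2 powr (- (3 / 2 + s)) * (2 powr (3 / 2) * pi powr (3 / 2) * (2 powr (5 / 2) * m powr (- 5))))"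
  proof -
    assume CG: "C_const s * Gamma (1 - s) = s * 2 powr ((2 * s - 1) / 2) * pi powr (- (3 / 2))"
      and q: "C_const s / 4 = C_const s * 2 powr (- 2)"
    have "C_const s * 2 powr (- 2) * m powr (3 + 2 * s) * 2 powr (- (3 / 2 + s)) * (2 powr (3 / 2) * pi powr (3 / 2) * (2 powr (5 / 2) * m powr (- 5))) * Gamma (1 - s)
      = (C_const s * Gamma (1 - s)) * (2 powr (- 2) * m powr (3 + 2 * s) * 2 powr (- (3 / 2 + s)) * (2 powr (3 / 2) * pi powr (3 / 2) * (2 powr (5 / 2) * m powr (- 5))))"
      by (simp only: mult_ac)
    then show ?thesis unfolding q m2 powr_mult[of 2 pi] CG .
  qed
  also have "\<dots> = s * (2 powr ((2 * s - 1) / 2) * 2 powr (- 2) * 2 powr (- (3 / 2 + s)) * 2 powr (3 / 2) * 2 powr (5 / 2)) * (pi powr (- (3 / 2)) * pi powr (3 / 2)) * (m powr (3 + 2 * s) * m powr (- 5))"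
    by (simp only: mult_ac)
  also have "2 powr ((2 * s - 1) / 2) * 2 powr (- 2) * 2 powr (- (3 / 2 + s)) * 2 powr (3 / 2) * 2 powr (5 / 2) = (2::real) powr 0"
    unfolding powr_add[symmetric] by (simp add: field_simps)
  also have "pi powr (- (3 / 2)) * pi powr (3 / 2) = pi powr 0" unfolding powr_add[symmetric] by simp
  also have "m powr (3 + 2 * s) * m powr (- 5) = m powr (2 * s - 2)" unfolding powr_add[symmetric] by simp
  finally show ?thesis by simp
qed

text \<open>For fixed \<open>t\<close> the kernel is a Gaussian with \<open>\<sigma>\<^sup>2 = 2t / m\<^sup>2\<close>.  A function whose Gaussian moment is
\<open>c \<sigma>\<^sup>2\<^sup>p\<close> therefore contributes, together with the normalisation \<open>t\<^sup>3\<^sup>/\<^sup>2\<close> of the Gaussian, a multiple of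
\<open>t\<^sup>p\<^sup>-\<^sup>s\<^sup>-\<^sup>1\<close>, and the remaining integral over \<open>t\<close> is \<open>\<Gamma>(p - s)\<close>.\<close>

lemma bessel_kernel_moment:
  fixes h :: "real^3 \<Rightarrow> real"
  assumes s: "0 < s" "s < 1" and m: "m > 0" and p: "p \<ge> 1" and "c \<ge> 0"
    and [measurable]: "h \<in> borel_measurable borel" and h0: "\<And>v. h v \<ge> 0"
    and mom: "\<And>\<sigma>. \<sigma> > 0 \<Longrightarrow> (\<integral>\<^sup>+v. ennreal (gauss \<sigma> v * h v) \<partial>lborel) = ennreal (c * \<sigma> ^ (2 * p))"
  shows "(\<integral>\<^sup>+v. bessel_kernel m s (norm v) * ennreal (h v) \<partial>lborel)
    = ennreal (c * (s * m powr (2 * s - 2)) * (2 / m\<^sup>2) ^ (p - 1) * (Gamma (real p - s) / Gamma (1 - s)))"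
proof -
  define K where "K = C_const s / 4 * m powr (3 + 2 * s) * 2 powr (- (3 / 2 + s))"
  have K: "K \<ge> 0" using C_const_pos[OF s] by (simp add: K_def)
  define M where "M = (2 * pi) powr (3 / 2) * (2 / m\<^sup>2) powr (3 / 2) * (2 / m\<^sup>2) ^ p * c"
  have M: "M \<ge> 0" using \<open>c \<ge> 0\<close> by (simp add: M_def)
  have inner: "(\<integral>\<^sup>+v. ennreal (bessel_profile (3 / 2 + s) (m * norm v) t * h v) \<partial>lborel)
      = ennreal M * ennreal (indicator {0..} t * t powr (real p - s - 1) / exp t)" if t: "t \<noteq> 0" for t
  proof (cases "t > 0")
    case True
    define \<sigma> where "\<sigma> = sqrt (2 * t) / m"
    have \<sigma>: "\<sigma> > 0" and \<sigma>2: "\<sigma>\<^sup>2 = 2 / m\<^sup>2 * t" using True m by (auto simp: \<sigma>_def power_divide)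
    have split: "bessel_profile (3 / 2 + s) (m * norm v) t * h v
        = (exp (- t) * t powr (- 1 - (3 / 2 + s)) * (2 * pi * \<sigma>\<^sup>2) powr (3 / 2)) * (gauss \<sigma> v * h v)" for v
    proof -
      have "(m * norm v)\<^sup>2 / (4 * t) = (norm v)\<^sup>2 / (2 * \<sigma>\<^sup>2)"
        unfolding \<sigma>2 using True m by (simp add: field_simps power_mult_distrib)
      then have "exp (- ((m * norm v)\<^sup>2 / (4 * t)) - t) = exp (- t) * exp (- (norm v)\<^sup>2 / (2 * \<sigma>\<^sup>2))"
        by (simp flip: exp_add)
      then show ?thesis using True unfolding gauss_eq_exp[OF \<sigma>] by (simp add: bessel_profile_def mult_ac)
    qed
    have "(\<integral>\<^sup>+v. ennreal (bessel_profile (3 / 2 + s) (m * norm v) t * h v) \<partial>lborel)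
        = (\<integral>\<^sup>+v. ennreal (exp (- t) * t powr (- 1 - (3 / 2 + s)) * (2 * pi * \<sigma>\<^sup>2) powr (3 / 2)) * ennreal (gauss \<sigma> v * h v) \<partial>lborel)"
      unfolding split by (intro nn_integral_cong ennreal_mult') simp
    also have "\<dots> = ennreal (exp (- t) * t powr (- 1 - (3 / 2 + s)) * (2 * pi * \<sigma>\<^sup>2) powr (3 / 2)) * ennreal (c * \<sigma> ^ (2 * p))"
      unfolding mom[OF \<sigma>, symmetric] by (rule nn_integral_cmult) measurable
    also have "\<dots> = ennreal (exp (- t) * t powr (- 1 - (3 / 2 + s)) * (2 * pi * \<sigma>\<^sup>2) powr (3 / 2) * (c * \<sigma> ^ (2 * p)))"
      using \<open>c \<ge> 0\<close> by (simp add: ennreal_mult'')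
    also have "exp (- t) * t powr (- 1 - (3 / 2 + s)) * (2 * pi * \<sigma>\<^sup>2) powr (3 / 2) * (c * \<sigma> ^ (2 * p))
        = M * (t powr (- 1 - (3 / 2 + s)) * t powr (3 / 2) * t powr (real p) * exp (- t))"
    proof -
      have e1: "\<sigma> ^ (2 * p) = (2 / m\<^sup>2) ^ p * t ^ p"
        by (simp only: power_mult \<sigma>2 power_mult_distrib)
      have e2: "(2 * pi * \<sigma>\<^sup>2) powr (3 / 2) = (2 * pi) powr (3 / 2) * ((2 / m\<^sup>2) powr (3 / 2) * t powr (3 / 2))"
        unfolding \<sigma>2 powr_mult[of "2 * pi" "2 / m\<^sup>2 * t"] powr_mult[of "2 / m\<^sup>2" t] by (rule refl)
      show ?thesis unfolding e1 e2 M_def powr_realpow[OF True] by (simp only: mult_ac)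
    qed
    also have "t powr (- 1 - (3 / 2 + s)) * t powr (3 / 2) * t powr (real p) = t powr (real p - s - 1)"
      unfolding powr_add[symmetric] by (simp add: algebra_simps)
    also have "t powr (real p - s - 1) * exp (- t) = indicator {0..} t * t powr (real p - s - 1) / exp t"
      using True by (simp add: exp_minus field_simps)
    also have "ennreal (M * (indicator {0..} t * t powr (real p - s - 1) / exp t)) = ennreal M * ennreal (indicator {0..} t * t powr (real p - s - 1) / exp t)"
      by (rule ennreal_mult'[OF M])
    finally show ?thesis .
  qed (use t in \<open>auto simp: bessel_profile_def\<close>)
  have "(\<integral>\<^sup>+v. bessel_kernel m s (norm v) * ennreal (h v) \<partial>lborel)
      = (\<integral>\<^sup>+v. ennreal K * (\<integral>\<^sup>+t. ennreal (bessel_profile (3 / 2 + s) (m * norm v) t * h v) \<partial>lborel) \<partial>lborel)"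
    by (intro nn_integral_cong) (simp add: bessel_kernel_def K_def mult.assoc ennreal_mult'' h0 nn_integral_multc)
  also have "\<dots> = ennreal K * (\<integral>\<^sup>+v. \<integral>\<^sup>+t. ennreal (bessel_profile (3 / 2 + s) (m * norm v) t * h v) \<partial>lborel \<partial>lborel)"
    by (rule nn_integral_cmult) measurable
  also have "(\<integral>\<^sup>+v. \<integral>\<^sup>+t. ennreal (bessel_profile (3 / 2 + s) (m * norm v) t * h v) \<partial>lborel \<partial>lborel)
      = (\<integral>\<^sup>+t. \<integral>\<^sup>+v. ennreal (bessel_profile (3 / 2 + s) (m * norm v) t * h v) \<partial>lborel \<partial>lborel)"
    by (rule lborel_pair.Fubini') measurable
  also have "\<dots> = (\<integral>\<^sup>+t. ennreal M * ennreal (indicator {0..} t * t powr (real p - s - 1) / exp t) \<partial>lborel)"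
    by (intro nn_integral_cong_AE) (use AE_lborel_singleton[of "0::real"] inner in \<open>auto elim!: eventually_mono\<close>)
  also have "\<dots> = ennreal M * ennreal (Gamma (real p - s))"
    using s p by (subst nn_integral_cmult) (auto simp: Gamma_conv_nn_integral_real)
  also have "ennreal K * (ennreal M * ennreal (Gamma (real p - s))) = ennreal (K * (M * Gamma (real p - s)))"
    using K M by (simp add: ennreal_mult')
  also have "K * (M * Gamma (real p - s)) = c * (s * m powr (2 * s - 2)) * (2 / m\<^sup>2) ^ (p - 1) * (Gamma (real p - s) / Gamma (1 - s))"
  proof -
    have G: "Gamma (1 - s) \<noteq> 0" by (rule Gamma_one_minus_nonzero[OF s])
    have E: "(2 / m\<^sup>2) powr (3 / 2) * (2 / m\<^sup>2) ^ p = (2 / m\<^sup>2) powr (5 / 2) * (2 / m\<^sup>2) ^ (p - 1)"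
    proof -
      have pos: "2 / m\<^sup>2 > 0" using m by simp
      have "(2 / m\<^sup>2) powr (3 / 2) * (2 / m\<^sup>2) ^ p = (2 / m\<^sup>2) powr (3 / 2 + real p)"
        using pos by (simp add: powr_add powr_realpow)
      also have "3 / 2 + real p = 5 / 2 + real (p - 1)" using p by simp
      finally show ?thesis using pos by (simp only: powr_add powr_realpow)
    qed
    have "K * (M * Gamma (real p - s)) * Gamma (1 - s)
        = (2 / m\<^sup>2) powr (3 / 2) * (2 / m\<^sup>2) ^ p * (K * (2 * pi) powr (3 / 2) * Gamma (1 - s) * c * Gamma (real p - s))"
      unfolding M_def by (simp only: mult_ac)
    also have "\<dots> = (K * ((2 * pi) powr (3 / 2) * (2 / m\<^sup>2) powr (5 / 2)) * Gamma (1 - s)) * c * (2 / m\<^sup>2) ^ (p - 1) * Gamma (real p - s)"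
      unfolding E by (simp only: mult_ac)
    also have "K * ((2 * pi) powr (3 / 2) * (2 / m\<^sup>2) powr (5 / 2)) * Gamma (1 - s) = s * m powr (2 * s - 2)"
      unfolding K_def by (rule C_const_normalization[OF s m])
    finally have "K * (M * Gamma (real p - s)) = (s * m powr (2 * s - 2)) * c * (2 / m\<^sup>2) ^ (p - 1) * Gamma (real p - s) / Gamma (1 - s)"
      unfolding nonzero_eq_divide_eq[OF G] .
    moreover have "a * b * y * G / H = b * a * y * (G / H)" for a b y G H :: real by simp
    ultimately show ?thesis by (simp only:)
  qed
  finally show ?thesis .
qed

lemma bessel_kernel_dot_moment:
  fixes w :: "complex^3"
  assumes s: "0 < s" "s < 1" and m: "m > 0"
  shows "(\<integral>\<^sup>+v. bessel_kernel m s (norm v) * ennreal ((norm (dot v w))\<^sup>2) \<partial>lborel) = ennreal (s * m powr (2 * s - 2)) * ennreal ((norm w)\<^sup>2)"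
proof -
  have "(\<lambda>v. dot v w) \<in> borel_measurable borel"
    unfolding dot_def by (intro borel_measurable_continuous_onI continuous_intros)
  then have "(\<integral>\<^sup>+v. bessel_kernel m s (norm v) * ennreal ((norm (dot v w))\<^sup>2) \<partial>lborel)
      = ennreal ((norm w)\<^sup>2 * (s * m powr (2 * s - 2)) * (2 / m\<^sup>2) ^ (1 - 1) * (Gamma (real 1 - s) / Gamma (1 - s)))"
    by (intro bessel_kernel_moment s m) (auto simp: gauss_dot_square mult.commute)
  also have "Gamma (real 1 - s) / Gamma (1 - s) = 1" using Gamma_one_minus_nonzero[OF s] by simp
  finally show ?thesis using s by (simp add: ennreal_mult' mult.commute)
qed

lemma norm_power2_sum: "(norm (v::real^'n))\<^sup>2 = (\<Sum>j\<in>UNIV. (v $ j)\<^sup>2)"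
  by (simp add: norm_vec_def L2_set_def sum_nonneg)

lemma bessel_kernel_second_moment:
  assumes s: "0 < s" "s < 1" and m: "m > 0"
  shows "(\<integral>\<^sup>+v. bessel_kernel m s (norm (v::real^3)) * ennreal ((norm v)\<^sup>2) \<partial>lborel) = ennreal (3 * (s * m powr (2 * s - 2)))"
proof -
  have d: "(norm (dot v (axis j 1)))\<^sup>2 = (v $ j)\<^sup>2" for v :: "real^3" and j
  proof -
    have "dot v (axis j 1) = of_real (v $ j)"
      by (simp add: dot_def axis_def if_distrib sum.delta scaleR_conv_of_real cong: if_cong)
    then show ?thesis by simp
  qed
  have eq: "bessel_kernel m s (norm v) * ennreal ((norm v)\<^sup>2) = (\<Sum>j\<in>UNIV. bessel_kernel m s (norm v) * ennreal ((norm (dot v (axis j 1)))\<^sup>2))" for v :: "real^3"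
  proof -
    have "ennreal ((norm v)\<^sup>2) = (\<Sum>j\<in>UNIV. ennreal ((v $ j)\<^sup>2))"
      unfolding norm_power2_sum by (rule sum_ennreal[symmetric]) simp
    then show ?thesis unfolding d by (simp only: sum_distrib_left)
  qed
  have [measurable]: "(\<lambda>v. dot v w) \<in> borel_measurable borel" for w :: "complex^3"
    unfolding dot_def by (intro borel_measurable_continuous_onI continuous_intros)
  have "(\<integral>\<^sup>+v. bessel_kernel m s (norm (v::real^3)) * ennreal ((norm v)\<^sup>2) \<partial>lborel)
      = (\<Sum>j\<in>UNIV. \<integral>\<^sup>+v. bessel_kernel m s (norm (v::real^3)) * ennreal ((norm (dot v (axis j 1)))\<^sup>2) \<partial>lborel)"
    unfolding eq by (subst nn_integral_sum) auto
  also have "\<dots> = (\<Sum>j\<in>(UNIV::3 set). ennreal (s * m powr (2 * s - 2)))"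
  proof -
    have "(norm (axis j 1 :: complex^3))\<^sup>2 = 1" for j
    proof -
      have "(norm (axis j 1 :: complex^3))\<^sup>2 = (\<Sum>i\<in>UNIV. (norm ((axis j 1 :: complex^3) $ i))\<^sup>2)"
        by (simp add: norm_vec_def L2_set_def sum_nonneg)
      also have "\<dots> = (\<Sum>i\<in>UNIV. if i = j then 1 else 0)"
        by (intro sum.cong) (auto simp: axis_def)
      finally show ?thesis by simp
    qed
    then show ?thesis unfolding bessel_kernel_dot_moment[OF s m] by simp
  qed
  also have "\<dots> = ennreal (3 * (s * m powr (2 * s - 2)))"
    using s by (subst sum_ennreal) auto
  finally show ?thesis .
qed

text \<open>The factor \<open>1 - s\<close>, which expresses the concentration at the origin, comes from
\<open>\<Gamma>(2 - s) = (1 - s) \<Gamma>(1 - s)\<close>.\<close>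

lemma bessel_kernel_fourth_moment:
  assumes s: "0 < s" "s < 1" and m: "m > 0"
  shows "(\<integral>\<^sup>+v. bessel_kernel m s (norm (v::real^3)) * ennreal ((norm v) ^ 4) \<partial>lborel)
    \<le> ennreal (27 * (s * m powr (2 * s - 2)) * (2 / m\<^sup>2) * (1 - s))"
proof -
  have "Gamma (real 2 - s) = Gamma ((1 - s) + 1)" by simp
  also have "\<dots> = (1 - s) * Gamma (1 - s)" using s by (intro Gamma_plus1) auto
  finally have G: "Gamma (real 2 - s) / Gamma (1 - s) = 1 - s" using Gamma_one_minus_nonzero[OF s] by simp
  have mom0: "(\<integral>\<^sup>+v. bessel_kernel m s (norm v) * ennreal (((v::real^3) $ j) ^ 4) \<partial>lborel)
      = ennreal (3 * (s * m powr (2 * s - 2)) * (2 / m\<^sup>2) ^ (2 - 1) * (Gamma (real 2 - s) / Gamma (1 - s)))" for j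
    by (rule bessel_kernel_moment[OF s m]) (auto simp: gauss_coordinate_fourth)
  note mom = mom0[unfolded G]
  have le: "ennreal ((norm v) ^ 4) \<le> (\<Sum>j\<in>UNIV. 3 * ennreal ((v $ j) ^ 4))" for v :: "real^3"
  proof -
    have "(norm v) ^ 4 = (\<Sum>j\<in>UNIV. (v $ j)\<^sup>2)\<^sup>2" by (simp flip: norm_power2_sum power_mult)
    also have "\<dots> \<le> (\<Sum>j\<in>UNIV. 3 * (v $ j) ^ 4)"
    proof -
      have "(a + b + c)\<^sup>2 \<le> 3 * a\<^sup>2 + 3 * b\<^sup>2 + 3 * c\<^sup>2" for a b c :: real
        using zero_le_power2[of "a - b"] zero_le_power2[of "a - c"] zero_le_power2[of "b - c"]
        by (simp add: power2_eq_square algebra_simps)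
      from this[of "(v $ 1)\<^sup>2" "(v $ 2)\<^sup>2" "(v $ 3)\<^sup>2"] show ?thesis
        by (simp add: sum_3 flip: power_mult)
    qed
    finally have "ennreal ((norm v) ^ 4) \<le> ennreal (\<Sum>j\<in>UNIV. 3 * (v $ j) ^ 4)" by (rule ennreal_leI)
    also have "\<dots> = (\<Sum>j\<in>UNIV. 3 * ennreal ((v $ j) ^ 4))"
    proof -
      have "ennreal (\<Sum>j\<in>UNIV. 3 * (v $ j) ^ 4) = (\<Sum>j\<in>UNIV. ennreal (3 * (v $ j) ^ 4))"
        by (rule sum_ennreal[symmetric]) simp
      then show ?thesis by (simp add: ennreal_mult')
    qed
    finally show ?thesis .
  qed
  have "(\<integral>\<^sup>+v. bessel_kernel m s (norm (v::real^3)) * ennreal ((norm v) ^ 4) \<partial>lborel)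
      \<le> (\<integral>\<^sup>+v. (\<Sum>j\<in>UNIV. 3 * (bessel_kernel m s (norm (v::real^3)) * ennreal ((v $ j) ^ 4))) \<partial>lborel)"
  proof (rule nn_integral_mono)
    fix v :: "real^3"
    have "bessel_kernel m s (norm v) * ennreal ((norm v) ^ 4) \<le> bessel_kernel m s (norm v) * (\<Sum>j\<in>UNIV. 3 * ennreal ((v $ j) ^ 4))"
      by (rule mult_left_mono[OF le]) simp
    then show "bessel_kernel m s (norm v) * ennreal ((norm v) ^ 4) \<le> (\<Sum>j\<in>UNIV. 3 * (bessel_kernel m s (norm v) * ennreal ((v $ j) ^ 4)))"
      by (simp add: sum_distrib_left mult_ac)
  qed
  also have "\<dots> = (\<Sum>j\<in>UNIV. 3 * (\<integral>\<^sup>+v. bessel_kernel m s (norm (v::real^3)) * ennreal ((v $ j) ^ 4) \<partial>lborel))"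
    by (subst nn_integral_sum) (auto simp: nn_integral_cmult)
  also have "\<dots> = (\<Sum>j\<in>(UNIV::3 set). ennreal (9 * (s * m powr (2 * s - 2)) * (2 / m\<^sup>2) * (1 - s)))"
  proof -
    have "3 * ennreal X = ennreal (3 * X)" for X by (simp add: ennreal_mult')
    then show ?thesis unfolding mom by (simp only:) (simp add: mult_ac)
  qed
  also have "\<dots> = ennreal (27 * (s * m powr (2 * s - 2)) * (2 / m\<^sup>2) * (1 - s))"
    using s by (subst sum_ennreal) auto
  finally show ?thesis .
qed

section \<open>First-order expansion of the twisted difference\<close>

lemma norm_add3_square_le:
  fixes a b c :: "'b::real_normed_vector"
  shows "(norm (a + b + c))\<^sup>2 \<le> 3 * ((norm a)\<^sup>2 + (norm b)\<^sup>2 + (norm c)\<^sup>2)"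
proof -
  have "(norm (a + b + c))\<^sup>2 \<le> (norm a + norm b + norm c)\<^sup>2"
    by (intro power_mono norm_triangle_le add_mono norm_triangle_ineq) auto
  also have "\<dots> \<le> 3 * ((norm a)\<^sup>2 + (norm b)\<^sup>2 + (norm c)\<^sup>2)"
    using zero_le_power2[of "norm a - norm b"] zero_le_power2[of "norm a - norm c"] zero_le_power2[of "norm b - norm c"]
    by (simp add: power2_eq_square algebra_simps)
  finally show ?thesis .
qed

lemma norm_add4_square_le:
  fixes a b c d :: "'b::real_normed_vector"
  shows "(norm (a + b + c + d))\<^sup>2 \<le> 4 * ((norm a)\<^sup>2 + (norm b)\<^sup>2 + (norm c)\<^sup>2 + (norm d)\<^sup>2)"
  using norm_add_square_le[of "a + b" "c + d"] norm_add_square_le[of a b] norm_add_square_le[of c d]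
  by (simp add: add.assoc)

lemma l2_shift_small:
  fixes f :: "'a::euclidean_space \<Rightarrow> 'b::euclidean_space"
  assumes "f \<in> borel_measurable borel" "l2sq f < \<infinity>" "\<eta> > 0"
  shows "\<exists>\<delta>>0. \<forall>w. norm w < \<delta> \<longrightarrow> l2sq (\<lambda>x. f (x + w) - f x) \<le> ennreal \<eta>"
proof -
  have "((\<lambda>w. l2sq (\<lambda>x. f (x + w) - f x)) \<longlongrightarrow> 0) (at 0)"
    using l2_imp_shift_continuous[OF assms(1,2)] by (simp add: l2_shift_continuous_def)
  then have "\<forall>\<^sub>F w in at 0. l2sq (\<lambda>x. f (x + w) - f x) < ennreal \<eta>"
    using assms(3) by (intro order_tendstoD(2)) auto
  then obtain \<delta> where \<delta>: "\<delta> > 0" "\<And>w. w \<noteq> 0 \<Longrightarrow> norm w < \<delta> \<Longrightarrow> l2sq (\<lambda>x. f (x + w) - f x) < ennreal \<eta>"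
    by (auto simp: eventually_at)
  have "l2sq (\<lambda>x. f (x + w) - f x) \<le> ennreal \<eta>" if "norm w < \<delta>" for w
    using \<delta>(2)[OF _ that] by (cases "w = 0") (auto simp: l2sq_def less_imp_le)
  then show ?thesis using \<delta>(1) by blast
qed

lemma borel_measurable_vec_lambda:
  fixes f :: "'i::finite \<Rightarrow> 'x \<Rightarrow> complex"
  assumes "\<And>j. f j \<in> borel_measurable M"
  shows "(\<lambda>x. \<chi> j. f j x) \<in> borel_measurable M"
proof -
  have "(\<lambda>x. \<Sum>j\<in>UNIV. f j x *s axis j 1) \<in> borel_measurable M"
  proof (rule borel_measurable_sum)
    fix j
    have "(\<lambda>z::complex. z *s (axis j 1 :: complex^'i)) \<in> borel_measurable borel"
      by (intro borel_measurable_continuous_onI) (auto simp: vector_scalar_mult_def intro!: continuous_intros)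
    from measurable_compose[OF assms[of j] this]
    show "(\<lambda>x. f j x *s axis j 1) \<in> borel_measurable M" .
  qed
  moreover have "(\<Sum>j\<in>UNIV. f j x *s axis j 1) = (\<chi> j. f j x)" for x
    by (simp add: vec_eq_iff axis_def if_distrib sum.delta cong: if_cong)
  ultimately show ?thesis by simp
qed

lemma continuous_bounded_on_cball:
  fixes A :: "'a::euclidean_space \<Rightarrow> 'b::real_normed_vector"
  assumes "continuous_on UNIV A"
  shows "\<exists>M>0. \<forall>x\<in>cball 0 \<rho>. norm (A x) \<le> M"
proof -
  have "bounded (A ` cball 0 \<rho>)"
    by (intro compact_imp_bounded compact_continuous_image compact_cball continuous_on_subset[OF assms]) simp
  then show ?thesis by (auto simp: bounded_pos)
qed

lemma potential_term_measurable:
  fixes A :: "real^'n \<Rightarrow> real^'n" and u :: "real^'n \<Rightarrow> complex"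
  assumes "continuous_on UNIV A" and [measurable]: "u \<in> borel_measurable borel"
  shows "(\<lambda>x. \<chi> j. \<i> * complex_of_real (A x $ j) * u x) \<in> borel_measurable borel"
proof -
  have [measurable]: "A \<in> borel_measurable borel" by (intro borel_measurable_continuous_onI assms(1))
  show ?thesis by (intro borel_measurable_vec_lambda) measurable
qed

lemma potential_term_l2:
  fixes A :: "real^'n \<Rightarrow> real^'n" and u :: "real^'n \<Rightarrow> complex"
  assumes A: "continuous_on UNIV A" and "bounded S" and [measurable]: "u \<in> borel_measurable borel"
    and u0: "\<And>x. x \<notin> S \<Longrightarrow> u x = 0" and l2: "l2sq u < \<infinity>"
  shows "l2sq (\<lambda>x. \<chi> j. \<i> * complex_of_real (A x $ j) * u x) < \<infinity>"
proof -
  obtain \<rho> where "\<forall>x\<in>S. norm x \<le> \<rho>" using \<open>bounded S\<close> unfolding bounded_iff by blast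
  then have \<rho>: "S \<subseteq> cball 0 \<rho>" by auto
  obtain M where M: "M > 0" "\<And>x. x \<in> S \<Longrightarrow> norm (A x) \<le> M"
    using continuous_bounded_on_cball[OF A, of \<rho>] \<rho> by blast
  define B where "B x = (\<chi> j. \<i> * complex_of_real (A x $ j) * u x)" for x
  have nB: "norm (B x) = norm (A x) * cmod (u x)" for x
    by (simp add: B_def norm_vec_def norm_mult flip: L2_set_left_distrib)
  have "l2sq B \<le> (\<integral>\<^sup>+x. ennreal (M\<^sup>2) * ennreal ((norm (u x))\<^sup>2) \<partial>lborel)"
    unfolding l2sq_def
  proof (rule nn_integral_mono)
    fix x
    have "(norm (B x))\<^sup>2 \<le> M\<^sup>2 * (norm (u x))\<^sup>2"
      using M u0[of x] unfolding nB power_mult_distrib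
      by (cases "x \<in> S") (auto intro!: mult_right_mono power_mono)
    then show "ennreal ((norm (B x))\<^sup>2) \<le> ennreal (M\<^sup>2) * ennreal ((norm (u x))\<^sup>2)"
      by (simp flip: ennreal_mult')
  qed
  also have "\<dots> = ennreal (M\<^sup>2) * l2sq u" unfolding l2sq_def by (rule nn_integral_cmult) measurable
  also have "\<dots> < \<infinity>" using l2 by (simp add: ennreal_mult_less_top)
  finally show ?thesis by (simp add: B_def[abs_def])
qed

text \<open>The finite set \<open>E\<close> of offsets and the distance \<open>r\<close>, which a Lipschitz boundary provides by
\<open>lipschitz_boundary_detours\<close>, carry all the information about the boundary.\<close>

locale magnetic_sobolev = sobolev_function \<Omega> u g
  for \<Omega> :: "(real^'n) set" and u :: "real^'n \<Rightarrow> complex" and g :: "real^'n \<Rightarrow> complex^'n" +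
  fixes A :: "real^'n \<Rightarrow> real^'n" and E :: "(real^'n) set" and r :: real
  assumes A_cont: "continuous_on UNIV A" and finE: "finite E" and r_pos: "r > 0"
    and detours: "\<And>x v. x \<in> \<Omega> \<Longrightarrow> x + v \<in> \<Omega> \<Longrightarrow> norm v < r \<Longrightarrow> \<exists>a\<in>E. detour_inside \<Omega> a x v"
begin

lemma A_measurable[measurable]: "A \<in> borel_measurable borel"
  by (intro borel_measurable_continuous_onI A_cont)

lemma domain_measurable[measurable]: "\<Omega> \<in> sets borel"
  using open_dom by simp

definition path_average :: "real^'n \<Rightarrow> real^'n \<Rightarrow> real^'n \<Rightarrow> ennreal" where
  "path_average b v x = (\<integral>\<^sup>+\<tau>\<in>{0..1}. ennreal ((norm (g (x + b + \<tau> *\<^sub>R v) - g x))\<^sup>2) \<partial>lborel)"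

lemma path_average_measurable[measurable]: "path_average b v \<in> borel_measurable borel"
  unfolding path_average_def by measurable

lemma path_average_integral_le:
  assumes "\<And>\<tau>. \<tau> \<in> {0..1} \<Longrightarrow> l2sq (\<lambda>x. g (x + (b + \<tau> *\<^sub>R v)) - g x) \<le> \<eta>"
  shows "(\<integral>\<^sup>+x. path_average b v x \<partial>lborel) \<le> \<eta>"
proof -
  have "(\<integral>\<^sup>+x. path_average b v x \<partial>lborel)
      = (\<integral>\<^sup>+\<tau>. \<integral>\<^sup>+x. ennreal ((norm (g (x + b + \<tau> *\<^sub>R v) - g x))\<^sup>2) * indicator {0..1} \<tau> \<partial>lborel \<partial>lborel)"
    unfolding path_average_def by (rule lborel_pair.Fubini') measurable
  also have "\<dots> \<le> (\<integral>\<^sup>+\<tau>. \<eta> * indicator {0..1::real} \<tau> \<partial>lborel)"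
  proof (rule nn_integral_mono)
    fix \<tau> :: real
    show "(\<integral>\<^sup>+x. ennreal ((norm (g (x + b + \<tau> *\<^sub>R v) - g x))\<^sup>2) * indicator {0..1} \<tau> \<partial>lborel) \<le> \<eta> * indicator {0..1} \<tau>"
      using assms[of \<tau>] by (cases "\<tau> \<in> {0..1}") (auto simp: l2sq_def add.assoc)
  qed
  also have "\<dots> = \<eta>" by (simp add: nn_integral_cmult_indicator)
  finally show ?thesis .
qed

definition detour_cost :: "real^'n \<Rightarrow> real^'n \<Rightarrow> real^'n \<Rightarrow> ennreal" where
  "detour_cost v a x = 3 * (ennreal ((norm (norm v *\<^sub>R a))\<^sup>2) * path_average 0 (norm v *\<^sub>R a) x
     + ennreal ((norm v)\<^sup>2) * path_average (norm v *\<^sub>R a) v x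
     + ennreal ((norm (norm v *\<^sub>R a))\<^sup>2) * path_average v (norm v *\<^sub>R a) x)"

lemma detour_cost_measurable[measurable]: "detour_cost v a \<in> borel_measurable borel"
  unfolding detour_cost_def by measurable

text \<open>All three legs are compared with the gradient at \<open>x\<close>, not at their own starting points.  The
contributions of the first and the last leg, which are traversed in opposite directions, then
cancel, and only \<open>v \<bullet> g(x)\<close> is left of the main terms.\<close>

lemma detour_difference_bound:
  "AE x in lborel. detour_inside \<Omega> a x v \<longrightarrow> ennreal ((norm (u (x + v) - u x - dot v (g x)))\<^sup>2) \<le> detour_cost v a x"
proof -
  define p where "p = norm v *\<^sub>R a"
  have 1: "AE x in lborel. x \<in> segment_inside p \<longrightarrow> (\<forall>y. ennreal ((norm (u (x + p) - u x - dot p y))\<^sup>2)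
     \<le> ennreal ((norm p)\<^sup>2) * (\<integral>\<^sup>+\<tau>\<in>{0..1}. ennreal ((norm (g (x + \<tau> *\<^sub>R p) - y))\<^sup>2) \<partial>lborel))"
    by (rule segment_difference_bound)
  note 2 = AE_translate[OF segment_difference_bound[of v], of p]
  note 3 = AE_translate[OF 1, of v]
  from 1 2 3 show ?thesis
  proof eventually_elim
    case (elim x)
    show ?case
    proof
      assume "detour_inside \<Omega> a x v"
      then have S: "x \<in> segment_inside p" "x + p \<in> segment_inside v" "x + v \<in> segment_inside p"
        by (auto simp: detour_inside_def segment_inside_iff p_def)
      define D1 where "D1 = u (x + p) - u x - dot p (g x)"
      define D2 where "D2 = u (x + p + v) - u (x + p) - dot v (g x)"
      define D3 where "D3 = u (x + v + p) - u (x + v) - dot p (g x)"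
      have b: "ennreal ((norm D1)\<^sup>2) \<le> ennreal ((norm p)\<^sup>2) * path_average 0 p x"
        "ennreal ((norm D2)\<^sup>2) \<le> ennreal ((norm v)\<^sup>2) * path_average p v x"
        "ennreal ((norm D3)\<^sup>2) \<le> ennreal ((norm p)\<^sup>2) * path_average v p x"
        using elim S unfolding D1_def D2_def D3_def path_average_def by auto
      have "u (x + v) - u x - dot v (g x) = D1 + D2 + (- D3)"
        by (simp add: D1_def D2_def D3_def add_ac)
      then have "ennreal ((norm (u (x + v) - u x - dot v (g x)))\<^sup>2) \<le> ennreal (3 * ((norm D1)\<^sup>2 + (norm D2)\<^sup>2 + (norm D3)\<^sup>2))"
        using norm_add3_square_le[of D1 D2 "- D3"] by (intro ennreal_leI) simp
      also have "\<dots> = 3 * (ennreal ((norm D1)\<^sup>2) + ennreal ((norm D2)\<^sup>2) + ennreal ((norm D3)\<^sup>2))"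
        by (simp add: ennreal_mult')
      also have "\<dots> \<le> detour_cost v a x"
        unfolding detour_cost_def p_def[symmetric] by (intro mult_left_mono add_mono b) simp
      finally show "ennreal ((norm (u (x + v) - u x - dot v (g x)))\<^sup>2) \<le> detour_cost v a x" .
    qed
  qed
qed

definition covariant_gradient :: "real^'n \<Rightarrow> complex^'n" where
  "covariant_gradient x = (\<chi> j. g x $ j - \<i> * complex_of_real (A x $ j) * u x)"

lemma covariant_gradient_measurable[measurable]: "covariant_gradient \<in> borel_measurable borel"
  unfolding covariant_gradient_def by (intro borel_measurable_vec_lambda) measurable

lemma covariant_gradient_outside: "x \<notin> \<Omega> \<Longrightarrow> covariant_gradient x = 0"
  by (simp add: covariant_gradient_def u_outside g_outside vec_eq_iff)

lemma dot_covariant_gradient: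
  "dot v (covariant_gradient x) = dot v (g x) - \<i> * complex_of_real (v \<bullet> A x) * u x"
proof -
  have "complex_of_real (v \<bullet> A x) = (\<Sum>j\<in>UNIV. complex_of_real (v $ j) * complex_of_real (A x $ j))"
    by (simp add: inner_vec_def)
  then show ?thesis
    unfolding dot_def covariant_gradient_def
    by (simp add: scaleR_conv_of_real algebra_simps sum_subtractf sum_distrib_left sum_distrib_right)
qed

lemma covariant_gradient_l2: "l2sq covariant_gradient < \<infinity>"
proof -
  define B where "B x = (\<chi> j. \<i> * complex_of_real (A x $ j) * u x)" for x
  have [measurable]: "B \<in> borel_measurable borel"
    unfolding B_def by (rule potential_term_measurable[OF A_cont u_meas])
  have "l2sq B < \<infinity>"
    unfolding B_def by (rule potential_term_l2[OF A_cont bounded_dom u_meas u_outside u_l2])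
  moreover have "l2sq covariant_gradient = l2sq (\<lambda>x. g x + (- B x))"
    by (rule arg_cong[where f = l2sq]) (auto simp: fun_eq_iff vec_eq_iff covariant_gradient_def B_def)
  moreover have "l2sq (\<lambda>x. g x + (- B x)) \<le> 2 * l2sq g + 2 * l2sq (\<lambda>x. - B x)"
    by (rule l2sq_add_le) measurable
  ultimately show ?thesis
    using g_l2 by (auto simp: l2sq_uminus ennreal_mult_less_top intro: le_less_trans)
qed

text \<open>Up to sign this is the difference in the integrand.  Setting it to zero unless both points are in
the domain accounts for the integration over \<open>\<Omega> \<times> \<Omega>\<close>.\<close>

definition twisted_difference :: "real^'n \<Rightarrow> real^'n \<Rightarrow> complex" where
  "twisted_difference v x = (if x \<in> \<Omega> \<and> x + v \<in> \<Omega>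
     then exp (\<i> * complex_of_real (- (v \<bullet> A (x + (1 / 2) *\<^sub>R v)))) * u (x + v) - u x else 0)"

lemma twisted_difference_measurable[measurable]:
  assumes [measurable]: "f \<in> borel_measurable M" "h \<in> borel_measurable M"
  shows "(\<lambda>x. twisted_difference (f x) (h x)) \<in> borel_measurable M"
  unfolding twisted_difference_def by measurable

definition remainder :: "real^'n \<Rightarrow> ennreal" where
  "remainder v = l2sq (\<lambda>x. twisted_difference v x - dot v (covariant_gradient x))"

text \<open>If both points are in the domain, the phase is expanded as \<open>1 + \<i> \<theta> + O(\<theta>\<^sup>2)\<close> with \<open>\<theta> = O(|v|)\<close>, and
the potential at the midpoint and the value of \<open>u\<close> at \<open>x + v\<close> are moved to \<open>x\<close>.  If \<open>x + v\<close> is outside,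
the covariant gradient vanishes at \<open>x + v\<close>, so the last term alone dominates.\<close>

lemma remainder_pointwise:
  assumes M: "\<And>z. z \<in> cball 0 \<rho> \<Longrightarrow> norm (A z) \<le> M" and \<rho>: "\<Omega> \<subseteq> cball 0 \<rho>"
    and \<omega>: "\<And>z z'. z \<in> cball 0 \<rho> \<Longrightarrow> z' \<in> cball 0 \<rho> \<Longrightarrow> norm (z - z') \<le> norm v \<Longrightarrow> (norm (A z - A z'))\<^sup>2 \<le> q"
    and q: "(norm v)\<^sup>2 * M ^ 4 \<le> q"
  shows "(norm (twisted_difference v x - dot v (covariant_gradient x)))\<^sup>2
    \<le> 4 * (indicator {x. x \<in> \<Omega> \<and> x + v \<in> \<Omega>} x * (norm (u (x + v) - u x - dot v (g x)))\<^sup>2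
          + (norm v)\<^sup>2 * q * (norm (u (x + v)))\<^sup>2
          + (norm v)\<^sup>2 * M\<^sup>2 * (norm (u (x + v) - u x))\<^sup>2
          + (norm v)\<^sup>2 * q * (norm (u x))\<^sup>2)
      + (norm v)\<^sup>2 * (norm (covariant_gradient (x + v) - covariant_gradient x))\<^sup>2"
proof -
  have q0: "q \<ge> 0" using q by (rule order_trans[rotated]) simp
  consider "x \<in> \<Omega> \<and> x + v \<in> \<Omega>" | "x + v \<notin> \<Omega>" | "x \<notin> \<Omega>" by blast
  then show ?thesis
  proof cases
    case 1
    define z where "z = x + (1 / 2) *\<^sub>R v"
    define \<theta> where "\<theta> = - (v \<bullet> A z)"
    have "z = (1 / 2) *\<^sub>R x + (1 / 2) *\<^sub>R (x + v)" by (simp add: z_def algebra_simps flip: scaleR_add_left)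
    moreover have "(1 / 2) *\<^sub>R x + (1 / 2) *\<^sub>R (x + v) \<in> cball 0 \<rho>"
      using 1 \<rho> by (intro convexD[OF convex_cball]) auto
    ultimately have z: "z \<in> cball 0 \<rho>" by simp
    have x: "x \<in> cball 0 \<rho>" using 1 \<rho> by auto
    have \<theta>: "\<bar>\<theta>\<bar> \<le> norm v * M"
      using Cauchy_Schwarz_ineq2[of v "A z"] mult_left_mono[OF M[OF z] norm_ge_zero[of v]] by (simp add: \<theta>_def)
    define T1 where "T1 = u (x + v) - u x - dot v (g x)"
    define T2 where "T2 = (exp (\<i> * of_real \<theta>) - 1 - \<i> * of_real \<theta>) * u (x + v)"
    define T3 where "T3 = \<i> * of_real \<theta> * (u (x + v) - u x)"
    define T4 where "T4 = \<i> * of_real (v \<bullet> (A x - A z)) * u x"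
    have "twisted_difference v x - dot v (covariant_gradient x) = T1 + T2 + T3 + T4"
      using 1 unfolding twisted_difference_def dot_covariant_gradient T1_def T2_def T3_def T4_def z_def[symmetric] \<theta>_def[symmetric]
      by (simp add: \<theta>_def inner_diff_right algebra_simps)
    then have main: "(norm (twisted_difference v x - dot v (covariant_gradient x)))\<^sup>2
        \<le> 4 * ((norm T1)\<^sup>2 + (norm T2)\<^sup>2 + (norm T3)\<^sup>2 + (norm T4)\<^sup>2)"
      using norm_add4_square_le[of T1 T2 T3 T4] by simp
    have b2: "(norm T2)\<^sup>2 \<le> (norm v)\<^sup>2 * q * (norm (u (x + v)))\<^sup>2"
    proof -
      have "cmod (exp (\<i> * of_real \<theta>) - 1 - \<i> * of_real \<theta>) \<le> \<theta>\<^sup>2 / 2"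
        using iexp_approx1[of \<theta> 1] by (simp add: diff_diff_eq numeral_2_eq_2)
      also have "\<dots> \<le> \<theta>\<^sup>2" by simp
      also have "\<dots> \<le> (norm v * M)\<^sup>2" using power_mono[OF \<theta>, of 2] by simp
      finally have "(cmod (exp (\<i> * of_real \<theta>) - 1 - \<i> * of_real \<theta>))\<^sup>2 \<le> ((norm v * M)\<^sup>2)\<^sup>2"
        by (rule power_mono) simp
      also have "\<dots> = (norm v)\<^sup>2 * ((norm v)\<^sup>2 * M ^ 4)" by (simp add: power_mult_distrib eval_nat_numeral mult_ac)
      also have "\<dots> \<le> (norm v)\<^sup>2 * q" by (rule mult_left_mono[OF q]) simp
      finally show ?thesis unfolding T2_def norm_mult power_mult_distrib by (rule mult_right_mono) simp
    qed
    have b3: "(norm T3)\<^sup>2 \<le> (norm v)\<^sup>2 * M\<^sup>2 * (norm (u (x + v) - u x))\<^sup>2"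
      using power_mono[OF \<theta>, of 2] unfolding T3_def norm_mult power_mult_distrib
      by (intro mult_right_mono) (auto simp: power_mult_distrib)
    have b4: "(norm T4)\<^sup>2 \<le> (norm v)\<^sup>2 * q * (norm (u x))\<^sup>2"
    proof -
      have "\<bar>v \<bullet> (A x - A z)\<bar> \<le> norm v * norm (A x - A z)" by (rule Cauchy_Schwarz_ineq2)
      then have "\<bar>v \<bullet> (A x - A z)\<bar>\<^sup>2 \<le> (norm v * norm (A x - A z))\<^sup>2" by (rule power_mono) simp
      also have "\<dots> = (norm v)\<^sup>2 * (norm (A x - A z))\<^sup>2" by (rule power_mult_distrib)
      also have "\<dots> \<le> (norm v)\<^sup>2 * q" by (intro mult_left_mono \<omega> x z) (auto simp: z_def)
      finally show ?thesis unfolding T4_def norm_mult power_mult_distrib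
        by (intro mult_right_mono) auto
    qed
    have "4 * ((norm T1)\<^sup>2 + (norm T2)\<^sup>2 + (norm T3)\<^sup>2 + (norm T4)\<^sup>2)
      \<le> 4 * ((norm T1)\<^sup>2 + (norm v)\<^sup>2 * q * (norm (u (x + v)))\<^sup>2 + (norm v)\<^sup>2 * M\<^sup>2 * (norm (u (x + v) - u x))\<^sup>2
        + (norm v)\<^sup>2 * q * (norm (u x))\<^sup>2)" by (intro mult_left_mono add_mono order_refl b2 b3 b4) simp
    with main have "(norm (twisted_difference v x - dot v (covariant_gradient x)))\<^sup>2
      \<le> 4 * ((norm T1)\<^sup>2 + (norm v)\<^sup>2 * q * (norm (u (x + v)))\<^sup>2 + (norm v)\<^sup>2 * M\<^sup>2 * (norm (u (x + v) - u x))\<^sup>2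
        + (norm v)\<^sup>2 * q * (norm (u x))\<^sup>2)" by (rule order_trans)
    then show ?thesis using 1 by (simp add: T1_def add_increasing2)
  next
    case 2
    then have "twisted_difference v x - dot v (covariant_gradient x) = dot v (covariant_gradient (x + v) - covariant_gradient x)"
      by (simp add: twisted_difference_def covariant_gradient_outside dot_diff dot_def sum_negf)
    then have "(norm (twisted_difference v x - dot v (covariant_gradient x)))\<^sup>2
      \<le> (norm v)\<^sup>2 * (norm (covariant_gradient (x + v) - covariant_gradient x))\<^sup>2"
      using power_mono[OF norm_dot_le[of v "covariant_gradient (x + v) - covariant_gradient x"], of 2] by (simp add: power_mult_distrib)
    then show ?thesis using q0 by (intro add_increasing) auto
  next
    case 3
    then have "twisted_difference v x - dot v (covariant_gradient x) = 0"
      by (simp add: twisted_difference_def covariant_gradient_outside dot_def)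
    then show ?thesis using q0 by simp
  qed
qed

text \<open>Since there are finitely many offsets, the costs of all detours are added up; this avoids a
measurable choice of the offset for each \<open>x\<close>.\<close>

lemma main_term_small:
  assumes \<eta>: "\<eta> > 0"
  shows "\<exists>\<delta>>0. \<forall>v. norm v < \<delta> \<longrightarrow>
    (\<integral>\<^sup>+x. indicator {x. x \<in> \<Omega> \<and> x + v \<in> \<Omega>} x * ennreal ((norm (u (x + v) - u x - dot v (g x)))\<^sup>2) \<partial>lborel)
    \<le> ennreal ((norm v)\<^sup>2 * (\<Sum>a\<in>E. 3 * (2 * (norm a)\<^sup>2 + 1)) * \<eta>)"
proof -
  obtain d where d: "d > 0" "\<And>w. norm w < d \<Longrightarrow> l2sq (\<lambda>x. g (x + w) - g x) \<le> ennreal \<eta>"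
    using l2_shift_small[OF g_meas g_l2 \<eta>] by blast
  define s where "s = (\<Sum>a\<in>E. norm a) + 1"
  have s: "s \<ge> 1" "norm a + 1 \<le> s" if "a \<in> E" for a
    unfolding s_def using finE that by (auto intro!: sum_nonneg member_le_sum)
  have s1: "s \<ge> 1" unfolding s_def by (auto intro!: sum_nonneg)
  define \<delta> where "\<delta> = min r (d / s)"
  have \<delta>: "\<delta> > 0" using r_pos d(1) s1 by (auto simp: \<delta>_def)
  have "(\<integral>\<^sup>+x. indicator {x. x \<in> \<Omega> \<and> x + v \<in> \<Omega>} x * ennreal ((norm (u (x + v) - u x - dot v (g x)))\<^sup>2) \<partial>lborel)
    \<le> ennreal ((norm v)\<^sup>2 * (\<Sum>a\<in>E. 3 * (2 * (norm a)\<^sup>2 + 1)) * \<eta>)" if v: "norm v < \<delta>" for v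
  proof -
    have vr: "norm v < r" and vs: "norm v * s < d"
      using v s1 by (auto simp: \<delta>_def field_simps)
    have "AE x in lborel. \<forall>a\<in>E. detour_inside \<Omega> a x v \<longrightarrow> ennreal ((norm (u (x + v) - u x - dot v (g x)))\<^sup>2) \<le> detour_cost v a x"
      by (rule AE_finite_allI[OF finE]) (rule detour_difference_bound)
    then have "(\<integral>\<^sup>+x. indicator {x. x \<in> \<Omega> \<and> x + v \<in> \<Omega>} x * ennreal ((norm (u (x + v) - u x - dot v (g x)))\<^sup>2) \<partial>lborel)
        \<le> (\<integral>\<^sup>+x. (\<Sum>a\<in>E. detour_cost v a x) \<partial>lborel)"
    proof (intro nn_integral_mono_AE, eventually_elim)
      case (elim x)
      show ?case
      proof (cases "x \<in> \<Omega> \<and> x + v \<in> \<Omega>")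
        case True
        then obtain a where a: "a \<in> E" "detour_inside \<Omega> a x v" using detours vr by blast
        then have "ennreal ((norm (u (x + v) - u x - dot v (g x)))\<^sup>2) \<le> detour_cost v a x" using elim by blast
        also have "\<dots> \<le> (\<Sum>a\<in>E. detour_cost v a x)" using a(1) finE by (intro member_le_sum) auto
        finally show ?thesis using True by simp
      qed simp
    qed
    also have "\<dots> = (\<Sum>a\<in>E. \<integral>\<^sup>+x. detour_cost v a x \<partial>lborel)"
      by (rule nn_integral_sum) measurable
    also have "\<dots> \<le> (\<Sum>a\<in>E. ennreal ((norm v)\<^sup>2 * (3 * (2 * (norm a)\<^sup>2 + 1)) * \<eta>))"
    proof (rule sum_mono)
      fix a assume a: "a \<in> E"
      define p where "p = norm v *\<^sub>R a"
      have small: "norm w < d" if "norm w \<le> norm v * (norm a + 1)" for w :: "real^'n"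
      proof -
        have "norm v * (norm a + 1) \<le> norm v * s" using s(2)[OF a] by (intro mult_left_mono) auto
        then show ?thesis using that vs by linarith
      qed
      have tau: "norm (\<tau> *\<^sub>R w) \<le> norm w" if "\<tau> \<in> {0..1}" for \<tau> and w :: "real^'n"
        using that by (auto intro: mult_left_le_one_le)
      have np: "norm p = norm v * norm a" by (simp add: p_def)
      have I: "(\<integral>\<^sup>+x. path_average 0 p x \<partial>lborel) \<le> ennreal \<eta>" "(\<integral>\<^sup>+x. path_average p v x \<partial>lborel) \<le> ennreal \<eta>"
        "(\<integral>\<^sup>+x. path_average v p x \<partial>lborel) \<le> ennreal \<eta>"
      proof -
        show "(\<integral>\<^sup>+x. path_average 0 p x \<partial>lborel) \<le> ennreal \<eta>"
        proof (intro path_average_integral_le d(2) small)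
          show "norm (0 + \<tau> *\<^sub>R p) \<le> norm v * (norm a + 1)" if "\<tau> \<in> {0..1}" for \<tau>
            using tau[OF that, of p] np by (simp add: algebra_simps add_increasing)
        qed
        show "(\<integral>\<^sup>+x. path_average p v x \<partial>lborel) \<le> ennreal \<eta>"
        proof (intro path_average_integral_le d(2) small)
          show "norm (p + \<tau> *\<^sub>R v) \<le> norm v * (norm a + 1)" if "\<tau> \<in> {0..1}" for \<tau>
            using tau[OF that, of v] np norm_triangle_ineq[of p "\<tau> *\<^sub>R v"] by (simp add: algebra_simps)
        qed
        show "(\<integral>\<^sup>+x. path_average v p x \<partial>lborel) \<le> ennreal \<eta>"
        proof (intro path_average_integral_le d(2) small)
          show "norm (v + \<tau> *\<^sub>R p) \<le> norm v * (norm a + 1)" if "\<tau> \<in> {0..1}" for \<tau>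
            using tau[OF that, of p] np norm_triangle_ineq[of v "\<tau> *\<^sub>R p"] by (simp add: algebra_simps)
        qed
      qed
      have "(\<integral>\<^sup>+x. detour_cost v a x \<partial>lborel) = 3 * (ennreal ((norm p)\<^sup>2) * (\<integral>\<^sup>+x. path_average 0 p x \<partial>lborel)
          + ennreal ((norm v)\<^sup>2) * (\<integral>\<^sup>+x. path_average p v x \<partial>lborel) + ennreal ((norm p)\<^sup>2) * (\<integral>\<^sup>+x. path_average v p x \<partial>lborel))"
        unfolding detour_cost_def p_def[symmetric] by (simp add: nn_integral_cmult nn_integral_add)
      also have "\<dots> \<le> 3 * (ennreal ((norm p)\<^sup>2) * ennreal \<eta> + ennreal ((norm v)\<^sup>2) * ennreal \<eta> + ennreal ((norm p)\<^sup>2) * ennreal \<eta>)"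
        by (intro mult_left_mono add_mono I) auto
      also have "\<dots> = ennreal (3 * ((norm p)\<^sup>2 * \<eta> + (norm v)\<^sup>2 * \<eta> + (norm p)\<^sup>2 * \<eta>))"
        using \<eta>[THEN less_imp_le] by (simp only: ennreal_mult ennreal_plus ennreal_numeral mult_nonneg_nonneg
            add_nonneg_nonneg zero_le_power2 zero_le_numeral)
      also have "3 * ((norm p)\<^sup>2 * \<eta> + (norm v)\<^sup>2 * \<eta> + (norm p)\<^sup>2 * \<eta>) = (norm v)\<^sup>2 * (3 * (2 * (norm a)\<^sup>2 + 1)) * \<eta>"
        by (simp add: np power_mult_distrib algebra_simps)
      finally show "(\<integral>\<^sup>+x. detour_cost v a x \<partial>lborel) \<le> ennreal ((norm v)\<^sup>2 * (3 * (2 * (norm a)\<^sup>2 + 1)) * \<eta>)" .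
    qed
    also have "\<dots> = ennreal ((norm v)\<^sup>2 * (\<Sum>a\<in>E. 3 * (2 * (norm a)\<^sup>2 + 1)) * \<eta>)"
      using \<eta> by (subst sum_ennreal) (auto simp: sum_distrib_left sum_distrib_right)
    finally show ?thesis .
  qed
  then show ?thesis using \<delta> by blast
qed

lemma A_uniformly_continuous:
  assumes "q > 0"
  shows "\<exists>\<delta>>0. \<forall>z\<in>cball 0 \<rho>. \<forall>z'\<in>cball 0 \<rho>. norm (z - z') < \<delta> \<longrightarrow> (norm (A z - A z'))\<^sup>2 \<le> q"
proof -
  have "uniformly_continuous_on (cball 0 \<rho>) A"
    by (intro compact_uniformly_continuous continuous_on_subset[OF A_cont] compact_cball) simp
  then obtain \<delta> where \<delta>: "\<delta> > 0" "\<And>z z'. z \<in> cball 0 \<rho> \<Longrightarrow> z' \<in> cball 0 \<rho> \<Longrightarrow> dist z' z < \<delta> \<Longrightarrow> dist (A z') (A z) < sqrt q"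
    unfolding uniformly_continuous_on_def using assms by (metis real_sqrt_gt_zero)
  have "(norm (A z - A z'))\<^sup>2 \<le> q" if "z \<in> cball 0 \<rho>" "z' \<in> cball 0 \<rho>" "norm (z - z') < \<delta>" for z z'
  proof -
    have "norm (A z - A z') \<le> sqrt q" using \<delta>(2)[of z' z] that by (simp add: dist_norm)
    then have "(norm (A z - A z'))\<^sup>2 \<le> (sqrt q)\<^sup>2" by (rule power_mono) simp
    then show ?thesis using assms by simp
  qed
  then show ?thesis using \<delta>(1) by blast
qed

text \<open>Every term of the pointwise bound is \<open>|v|\<^sup>2\<close> times either a translation error of \<open>u\<close>, \<open>g\<close> or the
covariant gradient, or a phase error that is small with \<open>|v|\<close>.\<close>

theorem remainder_small:
  assumes \<epsilon>: "\<epsilon> > 0"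
  shows "\<exists>\<delta>>0. \<forall>v. norm v < \<delta> \<longrightarrow> remainder v \<le> ennreal (\<epsilon> * (norm v)\<^sup>2)"
proof -
  obtain \<rho> where "\<forall>x\<in>\<Omega>. norm x \<le> \<rho>" using bounded_dom unfolding bounded_iff by blast
  then have \<rho>: "\<Omega> \<subseteq> cball 0 \<rho>" by auto
  obtain M where M: "M > 0" "\<And>x. x \<in> cball 0 \<rho> \<Longrightarrow> norm (A x) \<le> M" using continuous_bounded_on_cball[OF A_cont, of \<rho>] by blast
  define U where "U = enn2real (l2sq u)"
  have U: "l2sq u = ennreal U" "U \<ge> 0" using u_l2 by (auto simp: U_def)
  define K where "K = (\<Sum>a\<in>E. 3 * (2 * (norm a)\<^sup>2 + 1))"
  have K: "K \<ge> 0" by (auto simp: K_def intro!: sum_nonneg)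
  \<comment> \<open>half of \<open>\<epsilon>\<close> pays for the translation errors, each at most \<open>\<eta>\<close>; the other half pays for the two
    phase errors, each at most \<open>q |v|\<^sup>2\<close> times the norm of \<open>u\<close>\<close>
  define \<eta> where "\<eta> = \<epsilon> / (2 * (4 * K + 4 * M\<^sup>2 + 1))"
  define q where "q = \<epsilon> / (16 * (U + 1))"
  have den: "4 * K + 4 * M\<^sup>2 + 1 > 0" using K by (simp add: add_nonneg_pos)
  have \<eta>: "\<eta> > 0" and q: "q > 0" using \<epsilon> den U(2) by (auto simp: \<eta>_def q_def)
  have "D * (\<epsilon> / (2 * D)) = \<epsilon> / 2" if "D > 0" for D using that by simp
  from this[OF den] have \<eta>_eq: "(4 * K + 4 * M\<^sup>2 + 1) * \<eta> = \<epsilon> / 2" by (simp only: \<eta>_def)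
  have q_le: "8 * (q * U) \<le> \<epsilon> / 2" using \<epsilon> U(2) by (simp add: q_def field_simps)
  obtain d1 where d1: "d1 > 0" "\<And>v. norm v < d1 \<Longrightarrow>
    (\<integral>\<^sup>+x. indicator {x. x \<in> \<Omega> \<and> x + v \<in> \<Omega>} x * ennreal ((norm (u (x + v) - u x - dot v (g x)))\<^sup>2) \<partial>lborel)
    \<le> ennreal ((norm v)\<^sup>2 * K * \<eta>)" using main_term_small[OF \<eta>] unfolding K_def by blast
  obtain d2 where d2: "d2 > 0" "\<And>w. norm w < d2 \<Longrightarrow> l2sq (\<lambda>x. u (x + w) - u x) \<le> ennreal \<eta>"
    using l2_shift_small[OF u_meas u_l2 \<eta>] by blast
  obtain d3 where d3: "d3 > 0" "\<And>w. norm w < d3 \<Longrightarrow> l2sq (\<lambda>x. covariant_gradient (x + w) - covariant_gradient x) \<le> ennreal \<eta>"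
    using l2_shift_small[OF covariant_gradient_measurable covariant_gradient_l2 \<eta>] by blast
  obtain d4 where d4: "d4 > 0" "\<And>z z'. z \<in> cball 0 \<rho> \<Longrightarrow> z' \<in> cball 0 \<rho> \<Longrightarrow> norm (z - z') < d4 \<Longrightarrow> (norm (A z - A z'))\<^sup>2 \<le> q"
    using A_uniformly_continuous[OF q] by blast
  define d5 where "d5 = sqrt q / M\<^sup>2"
  have d5: "d5 > 0" using q M by (simp add: d5_def)
  define \<delta> where "\<delta> = Min {d1, d2, d3, d4, d5}"
  have \<delta>: "\<delta> > 0" using d1 d2 d3 d4 d5 by (simp add: \<delta>_def)
  have "remainder v \<le> ennreal (\<epsilon> * (norm v)\<^sup>2)" if v: "norm v < \<delta>" for v
  proof -
    have vd: "norm v < d1" "norm v < d2" "norm v < d3" "norm v < d4" "norm v < d5" using v by (auto simp: \<delta>_def)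
    have "norm v * M\<^sup>2 \<le> sqrt q" using vd(5) M(1) by (simp add: d5_def field_simps)
    then have "(norm v * M\<^sup>2)\<^sup>2 \<le> (sqrt q)\<^sup>2" by (rule power_mono) simp
    then have qv: "(norm v)\<^sup>2 * M ^ 4 \<le> q" using q by (simp add: power_mult_distrib flip: power_mult)
    define n where "n = (norm v)\<^sup>2"
    have n: "n \<ge> 0" by (simp add: n_def)
    define I1 where "I1 x = indicator {x. x \<in> \<Omega> \<and> x + v \<in> \<Omega>} x * ennreal ((norm (u (x + v) - u x - dot v (g x)))\<^sup>2)" for x
    define I2 where "I2 x = ennreal ((norm (u (x + v)))\<^sup>2)" for x
    define I3 where "I3 x = ennreal ((norm (u (x + v) - u x))\<^sup>2)" for x
    define I4 where "I4 x = ennreal ((norm (u x))\<^sup>2)" for x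
    define I5 where "I5 x = ennreal ((norm (covariant_gradient (x + v) - covariant_gradient x))\<^sup>2)" for x
    have [measurable]: "I1 \<in> borel_measurable borel" "I2 \<in> borel_measurable borel" "I3 \<in> borel_measurable borel"
      "I4 \<in> borel_measurable borel" "I5 \<in> borel_measurable borel"
      unfolding I1_def I2_def I3_def I4_def I5_def by measurable
    have "remainder v \<le> (\<integral>\<^sup>+x. 4 * (I1 x + ennreal (n * q) * I2 x + ennreal (n * M\<^sup>2) * I3 x + ennreal (n * q) * I4 x) + ennreal n * I5 x \<partial>lborel)"
      unfolding remainder_def l2sq_def
    proof (rule nn_integral_mono)
      fix x
      have "ennreal ((norm (twisted_difference v x - dot v (covariant_gradient x)))\<^sup>2)
        \<le> ennreal (4 * (indicator {x. x \<in> \<Omega> \<and> x + v \<in> \<Omega>} x * (norm (u (x + v) - u x - dot v (g x)))\<^sup>2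
          + n * q * (norm (u (x + v)))\<^sup>2 + n * M\<^sup>2 * (norm (u (x + v) - u x))\<^sup>2 + n * q * (norm (u x))\<^sup>2)
        + n * (norm (covariant_gradient (x + v) - covariant_gradient x))\<^sup>2)"
        unfolding n_def
        by (intro ennreal_leI remainder_pointwise[of \<rho>] M(2) \<rho> qv d4(2)) (use vd in auto)
      also have "\<dots> = 4 * (I1 x + ennreal (n * q) * I2 x + ennreal (n * M\<^sup>2) * I3 x + ennreal (n * q) * I4 x) + ennreal n * I5 x"
        unfolding I1_def I2_def I3_def I4_def I5_def using n q
        by (simp add: ennreal_mult' indicator_def)
      finally show "ennreal ((norm (twisted_difference v x - dot v (covariant_gradient x)))\<^sup>2)
        \<le> 4 * (I1 x + ennreal (n * q) * I2 x + ennreal (n * M\<^sup>2) * I3 x + ennreal (n * q) * I4 x) + ennreal n * I5 x" .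
    qed
    also have "\<dots> = 4 * ((\<integral>\<^sup>+x. I1 x \<partial>lborel) + ennreal (n * q) * (\<integral>\<^sup>+x. I2 x \<partial>lborel) + ennreal (n * M\<^sup>2) * (\<integral>\<^sup>+x. I3 x \<partial>lborel)
        + ennreal (n * q) * (\<integral>\<^sup>+x. I4 x \<partial>lborel)) + ennreal n * (\<integral>\<^sup>+x. I5 x \<partial>lborel)"
      by (simp add: nn_integral_add nn_integral_cmult)
    also have "\<dots> \<le> 4 * (ennreal (n * K * \<eta>) + ennreal (n * q) * ennreal U + ennreal (n * M\<^sup>2) * ennreal \<eta>
        + ennreal (n * q) * ennreal U) + ennreal n * ennreal \<eta>"
    proof (intro add_mono mult_left_mono)
      show "(\<integral>\<^sup>+x. I1 x \<partial>lborel) \<le> ennreal (n * K * \<eta>)" unfolding I1_def n_def by (rule d1(2)[OF vd(1)])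
      show "(\<integral>\<^sup>+x. I2 x \<partial>lborel) \<le> ennreal U"
        using l2sq_translate[OF u_meas, of v] U(1) by (simp add: I2_def l2sq_def)
      show "(\<integral>\<^sup>+x. I3 x \<partial>lborel) \<le> ennreal \<eta>" using d2(2)[OF vd(2)] by (simp add: I3_def l2sq_def)
      show "(\<integral>\<^sup>+x. I4 x \<partial>lborel) \<le> ennreal U" using U(1) by (simp add: I4_def l2sq_def)
      show "(\<integral>\<^sup>+x. I5 x \<partial>lborel) \<le> ennreal \<eta>" using d3(2)[OF vd(3)] by (simp add: I5_def l2sq_def)
    qed auto
    also have "\<dots> = ennreal (4 * (n * K * \<eta> + n * q * U + n * M\<^sup>2 * \<eta> + n * q * U) + n * \<eta>)"
      using n K \<eta>[THEN less_imp_le] q[THEN less_imp_le] U(2)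
      by (simp only: ennreal_mult ennreal_plus ennreal_numeral mult_nonneg_nonneg
            add_nonneg_nonneg zero_le_power2 zero_le_numeral)
    also have "4 * (n * K * \<eta> + n * q * U + n * M\<^sup>2 * \<eta> + n * q * U) + n * \<eta> = n * ((4 * K + 4 * M\<^sup>2 + 1) * \<eta> + 8 * (q * U))"
      by (simp add: algebra_simps)
    also have "ennreal (n * ((4 * K + 4 * M\<^sup>2 + 1) * \<eta> + 8 * (q * U))) \<le> ennreal (n * \<epsilon>)"
      unfolding \<eta>_eq using q_le n by (intro ennreal_leI mult_left_mono) auto
    finally show ?thesis by (simp add: n_def mult.commute)
  qed
  then show ?thesis using \<delta> by blast
qed

text \<open>For short \<open>v\<close> this is \<open>remainder_small\<close>; for \<open>|v| \<ge> \<delta>\<close> the factor \<open>|v|\<^sup>2 / \<delta>\<^sup>2 \<ge> 1\<close> absorbs the norm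
of \<open>u\<close>.\<close>

theorem remainder_bounded: "\<exists>C\<ge>0. \<forall>v. remainder v \<le> ennreal (C * (norm v)\<^sup>2)"
proof -
  obtain \<delta> where \<delta>: "\<delta> > 0" "\<And>v. norm v < \<delta> \<Longrightarrow> remainder v \<le> ennreal (1 * (norm v)\<^sup>2)"
    using remainder_small[of 1] by auto
  define U where "U = enn2real (l2sq u)"
  have U: "l2sq u = ennreal U" "U \<ge> 0" using u_l2 by (auto simp: U_def)
  define G where "G = enn2real (l2sq covariant_gradient)"
  have G: "l2sq covariant_gradient = ennreal G" "G \<ge> 0" using covariant_gradient_l2 by (auto simp: G_def)
  define C where "C = 1 + 8 * U / \<delta>\<^sup>2 + 2 * G"
  have "remainder v \<le> ennreal (C * (norm v)\<^sup>2)" for v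
  proof (cases "norm v < \<delta>")
    case True
    have "1 * (norm v)\<^sup>2 \<le> C * (norm v)\<^sup>2" using U G by (intro mult_right_mono) (auto simp: C_def)
    then show ?thesis using \<delta>(2)[OF True] ennreal_leI order_trans by blast
  next
    case False
    have "l2sq (twisted_difference v) \<le> l2sq u * 4"
    proof -
      have "l2sq (twisted_difference v) \<le> (\<integral>\<^sup>+x. 2 * ennreal ((norm (u (x + v)))\<^sup>2) + 2 * ennreal ((norm (u x))\<^sup>2) \<partial>lborel)"
        unfolding l2sq_def
      proof (rule nn_integral_mono)
        fix x
        have "(norm (twisted_difference v x))\<^sup>2 \<le> 2 * (norm (u (x + v)))\<^sup>2 + 2 * (norm (u x))\<^sup>2"
        proof (cases "x \<in> \<Omega> \<and> x + v \<in> \<Omega>")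
          case True
          define e where "e = exp (\<i> * complex_of_real (- (v \<bullet> A (x + (1 / 2) *\<^sub>R v))))"
          have "cmod e = 1" unfolding e_def by (rule norm_exp_i_times)
          moreover have "twisted_difference v x = e * u (x + v) + (- u x)"
            using True by (simp add: twisted_difference_def e_def)
          ultimately show ?thesis
            using norm_add_square_le[of "e * u (x + v)" "- u x"] by (simp add: norm_mult)
        qed (auto simp: twisted_difference_def)
        then have "ennreal ((norm (twisted_difference v x))\<^sup>2) \<le> ennreal (2 * (norm (u (x + v)))\<^sup>2 + 2 * (norm (u x))\<^sup>2)"
          by (rule ennreal_leI)
        then show "ennreal ((norm (twisted_difference v x))\<^sup>2) \<le> 2 * ennreal ((norm (u (x + v)))\<^sup>2) + 2 * ennreal ((norm (u x))\<^sup>2)"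
          by (simp add: ennreal_mult')
      qed
      also have "\<dots> = 2 * l2sq (\<lambda>x. u (x + v)) + 2 * l2sq u"
        unfolding l2sq_def by (simp add: nn_integral_add nn_integral_cmult)
      also have "\<dots> = (2 + 2) * l2sq u" unfolding l2sq_translate[OF u_meas] by (rule distrib_right[symmetric])
      also have "\<dots> = l2sq u * 4" by (simp add: mult.commute)
      finally show ?thesis .
    qed
    moreover have "l2sq (\<lambda>x. - dot v (covariant_gradient x)) \<le> ennreal ((norm v)\<^sup>2) * l2sq covariant_gradient"
    proof -
      have "l2sq (\<lambda>x. - dot v (covariant_gradient x)) \<le> (\<integral>\<^sup>+x. ennreal ((norm v)\<^sup>2) * ennreal ((norm (covariant_gradient x))\<^sup>2) \<partial>lborel)"
        unfolding l2sq_def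
      proof (rule nn_integral_mono)
        fix x
        show "ennreal ((norm (- dot v (covariant_gradient x)))\<^sup>2) \<le> ennreal ((norm v)\<^sup>2) * ennreal ((norm (covariant_gradient x))\<^sup>2)"
          using power_mono[OF norm_dot_le[of v "covariant_gradient x"], of 2]
          by (simp add: power_mult_distrib flip: ennreal_mult')
      qed
      also have "\<dots> = ennreal ((norm v)\<^sup>2) * l2sq covariant_gradient"
        unfolding l2sq_def by (rule nn_integral_cmult) measurable
      finally show ?thesis .
    qed
    moreover have "remainder v \<le> 2 * l2sq (twisted_difference v) + 2 * l2sq (\<lambda>x. - dot v (covariant_gradient x))"
      using l2sq_add_le[of "twisted_difference v" "\<lambda>x. - dot v (covariant_gradient x)"] by (simp add: remainder_def)
    ultimately have "remainder v \<le> 2 * (l2sq u * 4) + 2 * (ennreal ((norm v)\<^sup>2) * l2sq covariant_gradient)"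
      by (meson add_mono mult_left_mono order_trans zero_le)
    also have "\<dots> = ennreal (8 * U + 2 * ((norm v)\<^sup>2 * G))"
    proof -
      have "2 * (ennreal U * 4) = ennreal (8 * U)" using U(2) by (simp add: ennreal_mult' mult_ac)
      then show ?thesis using U G by (simp add: ennreal_mult')
    qed
    also have "\<dots> \<le> ennreal (C * (norm v)\<^sup>2)"
    proof (rule ennreal_leI)
      have "1 \<le> (norm v)\<^sup>2 / \<delta>\<^sup>2" using False \<delta>(1) by (simp add: power_mono)
      then have "8 * U * 1 \<le> 8 * U * ((norm v)\<^sup>2 / \<delta>\<^sup>2)" using U(2) by (intro mult_left_mono) auto
      then show "8 * U + 2 * ((norm v)\<^sup>2 * G) \<le> C * (norm v)\<^sup>2" by (simp add: C_def algebra_simps add_increasing)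
    qed
    finally show ?thesis .
  qed
  moreover have "C \<ge> 0" using U G by (simp add: C_def)
  ultimately show ?thesis by blast
qed

end

section \<open>The nonlocal energy and its limit\<close>

lemma ennreal_linear_combination:
  assumes "0 \<le> a" "0 \<le> x" "0 \<le> b" "0 \<le> y"
  shows "ennreal (a * x + b * y) = ennreal a * ennreal x + ennreal b * ennreal y"
  using assms by (simp add: ennreal_mult)

lemma ennreal_affine:
  assumes "0 \<le> a" "0 \<le> x" "0 \<le> b"
  shows "ennreal (a * x + b) = ennreal a * ennreal x + ennreal b"
  using assms by (simp add: ennreal_mult)

lemma l2sq_young:
  fixes f h :: "'a::euclidean_space \<Rightarrow> 'b::{real_normed_vector, second_countable_topology}"
  assumes [measurable]: "f \<in> borel_measurable borel" "h \<in> borel_measurable borel" and \<epsilon>: "\<epsilon> > 0"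
  shows "l2sq (\<lambda>x. f x + h x) \<le> ennreal (1 + \<epsilon>) * l2sq f + ennreal (1 + 1 / \<epsilon>) * l2sq h"
proof -
  have "l2sq (\<lambda>x. f x + h x)
      \<le> (\<integral>\<^sup>+x. ennreal (1 + \<epsilon>) * ennreal ((norm (f x))\<^sup>2) + ennreal (1 + 1 / \<epsilon>) * ennreal ((norm (h x))\<^sup>2) \<partial>lborel)"
    unfolding l2sq_def
  proof (rule nn_integral_mono)
    fix x
    define a b where "a = norm (f x)" and "b = norm (h x)"
    have "(norm (f x + h x))\<^sup>2 \<le> (a + b)\<^sup>2"
      unfolding a_def b_def by (intro power_mono norm_triangle_ineq) auto
    also have "\<dots> \<le> (1 + \<epsilon>) * a\<^sup>2 + (1 + 1 / \<epsilon>) * b\<^sup>2"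
    proof -
      have "0 \<le> (\<epsilon> * a - b)\<^sup>2 / \<epsilon>" using \<epsilon> by simp
      also have "(\<epsilon> * a - b)\<^sup>2 / \<epsilon> = \<epsilon> * a\<^sup>2 - 2 * a * b + b\<^sup>2 / \<epsilon>"
        using \<epsilon> by (simp add: power2_eq_square field_simps)
      finally show ?thesis by (simp add: power2_sum algebra_simps)
    qed
    finally have "ennreal ((norm (f x + h x))\<^sup>2) \<le> ennreal ((1 + \<epsilon>) * a\<^sup>2 + (1 + 1 / \<epsilon>) * b\<^sup>2)"
      by (rule ennreal_leI)
    also have "\<dots> = ennreal (1 + \<epsilon>) * ennreal (a\<^sup>2) + ennreal (1 + 1 / \<epsilon>) * ennreal (b\<^sup>2)"
      using \<epsilon> by (intro ennreal_linear_combination) auto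
    finally show "ennreal ((norm (f x + h x))\<^sup>2)
        \<le> ennreal (1 + \<epsilon>) * ennreal ((norm (f x))\<^sup>2) + ennreal (1 + 1 / \<epsilon>) * ennreal ((norm (h x))\<^sup>2)"
      by (simp only: a_def b_def)
  qed
  also have "\<dots> = ennreal (1 + \<epsilon>) * l2sq f + ennreal (1 + 1 / \<epsilon>) * l2sq h"
    unfolding l2sq_def by (subst nn_integral_add) (auto simp: nn_integral_cmult)
  finally show ?thesis .
qed

text \<open>Young's inequality compares two energies only up to a multiplicative and an additive loss; as the
loss may be chosen arbitrarily small, the comparison in both directions still forces convergence.\<close>

lemma tendsto_of_two_sided_young:
  fixes f \<kappa> :: "real \<Rightarrow> real"
  assumes \<kappa>: "(\<kappa> \<longlongrightarrow> 1) F" and l: "l \<ge> 0"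
    and bounds: "\<And>\<epsilon>. \<epsilon> > 0 \<Longrightarrow> \<forall>\<^sub>F s in F. f s \<le> (1 + \<epsilon>) * (\<kappa> s * l) + \<epsilon> \<and> \<kappa> s * l \<le> (1 + \<epsilon>) * f s + \<epsilon>"
  shows "(f \<longlongrightarrow> l) F"
proof (rule order_tendstoI)
  fix a assume a: "a < l"
  have "((\<lambda>\<epsilon>. ((1 - \<epsilon>) * l - \<epsilon>) / (1 + \<epsilon>)) \<longlongrightarrow> l) (at_right 0)" by (auto intro!: tendsto_eq_intros)
  then have "\<forall>\<^sub>F \<epsilon> in at_right 0. a < ((1 - \<epsilon>) * l - \<epsilon>) / (1 + \<epsilon>)" using a by (rule order_tendstoD)
  then have "\<forall>\<^sub>F \<epsilon> in at_right 0. a < ((1 - \<epsilon>) * l - \<epsilon>) / (1 + \<epsilon>) \<and> (0::real) < \<epsilon>"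
    using eventually_at_right_less[of "0::real"] by (rule eventually_conj)
  then obtain \<epsilon> where \<epsilon>: "\<epsilon> > 0" "a < ((1 - \<epsilon>) * l - \<epsilon>) / (1 + \<epsilon>)"
    using eventually_happens'[OF trivial_limit_at_right_real] by blast
  have "\<forall>\<^sub>F s in F. 1 - \<epsilon> < \<kappa> s" using \<epsilon>(1) by (intro order_tendstoD(1)[OF \<kappa>]) simp
  with bounds[OF \<epsilon>(1)] show "\<forall>\<^sub>F s in F. a < f s"
  proof eventually_elim
    case (elim s)
    have "(1 - \<epsilon>) * l \<le> \<kappa> s * l" using elim l by (intro mult_right_mono) auto
    with elim have "((1 - \<epsilon>) * l - \<epsilon>) / (1 + \<epsilon>) \<le> f s"
      using \<epsilon>(1) by (simp add: pos_divide_le_eq mult.commute)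
    with \<epsilon>(2) show ?case by simp
  qed
next
  fix b assume b: "l < b"
  have "((\<lambda>\<epsilon>. (1 + \<epsilon>) * ((1 + \<epsilon>) * l) + \<epsilon>) \<longlongrightarrow> l) (at_right 0)" by (auto intro!: tendsto_eq_intros)
  then have "\<forall>\<^sub>F \<epsilon> in at_right 0. (1 + \<epsilon>) * ((1 + \<epsilon>) * l) + \<epsilon> < b" using b by (rule order_tendstoD)
  then have "\<forall>\<^sub>F \<epsilon> in at_right 0. (1 + \<epsilon>) * ((1 + \<epsilon>) * l) + \<epsilon> < b \<and> (0::real) < \<epsilon>"
    using eventually_at_right_less[of "0::real"] by (rule eventually_conj)
  then obtain \<epsilon> where \<epsilon>: "\<epsilon> > 0" "(1 + \<epsilon>) * ((1 + \<epsilon>) * l) + \<epsilon> < b"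
    using eventually_happens'[OF trivial_limit_at_right_real] by blast
  have "\<forall>\<^sub>F s in F. \<kappa> s < 1 + \<epsilon>" using \<epsilon>(1) by (intro order_tendstoD(2)[OF \<kappa>]) simp
  with bounds[OF \<epsilon>(1)] show "\<forall>\<^sub>F s in F. f s < b"
  proof eventually_elim
    case (elim s)
    have "(1 + \<epsilon>) * (\<kappa> s * l) \<le> (1 + \<epsilon>) * ((1 + \<epsilon>) * l)"
      using elim l \<epsilon>(1) by (intro mult_left_mono mult_right_mono) auto
    with elim \<epsilon>(2) show ?case by linarith
  qed
qed

lemma kernel_mass_tendsto:
  assumes "m > 0"
  shows "((\<lambda>s. s * m powr (2 * s - 2)) \<longlongrightarrow> 1) (at_left (1::real))"
  using assms by (auto intro!: tendsto_eq_intros)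

text \<open>The dimension is fixed from here on because the normalisation of the kernel depends on it.\<close>

locale magnetic_sobolev_3 = magnetic_sobolev \<Omega> u g A E r
  for \<Omega> :: "(real^3) set" and u :: "real^3 \<Rightarrow> complex" and g :: "real^3 \<Rightarrow> complex^3"
    and A :: "real^3 \<Rightarrow> real^3" and E :: "(real^3) set" and r :: real +
  fixes m :: real
  assumes m_pos: "m > 0"
begin

definition nonlocal_energy :: "real \<Rightarrow> ennreal" where
  "nonlocal_energy s = (\<integral>\<^sup>+v. bessel_kernel m s (norm v) * l2sq (twisted_difference v) \<partial>lborel)"

lemma l2sq_measurable_parameter:
  fixes F :: "real^3 \<Rightarrow> real^3 \<Rightarrow> complex"
  assumes [measurable]: "(\<lambda>(v, x). F v x) \<in> borel_measurable (lborel \<Otimes>\<^sub>M lborel)"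
  shows "(\<lambda>v. l2sq (F v)) \<in> borel_measurable borel"
proof -
  have "(\<lambda>v. \<integral>\<^sup>+x. ennreal ((norm (F v x))\<^sup>2) \<partial>lborel) \<in> borel_measurable lborel"
    by measurable
  then show ?thesis unfolding l2sq_def by simp
qed

lemma energies_measurable[measurable]:
  "(\<lambda>v. l2sq (twisted_difference v)) \<in> borel_measurable borel"
  "(\<lambda>v. l2sq (\<lambda>x. dot v (covariant_gradient x))) \<in> borel_measurable borel"
  "remainder \<in> borel_measurable borel"
proof -
  show "(\<lambda>v. l2sq (twisted_difference v)) \<in> borel_measurable borel"
    by (rule l2sq_measurable_parameter[of twisted_difference]) measurable
  show "(\<lambda>v. l2sq (\<lambda>x. dot v (covariant_gradient x))) \<in> borel_measurable borel"
    by (rule l2sq_measurable_parameter[of "\<lambda>v x. dot v (covariant_gradient x)"]) measurable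
  show "remainder \<in> borel_measurable borel"
    unfolding remainder_def[abs_def]
    by (rule l2sq_measurable_parameter[of "\<lambda>v x. twisted_difference v x - dot v (covariant_gradient x)"]) measurable
qed

text \<open>By the isotropy of the kernel, averaging the directional derivatives gives the full gradient.\<close>

lemma local_energy_kernel:
  assumes s: "0 < s" "s < 1"
  shows "(\<integral>\<^sup>+v. bessel_kernel m s (norm v) * l2sq (\<lambda>x. dot v (covariant_gradient x)) \<partial>lborel)
    = ennreal (s * m powr (2 * s - 2)) * l2sq covariant_gradient"
proof -
  have "(\<integral>\<^sup>+v. bessel_kernel m s (norm v) * l2sq (\<lambda>x. dot v (covariant_gradient x)) \<partial>lborel)
      = (\<integral>\<^sup>+v. \<integral>\<^sup>+x. bessel_kernel m s (norm v) * ennreal ((norm (dot v (covariant_gradient x)))\<^sup>2) \<partial>lborel \<partial>lborel)"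
    unfolding l2sq_def by (intro nn_integral_cong nn_integral_cmult[symmetric]) measurable
  also have "\<dots> = (\<integral>\<^sup>+x. \<integral>\<^sup>+v. bessel_kernel m s (norm v) * ennreal ((norm (dot v (covariant_gradient x)))\<^sup>2) \<partial>lborel \<partial>lborel)"
    by (rule lborel_pair.Fubini') measurable
  also have "\<dots> = (\<integral>\<^sup>+x. ennreal (s * m powr (2 * s - 2)) * ennreal ((norm (covariant_gradient x))\<^sup>2) \<partial>lborel)"
    by (simp only: bessel_kernel_dot_moment[OF s m_pos])
  also have "\<dots> = ennreal (s * m powr (2 * s - 2)) * l2sq covariant_gradient"
    unfolding l2sq_def by (rule nn_integral_cmult) measurable
  finally show ?thesis .
qed

text \<open>The remainder is at most a small multiple of \<open>|v|\<^sup>2\<close> near the origin and, by Chebyshev's trick, at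
most a multiple of \<open>|v|\<^sup>4\<close> elsewhere.  The second moments of the kernel stay bounded and the fourth
ones tend to 0.\<close>

lemma remainder_energy_vanishes:
  assumes \<eta>: "\<eta> > 0"
  shows "\<forall>\<^sub>F s in at_left 1. (\<integral>\<^sup>+v. bessel_kernel m s (norm v) * remainder v \<partial>lborel) \<le> ennreal \<eta>"
proof -
  obtain \<delta> where \<delta>: "\<delta> > 0" "\<And>v. norm v < \<delta> \<Longrightarrow> remainder v \<le> ennreal (\<eta> / 6 * (norm v)\<^sup>2)"
    using remainder_small[of "\<eta> / 6"] \<eta> by auto
  obtain C where C: "C \<ge> 0" "\<And>v. remainder v \<le> ennreal (C * (norm v)\<^sup>2)" using remainder_bounded by blast
  define D where "D = C / \<delta>\<^sup>2"
  have D: "D \<ge> 0" using C \<delta> by (simp add: D_def)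
  have le: "remainder v \<le> ennreal (\<eta> / 6) * ennreal ((norm v)\<^sup>2) + ennreal D * ennreal ((norm v) ^ 4)" for v
  proof -
    have "remainder v \<le> ennreal (\<eta> / 6 * (norm v)\<^sup>2 + D * (norm v) ^ 4)"
    proof (cases "norm v < \<delta>")
      case True
      have "ennreal (\<eta> / 6 * (norm v)\<^sup>2) \<le> ennreal (\<eta> / 6 * (norm v)\<^sup>2 + D * (norm v) ^ 4)"
        using D by (intro ennreal_leI) auto
      with \<delta>(2)[OF True] show ?thesis by (rule order_trans)
    next
      case False
      have "C * (norm v)\<^sup>2 * 1 \<le> C * (norm v)\<^sup>2 * ((norm v)\<^sup>2 / \<delta>\<^sup>2)"
        using False \<delta>(1) C(1) by (intro mult_left_mono) (auto simp: power_mono)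
      also have "\<dots> = D * (norm v) ^ 4" by (simp add: D_def eval_nat_numeral)
      finally have "ennreal (C * (norm v)\<^sup>2) \<le> ennreal (\<eta> / 6 * (norm v)\<^sup>2 + D * (norm v) ^ 4)"
        using \<eta> by (intro ennreal_leI) (simp add: add_increasing)
      with C(2) show ?thesis by (rule order_trans)
    qed
    also have "\<dots> = ennreal (\<eta> / 6) * ennreal ((norm v)\<^sup>2) + ennreal D * ennreal ((norm v) ^ 4)"
      using \<eta> D by (intro ennreal_linear_combination) auto
    finally show ?thesis .
  qed
  define \<kappa> where "\<kappa> s = s * m powr (2 * s - 2)" for s
  define \<rho> where "\<rho> s = \<eta> / 6 * (3 * \<kappa> s) + D * (27 * \<kappa> s * (2 / m\<^sup>2) * (1 - s))" for s
  have "(\<rho> \<longlongrightarrow> \<eta> / 6 * (3 * 1) + D * (27 * 1 * (2 / m\<^sup>2) * (1 - 1))) (at_left 1)"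
    unfolding \<rho>_def[abs_def] \<kappa>_def using m_pos by (intro tendsto_intros kernel_mass_tendsto)
  from order_tendstoD(2)[OF this, of \<eta>] \<eta> have "\<forall>\<^sub>F s in at_left 1. \<rho> s < \<eta>" by simp
  moreover have "\<forall>\<^sub>F s in at_left 1. (0::real) < s \<and> s < 1"
    by (rule eventually_at_leftI[of 0]) auto
  ultimately show ?thesis
  proof eventually_elim
    case (elim s)
    then have s: "0 < s" "s < 1" by auto
    have \<kappa>: "\<kappa> s \<ge> 0" using s by (simp add: \<kappa>_def)
    have "(\<integral>\<^sup>+v. bessel_kernel m s (norm v) * remainder v \<partial>lborel)
        \<le> (\<integral>\<^sup>+v. ennreal (\<eta> / 6) * (bessel_kernel m s (norm (v::real^3)) * ennreal ((norm v)\<^sup>2))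
             + ennreal D * (bessel_kernel m s (norm v) * ennreal ((norm v) ^ 4)) \<partial>lborel)"
    proof (rule nn_integral_mono)
      fix v
      have "bessel_kernel m s (norm v) * remainder v
          \<le> bessel_kernel m s (norm v) * (ennreal (\<eta> / 6) * ennreal ((norm v)\<^sup>2) + ennreal D * ennreal ((norm v) ^ 4))"
        by (rule mult_left_mono[OF le]) simp
      then show "bessel_kernel m s (norm v) * remainder v \<le> ennreal (\<eta> / 6) * (bessel_kernel m s (norm v) * ennreal ((norm v)\<^sup>2))
             + ennreal D * (bessel_kernel m s (norm v) * ennreal ((norm v) ^ 4))"
        by (simp only: distrib_left mult_ac)
    qed
    also have "\<dots> = ennreal (\<eta> / 6) * (\<integral>\<^sup>+v. bessel_kernel m s (norm (v::real^3)) * ennreal ((norm v)\<^sup>2) \<partial>lborel)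
        + ennreal D * (\<integral>\<^sup>+v. bessel_kernel m s (norm (v::real^3)) * ennreal ((norm v) ^ 4) \<partial>lborel)"
      by (subst nn_integral_add) (auto simp: nn_integral_cmult)
    also have "\<dots> \<le> ennreal (\<eta> / 6) * ennreal (3 * \<kappa> s) + ennreal D * ennreal (27 * \<kappa> s * (2 / m\<^sup>2) * (1 - s))"
      unfolding \<kappa>_def
      by (intro add_mono mult_left_mono bessel_kernel_fourth_moment s m_pos) (simp_all add: bessel_kernel_second_moment[OF s m_pos])
    also have "\<dots> = ennreal (\<rho> s)"
    proof -
      have "0 \<le> 27 * \<kappa> s * (2 / m\<^sup>2) * (1 - s)" using \<kappa> s by simp
      then show ?thesis
        unfolding \<rho>_def using \<eta> D \<kappa> by (intro ennreal_linear_combination[symmetric]) auto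
    qed
    also have "\<dots> \<le> ennreal \<eta>" using elim by (intro ennreal_leI) simp
    finally show ?case .
  qed
qed

lemma energy_comparison:
  assumes s: "0 < s" "s < 1" and \<epsilon>: "\<epsilon> > 0"
    and small: "(\<integral>\<^sup>+v. bessel_kernel m s (norm v) * remainder v \<partial>lborel) \<le> ennreal (\<epsilon> / (1 + 1 / \<epsilon>))"
  defines "L \<equiv> ennreal (s * m powr (2 * s - 2)) * l2sq covariant_gradient"
  shows "nonlocal_energy s \<le> ennreal (1 + \<epsilon>) * L + ennreal \<epsilon>" "L \<le> ennreal (1 + \<epsilon>) * nonlocal_energy s + ennreal \<epsilon>"
proof -
  let ?k = "\<lambda>v. bessel_kernel m s (norm (v::real^3))"
  let ?N = "\<lambda>v. l2sq (\<lambda>x. dot v (covariant_gradient x))"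
  let ?P = "\<lambda>v. l2sq (twisted_difference v)"
  have pos: "1 + 1 / \<epsilon> > 0" using \<epsilon> by (simp add: add_pos_pos)
  have step: "(\<integral>\<^sup>+v. ?k v * X v \<partial>lborel) \<le> ennreal (1 + \<epsilon>) * (\<integral>\<^sup>+v. ?k v * Y v \<partial>lborel) + ennreal \<epsilon>"
    if [measurable]: "Y \<in> borel_measurable borel"
      and XY: "\<And>v. X v \<le> ennreal (1 + \<epsilon>) * Y v + ennreal (1 + 1 / \<epsilon>) * remainder v" for X Y
  proof -
    have "(\<integral>\<^sup>+v. ?k v * X v \<partial>lborel) \<le> (\<integral>\<^sup>+v. ennreal (1 + \<epsilon>) * (?k v * Y v) + ennreal (1 + 1 / \<epsilon>) * (?k v * remainder v) \<partial>lborel)"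
    proof (rule nn_integral_mono)
      fix v
      have "?k v * X v \<le> ?k v * (ennreal (1 + \<epsilon>) * Y v + ennreal (1 + 1 / \<epsilon>) * remainder v)"
        by (rule mult_left_mono[OF XY]) simp
      then show "?k v * X v \<le> ennreal (1 + \<epsilon>) * (?k v * Y v) + ennreal (1 + 1 / \<epsilon>) * (?k v * remainder v)"
        by (simp only: distrib_left mult_ac)
    qed
    also have "\<dots> = ennreal (1 + \<epsilon>) * (\<integral>\<^sup>+v. ?k v * Y v \<partial>lborel) + ennreal (1 + 1 / \<epsilon>) * (\<integral>\<^sup>+v. ?k v * remainder v \<partial>lborel)"
      by (subst nn_integral_add) (auto simp: nn_integral_cmult)
    also have "\<dots> \<le> ennreal (1 + \<epsilon>) * (\<integral>\<^sup>+v. ?k v * Y v \<partial>lborel) + ennreal (1 + 1 / \<epsilon>) * ennreal (\<epsilon> / (1 + 1 / \<epsilon>))"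
      by (intro add_left_mono mult_left_mono small) simp
    also have "ennreal (1 + 1 / \<epsilon>) * ennreal (\<epsilon> / (1 + 1 / \<epsilon>)) = ennreal ((1 + 1 / \<epsilon>) * (\<epsilon> / (1 + 1 / \<epsilon>)))"
      by (rule ennreal_mult'[symmetric]) (use pos in simp)
    also have "(1 + 1 / \<epsilon>) * (\<epsilon> / (1 + 1 / \<epsilon>)) = \<epsilon>"
    proof -
      have "a * (\<epsilon> / a) = \<epsilon>" if "a > 0" for a using that by simp
      from this[OF pos] show ?thesis .
    qed
    finally show ?thesis .
  qed
  have m1: "(\<lambda>x. dot v (covariant_gradient x)) \<in> borel_measurable borel" for v by measurable
  have m2: "(\<lambda>x. twisted_difference v x) \<in> borel_measurable borel" for v by measurable
  note m3 = borel_measurable_diff[OF m2 m1] and m4 = borel_measurable_diff[OF m1 m2]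
  have 1: "?P v \<le> ennreal (1 + \<epsilon>) * ?N v + ennreal (1 + 1 / \<epsilon>) * remainder v" for v
  proof -
    have "l2sq (\<lambda>x. dot v (covariant_gradient x) + (twisted_difference v x - dot v (covariant_gradient x)))
      \<le> ennreal (1 + \<epsilon>) * ?N v + ennreal (1 + 1 / \<epsilon>) * remainder v"
      unfolding remainder_def by (rule l2sq_young[OF m1 m3 \<epsilon>])
    then show ?thesis by simp
  qed
  show "nonlocal_energy s \<le> ennreal (1 + \<epsilon>) * L + ennreal \<epsilon>"
    using step[of ?N ?P, OF energies_measurable(2) 1]
    unfolding nonlocal_energy_def L_def local_energy_kernel[OF s] .
  have 2: "?N v \<le> ennreal (1 + \<epsilon>) * ?P v + ennreal (1 + 1 / \<epsilon>) * remainder v" for v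
  proof -
    have "l2sq (\<lambda>x. twisted_difference v x + (dot v (covariant_gradient x) - twisted_difference v x))
      \<le> ennreal (1 + \<epsilon>) * ?P v + ennreal (1 + 1 / \<epsilon>) * remainder v"
    proof -
      have "remainder v = l2sq (\<lambda>x. dot v (covariant_gradient x) - twisted_difference v x)"
        unfolding remainder_def by (rule l2sq_minus_commute)
      then show ?thesis by (simp only:) (rule l2sq_young[OF m2 m4 \<epsilon>])
    qed
    then show ?thesis by simp
  qed
  show "L \<le> ennreal (1 + \<epsilon>) * nonlocal_energy s + ennreal \<epsilon>"
    using step[of ?P ?N, OF energies_measurable(1) 2]
    unfolding nonlocal_energy_def L_def local_energy_kernel[OF s] .
qed

theorem nonlocal_energy_tendsto: "(nonlocal_energy \<longlongrightarrow> l2sq covariant_gradient) (at_left 1)"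
proof -
  define \<kappa> where "\<kappa> s = s * m powr (2 * s - 2)" for s
  define l where "l = enn2real (l2sq covariant_gradient)"
  have l: "l2sq covariant_gradient = ennreal l" "l \<ge> 0" using covariant_gradient_l2 by (auto simp: l_def)
  define f where "f s = enn2real (nonlocal_energy s)" for s
  have ev: "\<forall>\<^sub>F s in at_left 1. nonlocal_energy s = ennreal (f s) \<and> f s \<le> (1 + \<epsilon>) * (\<kappa> s * l) + \<epsilon> \<and> \<kappa> s * l \<le> (1 + \<epsilon>) * f s + \<epsilon>"
    if \<epsilon>: "\<epsilon> > 0" for \<epsilon>
  proof -
    have "\<epsilon> / (1 + 1 / \<epsilon>) > 0" using \<epsilon> by (simp add: add_pos_pos)
    note remainder_energy_vanishes[OF this]
    moreover have "\<forall>\<^sub>F s in at_left 1. (0::real) < s \<and> s < 1"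
      by (rule eventually_at_leftI[of 0]) auto
    ultimately show ?thesis
    proof eventually_elim
      case (elim s)
      then have s: "0 < s" "s < 1" by auto
      have \<kappa>: "\<kappa> s \<ge> 0" using s by (simp add: \<kappa>_def)
      have kl: "ennreal (s * m powr (2 * s - 2)) * l2sq covariant_gradient = ennreal (\<kappa> s * l)"
        using \<kappa> by (simp add: l(1) \<kappa>_def ennreal_mult')
      have up: "nonlocal_energy s \<le> ennreal ((1 + \<epsilon>) * (\<kappa> s * l) + \<epsilon>)"
        using energy_comparison(1)[OF s \<epsilon> elim(1)] ennreal_affine[of "1 + \<epsilon>" "\<kappa> s * l" \<epsilon>] \<epsilon> \<kappa> l(2)
        unfolding kl by (simp only: add_nonneg_nonneg mult_nonneg_nonneg zero_le_one less_imp_le)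
      then have fin: "nonlocal_energy s = ennreal (f s)"
        unfolding f_def by (metis ennreal_enn2real ennreal_less_top le_less_trans)
      have f0: "f s \<ge> 0" by (simp add: f_def)
      have "ennreal (\<kappa> s * l) \<le> ennreal ((1 + \<epsilon>) * f s + \<epsilon>)"
        using energy_comparison(2)[OF s \<epsilon> elim(1)] ennreal_affine[of "1 + \<epsilon>" "f s" \<epsilon>] \<epsilon> f0
        unfolding kl fin by (simp only: add_nonneg_nonneg mult_nonneg_nonneg zero_le_one less_imp_le)
      then have "\<kappa> s * l \<le> (1 + \<epsilon>) * f s + \<epsilon>"
        using \<epsilon> f0 by (subst (asm) ennreal_le_iff) auto
      moreover have "f s \<le> (1 + \<epsilon>) * (\<kappa> s * l) + \<epsilon>"
        using up \<epsilon> \<kappa> l(2) unfolding fin by (subst (asm) ennreal_le_iff) auto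
      ultimately show ?case using fin by blast
    qed
  qed
  have "(f \<longlongrightarrow> l) (at_left 1)"
  proof (rule tendsto_of_two_sided_young)
    show "(\<kappa> \<longlongrightarrow> 1) (at_left 1)" unfolding \<kappa>_def[abs_def] by (rule kernel_mass_tendsto[OF m_pos])
    show "\<forall>\<^sub>F s in at_left 1. f s \<le> (1 + \<epsilon>) * (\<kappa> s * l) + \<epsilon> \<and> \<kappa> s * l \<le> (1 + \<epsilon>) * f s + \<epsilon>" if "\<epsilon> > 0" for \<epsilon>
      using ev[OF that] by eventually_elim blast
  qed (rule l(2))
  then have "((\<lambda>s. ennreal (f s)) \<longlongrightarrow> ennreal l) (at_left 1)" by (rule tendsto_ennrealI)
  then show ?thesis
    unfolding l(1)
  proof (rule Lim_transform_eventually)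
    show "\<forall>\<^sub>F s in at_left 1. ennreal (f s) = nonlocal_energy s"
      using ev[of 1] by (auto elim!: eventually_mono)
  qed
qed

lemma nonlocal_energy_eq_double_integral:
  "nonlocal_energy s = (\<integral>\<^sup>+(x, y). bessel_kernel m s (norm (y - x)) * ennreal ((norm (twisted_difference (y - x) x))\<^sup>2) \<partial>lborel)"
proof -
  have [measurable]: "(\<lambda>y. bessel_kernel m s (norm (y - x)) * ennreal ((norm (twisted_difference (y - x) x))\<^sup>2)) \<in> borel_measurable borel" for x
    by measurable
  have "(\<integral>\<^sup>+(x, y). bessel_kernel m s (norm (y - x)) * ennreal ((norm (twisted_difference (y - x) x))\<^sup>2) \<partial>lborel)
      = (\<integral>\<^sup>+x. \<integral>\<^sup>+y. bessel_kernel m s (norm (y - x)) * ennreal ((norm (twisted_difference (y - x) x))\<^sup>2) \<partial>lborel \<partial>lborel)"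
    unfolding lborel_prod[symmetric] by (subst lborel.nn_integral_fst[symmetric]) auto
  also have "\<dots> = (\<integral>\<^sup>+x. \<integral>\<^sup>+v. bessel_kernel m s (norm v) * ennreal ((norm (twisted_difference v x))\<^sup>2) \<partial>lborel \<partial>lborel)"
  proof (rule nn_integral_cong)
    fix x
    show "(\<integral>\<^sup>+y. bessel_kernel m s (norm (y - x)) * ennreal ((norm (twisted_difference (y - x) x))\<^sup>2) \<partial>lborel)
        = (\<integral>\<^sup>+v. bessel_kernel m s (norm v) * ennreal ((norm (twisted_difference v x))\<^sup>2) \<partial>lborel)"
      using nn_integral_translate[of "\<lambda>y. bessel_kernel m s (norm (y - x)) * ennreal ((norm (twisted_difference (y - x) x))\<^sup>2)" x] by simp
  qed
  also have "\<dots> = (\<integral>\<^sup>+v. \<integral>\<^sup>+x. bessel_kernel m s (norm v) * ennreal ((norm (twisted_difference v x))\<^sup>2) \<partial>lborel \<partial>lborel)"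
    by (rule lborel_pair.Fubini') measurable
  also have "\<dots> = nonlocal_energy s"
    unfolding nonlocal_energy_def l2sq_def by (intro nn_integral_cong nn_integral_cmult) measurable
  finally show ?thesis by simp
qed

end

text \<open>Borel representatives are needed because \<open>u(x)\<close> and \<open>u(y)\<close>, as functions of the pair \<open>(x, y)\<close>, must be
measurable for the product of the Borel sigma-algebras when Tonelli's theorem is applied.\<close>

lemma borel_representative:
  fixes f :: "'a::euclidean_space \<Rightarrow> complex"
  assumes [measurable]: "S \<in> sets borel" and f: "(\<lambda>x. indicat_real S x *\<^sub>R f x) \<in> borel_measurable lebesgue"
  shows "\<exists>f0\<in>borel_measurable borel. (\<forall>x. x \<notin> S \<longrightarrow> f0 x = 0) \<and> (AE x in lborel. x \<in> S \<longrightarrow> f x = f0 x)"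
proof -
  have re: "(\<lambda>x. Re (indicat_real S x *\<^sub>R f x)) \<in> borel_measurable lebesgue"
    by (rule measurable_compose[OF f borel_measurable_Re]) 
  have im: "(\<lambda>x. Im (indicat_real S x *\<^sub>R f x)) \<in> borel_measurable lebesgue"
    by (rule measurable_compose[OF f borel_measurable_Im])
  obtain p where [measurable]: "p \<in> borel_measurable lborel" and p: "AE x in lborel. Re (indicat_real S x *\<^sub>R f x) = p x"
    using completion_ex_borel_measurable_real[OF re] by blast
  obtain q where [measurable]: "q \<in> borel_measurable lborel" and q: "AE x in lborel. Im (indicat_real S x *\<^sub>R f x) = q x"
    using completion_ex_borel_measurable_real[OF im] by blast
  define f0 where "f0 x = indicat_real S x *\<^sub>R (complex_of_real (p x) + \<i> * complex_of_real (q x))" for x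
  have "f0 \<in> borel_measurable lborel" unfolding f0_def by measurable
  moreover have "AE x in lborel. x \<in> S \<longrightarrow> f x = f0 x"
    using p q by eventually_elim (auto simp: f0_def complex_eq_iff)
  ultimately show ?thesis by (intro bexI[of _ f0]) (auto simp: f0_def)
qed

text \<open>A weak gradient is given as integrable on compact subsets only; measurability on the whole open
set follows by exhaustion.\<close>

lemma weak_gradient_component_measurable:
  assumes "open S" and w: "has_weak_gradient S u g"
  shows "(\<lambda>x. indicat_real S x *\<^sub>R (g x $ j)) \<in> borel_measurable lebesgue"
proof -
  have "\<exists>C::nat \<Rightarrow> _ set. (\<forall>n. compact (C n) \<and> C n \<subseteq> S) \<and> (\<forall>x\<in>S. \<exists>N. \<forall>n\<ge>N. x \<in> C n)"
  proof (rule open_Union_compact_subsets[OF \<open>open S\<close>])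
    fix C :: "nat \<Rightarrow> _ set"
    assume 1: "\<And>n. compact (C n)" "\<And>n. C n \<subseteq> S" and 2: "\<And>K. compact K \<Longrightarrow> K \<subseteq> S \<Longrightarrow> \<exists>N. \<forall>n\<ge>N. K \<subseteq> C n"
    have "\<exists>N. \<forall>n\<ge>N. x \<in> C n" if "x \<in> S" for x
      using 2[of "{x}"] that by simp
    then show ?thesis using 1 by (intro exI[of _ C]) simp
  qed
  then obtain C where C: "\<And>n. compact (C n)" "\<And>n. C n \<subseteq> S" "\<And>x. x \<in> S \<Longrightarrow> \<exists>N::nat. \<forall>n\<ge>N. x \<in> C n"
    by blast
  show ?thesis
  proof (rule borel_measurable_LIMSEQ_metric)
    show "(\<lambda>x. indicat_real (C n) x *\<^sub>R (g x $ j)) \<in> borel_measurable lebesgue" for n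
    proof -
      have "\<forall>K. compact K \<and> K \<subseteq> S \<longrightarrow> set_integrable lebesgue K (\<lambda>x. g x $ j)"
        by (rule conjunct1[OF spec[OF w[unfolded has_weak_gradient_def], of j]])
      then have "set_integrable lebesgue (C n) (\<lambda>x. g x $ j)" using C(1,2) by simp
      then show ?thesis unfolding set_integrable_def by (rule borel_measurable_integrable)
    qed
    show "(\<lambda>n. indicat_real (C n) x *\<^sub>R (g x $ j)) \<longlonglongrightarrow> indicat_real S x *\<^sub>R (g x $ j)" for x
    proof (cases "x \<in> S")
      case True
      then obtain N where "\<forall>n\<ge>N. x \<in> C n" using C(3) by blast
      then have "\<forall>\<^sub>F n in sequentially. indicat_real (C n) x *\<^sub>R (g x $ j) = indicat_real S x *\<^sub>R (g x $ j)"
        using True by (auto simp: eventually_sequentially indicator_def)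
      then show ?thesis by (rule tendsto_eventually)
    next
      case False
      then have "x \<notin> C n" for n using C(2) by blast
      then show ?thesis using False by simp
    qed
  qed
qed

lemma lebesgue_energy_eq_l2sq:
  fixes h h0 :: "'a::euclidean_space \<Rightarrow> 'b::real_normed_vector"
  assumes "AE x in lborel. x \<in> S \<longrightarrow> h x = h0 x" "\<And>x. x \<notin> S \<Longrightarrow> h0 x = 0"
  shows "(\<integral>\<^sup>+x\<in>S. ennreal ((norm (h x))\<^sup>2) \<partial>lebesgue) = l2sq h0"
  unfolding l2sq_def nn_integral_completion
  by (rule nn_integral_cong_AE) (use assms in \<open>auto elim!: eventually_mono simp: indicator_def\<close>)

lemma lebesgue_pairing_eq:
  fixes h h0 :: "'a::euclidean_space \<Rightarrow> complex" and c :: "'a \<Rightarrow> real"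
  assumes S[measurable]: "S \<in> sets borel" and h: "(\<lambda>x. indicat_real S x *\<^sub>R h x) \<in> borel_measurable lebesgue"
    and [measurable]: "h0 \<in> borel_measurable borel" and c: "continuous_on UNIV c"
    and ae: "AE x in lborel. x \<in> S \<longrightarrow> h x = h0 x" and "\<And>x. x \<notin> S \<Longrightarrow> h0 x = 0"
  shows "(LINT x:S|lebesgue. c x *\<^sub>R h x) = (LINT x|lborel. c x *\<^sub>R h0 x)"
proof -
  have [measurable]: "c \<in> borel_measurable borel" by (intro borel_measurable_continuous_onI c)
  have c': "c \<in> borel_measurable lebesgue" by (intro measurable_completion) simp
  have h0': "(\<lambda>x. c x *\<^sub>R h0 x) \<in> borel_measurable lborel" by measurable
  have "(LINT x:S|lebesgue. c x *\<^sub>R h x) = (LINT x|lebesgue. c x *\<^sub>R (indicat_real S x *\<^sub>R h x))"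
    unfolding set_lebesgue_integral_def by (simp add: mult.commute)
  also have "\<dots> = (LINT x|lebesgue. c x *\<^sub>R h0 x)"
  proof (rule integral_cong_AE)
    show "(\<lambda>x. c x *\<^sub>R (indicat_real S x *\<^sub>R h x)) \<in> borel_measurable lebesgue"
      by (rule borel_measurable_scaleR[OF c' h])
    show "(\<lambda>x. c x *\<^sub>R h0 x) \<in> borel_measurable lebesgue" by (rule measurable_completion[OF h0'])
    show "AE x in lebesgue. c x *\<^sub>R (indicat_real S x *\<^sub>R h x) = c x *\<^sub>R h0 x"
      by (rule AE_completion) (use ae assms(6) in \<open>auto elim!: eventually_mono simp: indicator_def\<close>)
  qed
  also have "\<dots> = (LINT x|lborel. c x *\<^sub>R h0 x)" by (rule integral_completion[OF h0'])
  finally show ?thesis .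
qed

lemma AE_lborel_prodI:
  fixes P :: "'a::euclidean_space \<Rightarrow> bool"
  assumes "AE x in lborel. P x"
  shows "AE p in (lborel :: ('a \<times> 'a) measure). P (fst p) \<and> P (snd p)"
proof -
  obtain N where N: "N \<in> null_sets lborel" "{x. \<not> P x} \<subseteq> N"
    using AE_E2[OF assms] assms by (auto elim!: AE_E simp: null_sets_def)
  then have [measurable]: "N \<in> sets borel" by (simp add: null_sets_def)
  have "N \<times> UNIV \<in> null_sets (lborel \<Otimes>\<^sub>M lborel)" "UNIV \<times> N \<in> null_sets (lborel \<Otimes>\<^sub>M lborel)"
    using N(1) by (auto simp: null_sets_def lborel.emeasure_pair_measure_Times)
  then have "AE p in lborel \<Otimes>\<^sub>M lborel. p \<notin> N \<times> (UNIV :: 'a set)" "AE p in lborel \<Otimes>\<^sub>M lborel. p \<notin> (UNIV :: 'a set) \<times> N"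
    by (auto intro: AE_not_in)
  then have "AE p in lborel \<Otimes>\<^sub>M lborel. P (fst p) \<and> P (snd p)"
    by eventually_elim (use N(2) in auto)
  then show ?thesis unfolding lborel_prod .
qed

theorem theorem1p3:
  fixes m :: real and \<Omega> :: "(real^3) set" and A :: "real^3 \<Rightarrow> real^3" and u :: "real^3 \<Rightarrow> complex"
  assumes "m > 0"
    and "open \<Omega>" "bounded \<Omega>" "lipschitz_boundary \<Omega>"
    and "continuous_on UNIV A" "locally_bounded_gradient A" "C_closure 2 \<Omega> A"
    and "u \<in> H1_magnetic \<Omega> A"
  shows "((\<lambda>s. ennreal (C_const s / 2 * m powr ((3 + 2 * s) / 2)) *
            (\<integral>\<^sup>+(x, y)\<in>\<Omega> \<times> \<Omega>. ennreal
                ((cmod (u x - exp (\<i> * complex_of_real ((x - y) \<bullet> A ((1 / 2) *\<^sub>R (x + y)))) * u y))\<^sup>2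
                 / norm (x - y) powr ((3 + 2 * s) / 2)
                 * bessel_K ((3 + 2 * s) / 2) (m * norm (x - y))) \<partial>lebesgue))
          \<longlongrightarrow> (\<integral>\<^sup>+x\<in>\<Omega>. ennreal ((norm (magnetic_gradient \<Omega> A u x))\<^sup>2) \<partial>lebesgue))
         (at_left 1)"
proof -
  let ?J = "\<lambda>u s x y. ennreal
    ((cmod (u x - exp (\<i> * complex_of_real ((x - y) \<bullet> A ((1 / 2) *\<^sub>R (x + y)))) * u y))\<^sup>2
      / norm (x - y) powr ((3 + 2 * s) / 2)
      * bessel_K ((3 + 2 * s) / 2) (m * norm (x - y)))"
  define G where "G = weak_gradient \<Omega> u"
  have "\<exists>g. has_weak_gradient \<Omega> u g" using assms(8) by (simp add: H1_magnetic_def)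
  then have G: "has_weak_gradient \<Omega> u G"
    unfolding G_def weak_gradient_def by (rule someI_ex)
  have \<Omega>[measurable]: "\<Omega> \<in> sets borel" using assms(2) by simp
  have "u \<in> borel_measurable (lebesgue_on \<Omega>)" using assms(8) by (simp add: H1_magnetic_def L2_on_def)
  then have u_leb: "(\<lambda>x. indicat_real \<Omega> x *\<^sub>R u x) \<in> borel_measurable lebesgue"
    by (subst (asm) borel_measurable_restrict_space_iff) auto
  obtain u0 where u0[measurable]: "u0 \<in> borel_measurable borel" and u0_out: "\<And>x. x \<notin> \<Omega> \<Longrightarrow> u0 x = 0"
    and u0_ae: "AE x in lborel. x \<in> \<Omega> \<longrightarrow> u x = u0 x"
    using borel_representative[OF \<Omega> u_leb] by blast
  have G_leb: "(\<lambda>x. indicat_real \<Omega> x *\<^sub>R (G x $ j)) \<in> borel_measurable lebesgue" for j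
    by (rule weak_gradient_component_measurable[OF assms(2) G])
  have "\<forall>j. \<exists>f0. f0 \<in> borel_measurable borel \<and> (\<forall>x. x \<notin> \<Omega> \<longrightarrow> f0 x = 0) \<and> (AE x in lborel. x \<in> \<Omega> \<longrightarrow> G x $ j = f0 x)"
    using borel_representative[OF \<Omega> G_leb] unfolding Bex_def by (rule allI)
  from choice[OF this] obtain G0 where reps: "\<forall>j. G0 j \<in> borel_measurable borel
      \<and> (\<forall>x. x \<notin> \<Omega> \<longrightarrow> G0 j x = 0) \<and> (AE x in lborel. x \<in> \<Omega> \<longrightarrow> G x $ j = G0 j x)" ..
  have G0[measurable]: "G0 j \<in> borel_measurable borel" for j by (rule conjunct1[OF spec[OF reps]])
  have G0_out: "G0 j x = 0" if "x \<notin> \<Omega>" for j x using spec[OF reps, of j] that by blast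
  have G0_ae: "AE x in lborel. x \<in> \<Omega> \<longrightarrow> G x $ j = G0 j x" for j
    by (rule conjunct2[OF conjunct2[OF spec[OF reps]]])
  define g0 where "g0 x = (\<chi> j. G0 j x)" for x
  have g0[measurable]: "g0 \<in> borel_measurable borel"
    unfolding g0_def by (rule borel_measurable_vec_lambda) (rule G0)
  define B where "B x = (\<chi> j. \<i> * complex_of_real (A x $ j) * u0 x)" for x
  have B[measurable]: "B \<in> borel_measurable borel"
    unfolding B_def by (rule potential_term_measurable[OF assms(5) u0])
  define W where "W x = (\<chi> j. g0 x $ j - \<i> * complex_of_real (A x $ j) * u0 x)" for x
  have W_eq: "g0 x = W x + B x" for x by (simp add: W_def B_def vec_eq_iff)
  have W[measurable]: "W \<in> borel_measurable borel"
  proof -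
    have "W = (\<lambda>x. g0 x - B x)" using W_eq by (auto simp: fun_eq_iff)
    then show ?thesis by simp
  qed
  have "AE x in lborel. \<forall>j\<in>UNIV. x \<in> \<Omega> \<longrightarrow> G x $ j = G0 j x"
    by (rule AE_finite_allI) (use G0_ae in auto)
  with u0_ae have W_ae: "AE x in lborel. x \<in> \<Omega> \<longrightarrow> magnetic_gradient \<Omega> A u x = W x"
    by eventually_elim (auto simp: magnetic_gradient_def W_def g0_def G_def vec_eq_iff)
  have W_out: "W x = 0" if "x \<notin> \<Omega>" for x using that by (simp add: W_def g0_def G0_out u0_out vec_eq_iff)
  have rhs: "(\<integral>\<^sup>+x\<in>\<Omega>. ennreal ((norm (magnetic_gradient \<Omega> A u x))\<^sup>2) \<partial>lebesgue) = l2sq W"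
    by (rule lebesgue_energy_eq_l2sq[OF W_ae W_out])
  have u0_l2: "l2sq u0 < \<infinity>"
    using lebesgue_energy_eq_l2sq[OF u0_ae u0_out] assms(8) by (simp add: H1_magnetic_def L2_on_def)
  have W_l2: "l2sq W < \<infinity>"
    using rhs assms(8) by (simp add: H1_magnetic_def)
  have B_l2: "l2sq B < \<infinity>"
    unfolding B_def[abs_def] by (rule potential_term_l2[OF assms(5,3) u0 u0_out u0_l2])
  have "l2sq g0 \<le> 2 * l2sq W + 2 * l2sq B"
    unfolding W_eq[abs_def] by (rule l2sq_add_le[OF W B])
  also have "\<dots> < \<infinity>" using W_l2 B_l2 by (simp add: ennreal_mult_less_top)
  finally have g0_l2: "l2sq g0 < \<infinity>" .
  have sob: "sobolev_function \<Omega> u0 g0"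
  proof
    fix j \<phi> \<psi>
    assume test: "test_function \<Omega> \<phi>" and part: "\<And>x. has_partial_derivative \<phi> j x (\<psi> x)"
      and cont: "continuous_on UNIV \<phi>" "continuous_on UNIV \<psi>"
    have "(LINT x|lborel. \<psi> x *\<^sub>R u0 x) = (LINT x:\<Omega>|lebesgue. \<psi> x *\<^sub>R u x)"
      by (rule lebesgue_pairing_eq[OF \<Omega> u_leb u0 cont(2) u0_ae u0_out, symmetric])
    also have "\<dots> = - (LINT x:\<Omega>|lebesgue. \<phi> x *\<^sub>R (G x $ j))"
    proof -
      have "\<forall>\<phi> \<psi>. test_function \<Omega> \<phi> \<and> (\<forall>x. has_partial_derivative \<phi> j x (\<psi> x)) \<longrightarrow>
          (LINT x:\<Omega>|lebesgue. \<psi> x *\<^sub>R u x) = - (LINT x:\<Omega>|lebesgue. \<phi> x *\<^sub>R (G x $ j))"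
        by (rule conjunct2[OF spec[OF G[unfolded has_weak_gradient_def], of j]])
      from mp[OF spec[OF spec[OF this, of \<phi>], of \<psi>]] test part show ?thesis by blast
    qed
    also have "(LINT x:\<Omega>|lebesgue. \<phi> x *\<^sub>R (G x $ j)) = (LINT x|lborel. \<phi> x *\<^sub>R G0 j x)"
      by (rule lebesgue_pairing_eq[OF \<Omega> G_leb G0 cont(1) G0_ae G0_out])
    finally show "(LINT x|lborel. \<psi> x *\<^sub>R u0 x) = - (LINT x|lborel. \<phi> x *\<^sub>R (g0 x $ j))"
      by (simp add: g0_def)
  qed (use assms u0_l2 g0_l2 u0_out G0_out in \<open>auto simp: g0_def[abs_def, symmetric] vec_eq_iff g0_def\<close>)
  obtain E r where E: "finite E" "r > 0"
    "\<And>x v. x \<in> \<Omega> \<Longrightarrow> x + v \<in> \<Omega> \<Longrightarrow> norm v < r \<Longrightarrow> \<exists>a\<in>E. detour_inside \<Omega> a x v"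
    using lipschitz_boundary_detours[OF assms(2-4)] by blast
  interpret sobolev_function \<Omega> u0 g0 by (rule sob)
  interpret magnetic_sobolev_3 \<Omega> u0 g0 A E r m
    by unfold_locales (use assms(1,5) E in auto)
  have W_cov: "covariant_gradient = W" by (auto simp: fun_eq_iff covariant_gradient_def W_def)
  have "ennreal (C_const s / 2 * m powr ((3 + 2 * s) / 2)) * (\<integral>\<^sup>+(x, y)\<in>\<Omega> \<times> \<Omega>. ?J u s x y \<partial>lebesgue) = nonlocal_energy s"
    if s: "0 < s" "s < 1" for s
  proof -
    define c where "c = C_const s / 2 * m powr ((3 + 2 * s) / 2)"
    have c: "c > 0" using C_const_pos[OF s] assms(1) by (simp add: c_def)
    \<comment> \<open>the measurable form of the integrand, in which the constant has been absorbed by the kernel\<close>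
    define H where "H x y = bessel_kernel m s (norm (y - x)) * ennreal ((norm (twisted_difference (y - x) x))\<^sup>2)" for x y
    have [measurable]: "(\<lambda>(x, y). H x y) \<in> borel_measurable (lborel \<Otimes>\<^sub>M lborel)" unfolding H_def by measurable
    have H_meas: "(\<lambda>(x, y). H x y) \<in> borel_measurable lborel"
      unfolding lborel_prod[symmetric] by measurable
    have pointwise: "?J u0 s x y
        = ennreal (1 / c) * H x y" if xy: "x \<in> \<Omega>" "y \<in> \<Omega>" for x y
    proof (cases "x = y")
      case False
      define X where "X = ?J u0 s x y"
      have mid: "x + (1 / 2) *\<^sub>R (y - x) = (1 / 2) *\<^sub>R (x + y)"
        by (simp add: vec_eq_iff field_simps)
      have "- ((y - x) \<bullet> a) = (x - y) \<bullet> a" for a by (simp add: inner_diff_left)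
      moreover have "x + (y - x) = y" by simp
      ultimately have "twisted_difference (y - x) x = exp (\<i> * complex_of_real ((x - y) \<bullet> A ((1 / 2) *\<^sub>R (x + y)))) * u0 y - u0 x"
        using xy by (simp only: twisted_difference_def mid simp_thms if_True)
      then have "ennreal c * X = ennreal ((norm (twisted_difference (y - x) x))\<^sup>2) * bessel_kernel m s (norm (x - y))"
        unfolding X_def c_def using False s assms(1)
        by (subst bessel_kernel_eq) (auto simp: norm_minus_commute)
      also have "\<dots> = H x y" by (simp add: H_def mult.commute norm_minus_commute)
      finally have "ennreal (1 / c) * (ennreal c * X) = ennreal (1 / c) * H x y" by simp
      moreover have "ennreal (1 / c) * (ennreal c * X) = X"
      proof -
        have "ennreal (1 / c) * ennreal c = 1" using c by (simp flip: ennreal_mult')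
        then show ?thesis by (simp flip: mult.assoc)
      qed
      ultimately show ?thesis by (simp add: X_def)
    qed (simp add: H_def twisted_difference_def)
    have H_out: "H x y = 0" if "\<not> (x \<in> \<Omega> \<and> y \<in> \<Omega>)" for x y
    proof -
      have "twisted_difference (y - x) x = 0" using that by (auto simp: twisted_difference_def)
      then show ?thesis by (simp add: H_def)
    qed
    have "(\<integral>\<^sup>+(x, y)\<in>\<Omega> \<times> \<Omega>. ?J u s x y \<partial>lebesgue)
        = (\<integral>\<^sup>+p. ennreal (1 / c) * (case p of (x, y) \<Rightarrow> H x y) \<partial>lborel)"
      unfolding nn_integral_completion
    proof (rule nn_integral_cong_AE)
      from AE_lborel_prodI[OF u0_ae]
      show "AE p in lborel. (case p of (x, y) \<Rightarrow> ?J u s x y) * indicator (\<Omega> \<times> \<Omega>) p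
          = ennreal (1 / c) * (case p of (x, y) \<Rightarrow> H x y)"
      proof eventually_elim
        case (elim p)
        obtain x y where p: "p = (x, y)" by (cases p)
        show ?case
        proof (cases "x \<in> \<Omega> \<and> y \<in> \<Omega>")
          case True
          then show ?thesis using elim pointwise[of x y] by (simp add: p)
        next
          case False
          then show ?thesis using H_out[OF False] by (simp add: p indicator_def)
        qed
      qed
    qed
    also have "\<dots> = ennreal (1 / c) * (\<integral>\<^sup>+p. (case p of (x, y) \<Rightarrow> H x y) \<partial>lborel)"
      by (rule nn_integral_cmult[OF H_meas])
    also have "(\<integral>\<^sup>+p. (case p of (x, y) \<Rightarrow> H x y) \<partial>lborel) = nonlocal_energy s"
      unfolding nonlocal_energy_eq_double_integral H_def ..
    finally have "ennreal c * (\<integral>\<^sup>+(x, y)\<in>\<Omega> \<times> \<Omega>. ?J u s x y \<partial>lebesgue) = ennreal c * (ennreal (1 / c) * nonlocal_energy s)"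
      by (simp only:)
    also have "\<dots> = nonlocal_energy s"
    proof -
      have "ennreal c * ennreal (1 / c) = 1" using c by (simp flip: ennreal_mult')
      then show ?thesis by (simp flip: mult.assoc)
    qed
    finally show ?thesis by (simp only: c_def)
  qed
  note representation = this
  show ?thesis
    unfolding rhs W_cov[symmetric]
  proof (rule Lim_transform_eventually[OF nonlocal_energy_tendsto])
    show "\<forall>\<^sub>F s in at_left 1. nonlocal_energy s = ennreal (C_const s / 2 * m powr ((3 + 2 * s) / 2)) * (\<integral>\<^sup>+(x, y)\<in>\<Omega> \<times> \<Omega>. ?J u s x y \<partial>lebesgue)"
      by (rule eventually_at_leftI[of 0]) (use representation in auto)
  qed
qed

end
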